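(* Let $\mu,\nu\in\mathbb{C}$, let $N\ge 0$ be an integer, and define the remainder $R_N(z,\mu,\nu)$ by $$S_{\mu,\nu}(z)=z^{\mu-1}\sum_{n=0}^{N-1}(-1)^n\frac{a_n(-\mu,\nu)}{z^{2n}}+R_N(z,\mu,\nu).$$ If $|\arg z|<\frac{\pi}{2}$ and $\Re(\mu)+|\Re(\nu)|<2N+1$, then $$R_N(z,\mu,\nu)=(-1)^N\frac{2^{\mu+1}z^{\mu-2N-1}}{\Gamma\left(\frac{\nu-\mu+1}{2}\right)\Gamma\left(\frac{1-\mu-\nu}{2}\right)}\int_0^{+\infty}\frac{t^{2N-\mu}K_\nu(t)}{1+(t/z)^2}\,dt .$$
   Context: $S_{\mu,\nu}$ is the Lommel function: $S_{\mu,\nu}(z)=s_{\mu,\nu}(z)+2^{\mu-1}\Gamma\left(\frac{\mu-\nu+1}{2}\right)\Gamma\left(\frac{\mu+\nu+1}{2}\right)\left(\sin\left(\frac{(\mu-\nu)\pi}{2}\right)J_\nu(z)-\cos\left(\frac{(\mu-\nu)\pi}{2}\right)Y_\nu(z)\right)$, where $s_{\mu,\nu}(z)=\frac{z^{\mu+1}}{(\mu+1)^2-\nu^2}\,{}_1F_2\left(1;\frac{\mu-\nu+3}{2},\frac{\mu+\nu+3}{2};-\frac{z^2}{4}\right)$ (limiting values understood at exceptional parameters). $J_\nu,Y_\nu$ are Bessel functions, $K_\nu$ the modified Bessel function of the second kind. The coefficients are $a_n(\mu,\nu)=\prod_{k=1}^n\left((\mu+2k-1)^2-\nu^2\right)=2^{2n}\left(\frac{\mu-\nu+1}{2}\right)_n\left(\frac{\mu+\nu+1}{2}\right)_n$,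 with $(x)_n=\Gamma(x+n)/\Gamma(x)$. Empty sums are zero. Principal branches of powers are used. *)

theory Defs
  imports "HOL-Analysis.Analysis"
begin

definition hyp1F2 :: "complex \<Rightarrow> complex \<Rightarrow> complex \<Rightarrow> complex \<Rightarrow> complex" where
  "hyp1F2 a b1 b2 x =
     (\<Sum>k. pochhammer a k / (pochhammer b1 k * pochhammer b2 k) * x ^ k / of_nat (fact k))"

definition besselJ :: "complex \<Rightarrow> complex \<Rightarrow> complex" where
  "besselJ \<nu> z = (z / 2) powr \<nu> *
     (\<Sum>k. (-1) ^ k * (z / 2) ^ (2 * k) / of_nat (fact k) * rGamma (\<nu> + of_nat k + 1))"

definition besselI :: "complex \<Rightarrow> complex \<Rightarrow> complex" where
  "besselI \<nu> z = (z / 2) powr \<nu> *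
     (\<Sum>k. (z / 2) ^ (2 * k) / of_nat (fact k) * rGamma (\<nu> + of_nat k + 1))"

definition besselY_aux :: "complex \<Rightarrow> complex \<Rightarrow> complex" where
  "besselY_aux \<nu> z = (besselJ \<nu> z * cos (\<nu> * of_real pi) - besselJ (-\<nu>) z) / sin (\<nu> * of_real pi)"

definition besselY :: "complex \<Rightarrow> complex \<Rightarrow> complex" where
  "besselY \<nu> z = (if \<nu> \<in> \<int> then Lim (at \<nu>) (\<lambda>m. besselY_aux m z) else besselY_aux \<nu> z)"

definition besselK_aux :: "complex \<Rightarrow> complex \<Rightarrow> complex" where
  "besselK_aux \<nu> z = (of_real pi / 2) * (besselI (-\<nu>) z - besselI \<nu> z) / sin (\<nu> * of_real pi)"

definition besselK :: "complex \<Rightarrow> complex \<Rightarrow> complex" where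
  "besselK \<nu> z = (if \<nu> \<in> \<int> then Lim (at \<nu>) (\<lambda>m. besselK_aux m z) else besselK_aux \<nu> z)"

definition lommel_s :: "complex \<Rightarrow> complex \<Rightarrow> complex \<Rightarrow> complex" where
  "lommel_s \<mu> \<nu> z = z powr (\<mu> + 1) / ((\<mu> + 1)\<^sup>2 - \<nu>\<^sup>2) *
     hyp1F2 1 ((\<mu> - \<nu> + 3) / 2) ((\<mu> + \<nu> + 3) / 2) (- (z\<^sup>2) / 4)"

definition lommel_S_formula :: "complex \<Rightarrow> complex \<Rightarrow> complex \<Rightarrow> complex" where
  "lommel_S_formula \<mu> \<nu> z = lommel_s \<mu> \<nu> z +
     2 powr (\<mu> - 1) * Gamma ((\<mu> - \<nu> + 1) / 2) * Gamma ((\<mu> + \<nu> + 1) / 2) *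
     (sin ((\<mu> - \<nu>) * of_real pi / 2) * besselJ \<nu> z - cos ((\<mu> - \<nu>) * of_real pi / 2) * besselY \<nu> z)"

definition lommel_exceptional :: "complex \<Rightarrow> complex \<Rightarrow> bool" where
  "lommel_exceptional \<mu> \<nu> \<longleftrightarrow>
     (\<exists>k::nat. \<mu> - \<nu> = - (2 * of_nat k + 1) \<or> \<mu> + \<nu> = - (2 * of_nat k + 1))"

definition lommelS :: "complex \<Rightarrow> complex \<Rightarrow> complex \<Rightarrow> complex" where
  "lommelS \<mu> \<nu> z = (if lommel_exceptional \<mu> \<nu>
      then Lim (at \<mu>) (\<lambda>m. lommel_S_formula m \<nu> z)
      else lommel_S_formula \<mu> \<nu> z)"

definition lommel_a :: "nat \<Rightarrow> complex \<Rightarrow> complex \<Rightarrow> complex" where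
  "lommel_a n \<mu> \<nu> = (\<Prod>k=1..n. (\<mu> + 2 * of_nat k - 1)\<^sup>2 - \<nu>\<^sup>2)"

definition lommel_R :: "nat \<Rightarrow> complex \<Rightarrow> complex \<Rightarrow> complex \<Rightarrow> complex" where
  "lommel_R N z \<mu> \<nu> = lommelS \<mu> \<nu> z -
     z powr (\<mu> - 1) * (\<Sum>n<N. (-1) ^ n * lommel_a n (-\<mu>) \<nu> / z ^ (2 * n))"

end

theory Submission
  imports Defs "HOL-Real_Asymp.Real_Asymp"
begin

text \<open>
  In the variable \<open>y = t\<^sup>2 / 4\<close> the integral is a Stieltjes transform of \<open>K\<^sub>\<nu>(2 \<surd>y)\<close>, and it is
  evaluated without Mellin--Barnes contours. Cut the integral of \<open>\<phi>(t) \<psi>(1/t) / t\<close> at a point \<open>T\<close>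
  and expand \<open>\<phi>\<close> on \<open>(0, T]\<close> and \<open>\<psi>\<close> on \<open>(0, 1/T]\<close> in powers: the two resulting series combine into
  sums of the coefficients of one function against the finite-part Mellin moments of the other.
  Finite-part moments are found from the convergent ones by the recurrences that partial integration
  gives. For \<open>\<phi> = e\<^sup>-\<^sup>x\<close> and \<open>\<psi>(u) = u\<^sup>\<nu> exp (- y u)\<close> this identifies the integral representation of
  \<open>K\<^sub>\<nu>\<close> with its power series; for \<open>\<phi> = y\<^sup>b K\<^sub>\<nu>\<close> and \<open>\<psi>(u) = u / (1 + \<zeta> u)\<close>, \<open>\<zeta> = z\<^sup>2 / 4\<close>, the poles of
  the first function yield the Bessel part of \<open>S\<^sub>\<mu>\<^sub>,\<^sub>\<nu>\<close> and those of the second yield \<open>s\<^sub>\<mu>\<^sub>,\<^sub>\<nu>\<close>. This is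
  the case \<open>N = 0\<close> for generic parameters. The step from \<open>(N, \<mu>)\<close> to \<open>(N + 1, \<mu> + 2)\<close> multiplies both sides
  by \<open>\<nu>\<^sup>2 - (\<mu> + 1)\<^sup>2\<close>, and the remaining parameters follow by continuity.
\<close>

section \<open>Integration of series and parametrised sums\<close>

text \<open>At integer order \<open>besselK\<close> and \<open>besselY\<close>, and at exceptional
  parameters \<open>lommelS\<close>, are values of \<open>Lim\<close>, which say something only if
  the limits exist. For \<open>besselK\<close> existence comes from the integral \<open>kk\<close>,
  which is continuous in the order; for \<open>besselY\<close> and \<open>lommelS\<close> it comes
  from the integral representation itself, once that holds nearby. This fixes the order of the
  passages: first \<mu> for which both Gamma arguments have non-integer real part, then regular
  \<mu>, both with \<nu> not an integer; then integer \<nu>; exceptional \<mu> last. The demand on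
  real parts stems from the Cauchy kernel. Its ordinary moments exist only in the strip between -1
  and 0, and the recurrence that leaves this strip reaches the other open strips to its left, but
  not the lines that separate them. Finite parts are needed because neither expansion can be
  integrated termwise over the whole half line: a term of one expansion against the other function
  diverges at one of the two ends.\<close>

lemma integral_infsum:
  fixes f :: "'i::countable \<Rightarrow> real \<Rightarrow> complex"
  assumes f: "\<And>i. f i absolutely_integrable_on S" and S: "S \<in> sets lebesgue"
    and sm: "(\<lambda>i. integral S (\<lambda>x. norm (f i x))) summable_on UNIV"
    and hs: "\<And>x. x \<in> S \<Longrightarrow> ((\<lambda>i. f i x) has_sum F x) UNIV"
  shows "F absolutely_integrable_on S" and "((\<lambda>i. integral S (f i)) has_sum integral S F) UNIV"
proof -
  let ?M = "lebesgue_on S"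
  \<comment> \<open>Naturals outside the range of \<open>to_nat\<close> carry zero terms, which
    turns the family into a sequence for \<open>sums_integral\<close>; \<open>reidx\<close> carries
    sums back and forth.\<close>
  define g where "g n = (if n \<in> range (to_nat::'i\<Rightarrow>nat) then f (from_nat n) else (\<lambda>x. 0))" for n
  have bij: "bij_betw (to_nat::'i\<Rightarrow>nat) UNIV (range (to_nat::'i\<Rightarrow>nat))"
    by (simp add: bij_betw_def)
  have gi: "g n absolutely_integrable_on S" for n
    using f by (auto simp: g_def)
  have gi': "integrable ?M (g n)" for n
    using gi S by (rule absolutely_integrable_imp_integrable)
  have reidx: "(h has_sum s) UNIV \<longleftrightarrow> (k has_sum s) UNIV"
    if "\<And>i. k (to_nat i) = h i" "\<And>n. n \<notin> range (to_nat::'i\<Rightarrow>nat) \<Longrightarrow> k n = 0"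
    for h :: "'i \<Rightarrow> 'z::{topological_comm_monoid_add,t2_space}" and k :: "nat \<Rightarrow> 'z" and s
  proof -
    have "(h has_sum s) UNIV \<longleftrightarrow> (k has_sum s) (range (to_nat::'i\<Rightarrow>nat))"
      using has_sum_reindex_bij_betw[OF bij, of k s] that(1) by simp
    also have "\<dots> \<longleftrightarrow> (k has_sum s) UNIV"
      using that(2) by (intro has_sum_cong_neutral) auto
    finally show ?thesis .
  qed
  have g1: "((\<lambda>n. g n x) has_sum F x) UNIV" if "x \<in> S" for x
    using hs[OF that] by (subst reidx[symmetric, where h = "\<lambda>i. f i x"]) (auto simp: g_def)
  have g2: "summable (\<lambda>n. norm (g n x))" if "x \<in> S" for x
    using has_sum_imp_summable[OF g1[OF that]]
    by (subst (asm) summable_on_iff_abs_summable_on_complex) (rule summable_on_imp_summable)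
  have g3: "summable (\<lambda>n. integral S (\<lambda>x. norm (g n x)))"
  proof -
    from sm obtain s where "((\<lambda>i. integral S (\<lambda>x. norm (f i x))) has_sum s) UNIV"
      using summable_on_def by blast
    hence "((\<lambda>n. integral S (\<lambda>x. norm (g n x))) has_sum s) UNIV"
      by (subst reidx[symmetric, where h = "\<lambda>i. integral S (\<lambda>x. norm (f i x))"]) (auto simp: g_def)
    thus ?thesis using has_sum_imp_summable summable_on_imp_summable by blast
  qed
  have nrm: "integral\<^sup>L ?M (\<lambda>x. norm (g n x)) = integral S (\<lambda>x. norm (g n x))" for n
    by (intro lebesgue_integral_eq_integral S integrable_norm gi')
  have A: "AE x in ?M. summable (\<lambda>i. norm (g i x))"
    using g2 by (intro AE_I2) simp
  have B: "summable (\<lambda>n. integral\<^sup>L ?M (\<lambda>x. norm (g n x)))"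
    using g3 by (simp add: nrm)
  have eqF: "(\<Sum>n. g n x) = F x" if "x \<in> S" for x
    using has_sum_imp_sums[OF g1[OF that]] by (simp add: sums_iff)
  have I: "integrable ?M (\<lambda>x. \<Sum>n. g n x)"
    by (rule integrable_suminf[OF gi' A B])
  hence "integrable ?M F"
    by (subst Bochner_Integration.integrable_cong[of ?M ?M F "\<lambda>x. \<Sum>n. g n x"]) (auto simp: eqF)
  thus "F absolutely_integrable_on S"
    by (simp add: S integrable_restrict_space set_integrable_def)
  have gs: "(\<lambda>n. integral\<^sup>L ?M (g n)) sums integral\<^sup>L ?M (\<lambda>x. \<Sum>n. g n x)"
    by (rule sums_integral[OF gi' A B])
  have "integral\<^sup>L ?M (\<lambda>x. \<Sum>n. g n x) = integral\<^sup>L ?M F"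
    by (intro Bochner_Integration.integral_cong) (auto simp: eqF)
  hence gs': "(\<lambda>n. integral S (g n)) sums integral S F"
    using gs lebesgue_integral_eq_integral[OF gi' S] lebesgue_integral_eq_integral[OF \<open>integrable ?M F\<close> S] by simp
  have "summable (\<lambda>n. norm (integral S (g n)))"
  proof (rule summable_comparison_test'[OF g3])
    show "norm (norm (integral S (g n))) \<le> integral S (\<lambda>x. norm (g n x))" for n
      using gi[of n] by (auto intro!: integral_norm_bound_integral set_lebesgue_integral_eq_integral(1) simp: absolutely_integrable_on_def)
  qed
  hence "((\<lambda>n. integral S (g n)) has_sum integral S F) UNIV"
    using gs' by (rule norm_summable_imp_has_sum)
  moreover have "((\<lambda>i. integral S (f i)) has_sum v) UNIV \<longleftrightarrow> ((\<lambda>n. integral S (g n)) has_sum v) UNIV" for v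
    by (rule reidx) (auto simp: g_def)
  ultimately show "((\<lambda>i. integral S (f i)) has_sum integral S F) UNIV"
    by blast
qed

lemma absolutely_integrable_mult_bounded:
  fixes f g :: "real \<Rightarrow> complex"
  assumes f: "f absolutely_integrable_on S" and S: "S \<in> sets lebesgue"
    and g: "continuous_on S g" and B: "\<And>x. x \<in> S \<Longrightarrow> norm (g x) \<le> B"
  shows "(\<lambda>x. g x * f x) absolutely_integrable_on S"
proof (rule measurable_bounded_by_integrable_imp_absolutely_integrable)
  show "(\<lambda>x. g x * f x) \<in> borel_measurable (lebesgue_on S)"
    using g f S by (intro borel_measurable_times continuous_imp_measurable_on_sets_lebesgue
        absolutely_integrable_imp_borel_measurable)
  show "(\<lambda>x. B * norm (f x)) integrable_on S"
    using f by (intro integrable_on_mult_right) (simp add: absolutely_integrable_on_def)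
  show "norm (g x * f x) \<le> B * norm (f x)" if "x \<in> S" for x
    using B[OF that] by (simp add: norm_mult mult_right_mono)
qed (rule S)

lemma powr_of_real_exp: "x > 0 \<Longrightarrow> complex_of_real x powr s = exp (s * of_real (ln x))"
  by (simp add: powr_def Ln_of_real)

lemma norm_of_real_powr: "x > 0 \<Longrightarrow> norm (complex_of_real x powr s) = x powr Re s"
  by (simp add: norm_powr_real_powr)

lemma continuous_on_of_real_powr [continuous_intros]:
  "(\<And>x. x \<in> S \<Longrightarrow> x > 0) \<Longrightarrow> continuous_on S (\<lambda>x. complex_of_real x powr s)"
  by (intro continuous_intros) (auto simp: complex_nonpos_Reals_iff less_imp_le)

text \<open>The ratio condition, uniform in p, builds the majorant for Tannery's theorem: limit
  terms plus 1 up to K, then a geometric tail with ratio 1/2. Pointwise limits control only finitely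
  many terms, hence the split at K.\<close>

lemma suminf_tendsto_ratio:
  fixes f :: "nat \<Rightarrow> 'p \<Rightarrow> complex"
  assumes lim: "\<And>k. (f k \<longlongrightarrow> g k) F"
    and ratio: "eventually (\<lambda>p. \<forall>k\<ge>K. norm (f (Suc k) p) \<le> norm (f k p) / 2) F"
  shows "((\<lambda>p. \<Sum>k. f k p) \<longlongrightarrow> (\<Sum>k. g k)) F"
proof -
  define M where "M k = (if k \<le> K then norm (g k) + 1 else (norm (g K) + 1) / 2 ^ (k - K))" for k
  have ev1: "eventually (\<lambda>p. norm (f k p) \<le> norm (g k) + 1) F" for k
  proof -
    have "eventually (\<lambda>p. dist (f k p) (g k) < 1) F"
      using lim tendstoD zero_less_one by blast
    thus ?thesis
      by eventually_elim (use norm_triangle_ineq2 in \<open>smt (verit) dist_norm\<close>)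
  qed
  have ev2: "eventually (\<lambda>p. \<forall>k\<in>{..K}. norm (f k p) \<le> norm (g k) + 1) F"
    using ev1 by (intro eventually_ball_finite) auto
  have ev: "eventually (\<lambda>p. \<forall>k. norm (f k p) \<le> M k) F"
    using ev2 ratio
  proof eventually_elim
    case (elim p)
    have "norm (f (K + n) p) \<le> (norm (g K) + 1) / 2 ^ n" for n
    proof (induction n)
      case (Suc n)
      have "norm (f (K + Suc n) p) \<le> norm (f (K + n) p) / 2"
        using elim(2) by simp
      also have "\<dots> \<le> (norm (g K) + 1) / 2 ^ n / 2"
        using Suc by (intro divide_right_mono) auto
      finally show ?case by simp
    qed (use elim(1) in auto)
    from this[of "k - K" for k] show ?case
      using elim(1) by (metis M_def add_diff_inverse_nat atMost_iff nat_le_linear not_le)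
  qed
  have "summable M"
  proof (subst summable_iff_shift[of M "Suc K", symmetric])
    have "M (n + Suc K) = (norm (g K) + 1) / 2 * (1/2) ^ n" for n
      by (simp add: M_def power_divide)
    hence "(\<lambda>n. M (n + Suc K)) = (\<lambda>n. (norm (g K) + 1) / 2 * (1/2) ^ n)"
      by blast
    thus "summable (\<lambda>n. M (n + Suc K))"
      by (simp only:) (intro summable_mult summable_geometric, simp)
  qed
  moreover have "eventually (\<lambda>(k,p). norm (f k p) \<le> M k) (at_top \<times>\<^sub>F F)"
    unfolding eventually_prod_filter
    using ev by (intro exI[of _ "\<lambda>_. True"] exI[of _ "\<lambda>p. \<forall>k. norm (f k p) \<le> M k"]) auto
  ultimately show ?thesis
    using tannerys_theorem[of f g F M] lim by (cases "F = bot") auto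
qed


text \<open>Fubini is applied over \<open>lborel\<close>, while all other integrals are absolutely
  integrable in the sense of the completed measure. This lemma and the next translate between the
  two.\<close>

lemma absolutely_integrable_lborel:
  fixes f :: "real \<Rightarrow> 'a::euclidean_space"
  assumes "(\<lambda>x. indicator S x *\<^sub>R f x) \<in> borel_measurable borel" "f absolutely_integrable_on S"
  shows "integrable lborel (\<lambda>x. indicator S x *\<^sub>R f x)"
    and "integral\<^sup>L lborel (\<lambda>x. indicator S x *\<^sub>R f x) = integral S f"
proof -
  show *: "integrable lborel (\<lambda>x. indicator S x *\<^sub>R f x)"
    using assms by (simp add: set_integrable_def integrable_completion)
  show "integral\<^sup>L lborel (\<lambda>x. indicator S x *\<^sub>R f x) = integral S f"
    using set_borel_integral_eq_integral(2)[of S f] *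
    by (simp add: set_integrable_def set_lebesgue_integral_def)
qed

lemma lborel_absolutely_integrable:
  fixes f :: "real \<Rightarrow> 'a::euclidean_space"
  assumes "integrable lborel (\<lambda>x. indicator S x *\<^sub>R f x)"
  shows "f absolutely_integrable_on S"
    and "integral\<^sup>L lborel (\<lambda>x. indicator S x *\<^sub>R f x) = integral S f"
proof -
  show "f absolutely_integrable_on S"
    using assms borel_measurable_integrable[OF assms] by (simp add: set_integrable_def integrable_completion)
  show "integral\<^sup>L lborel (\<lambda>x. indicator S x *\<^sub>R f x) = integral S f"
    using set_borel_integral_eq_integral(2)[of S f] assms
    by (simp add: set_integrable_def set_lebesgue_integral_def)
qed

section \<open>Gamma integrals with a scale factor\<close>

lemma scaled_Gamma_integral:
  assumes "c > 0" "Re a > 0"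
  shows "(\<lambda>y. complex_of_real y powr (a - 1) * of_real (exp (- (c * y)))) absolutely_integrable_on {0<..}"
    and "integral {0<..} (\<lambda>y. complex_of_real y powr (a - 1) * of_real (exp (- (c * y)))) = Gamma a * of_real c powr (- a)"
proof -
  let ?f = "\<lambda>y. complex_of_real y powr (a - 1) * of_real (exp (- y))"
  have f: "?f absolutely_integrable_on {0<..}" "integral {0<..} ?f = Gamma a"
    using absolutely_integrable_Gamma_integral'[OF assms(2)] Gamma_integral_complex'[OF assms(2)]
    by (simp_all add: exp_minus divide_inverse integral_unique)
  have img: "(*) c ` {0<..} = {0<..}"
  proof safe
    fix x :: real assume "x > 0"
    thus "x \<in> (*) c ` {0<..}"
      using assms by (intro image_eqI[of _ _ "x / c"]) auto
  qed (use assms in auto)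
  have "(\<lambda>x. \<bar>c\<bar> *\<^sub>R ?f (c * x)) absolutely_integrable_on {0<..} \<and>
     integral {0<..} (\<lambda>x. \<bar>c\<bar> *\<^sub>R ?f (c * x)) = Gamma a"
    using has_absolute_integral_change_of_variables_real[of "{0<..}" "(*) c" "\<lambda>_. c" ?f "Gamma a"] f img assms
    by (auto intro!: derivative_eq_intros simp: inj_on_def)
  hence 1: "(\<lambda>x. \<bar>c\<bar> *\<^sub>R ?f (c * x)) absolutely_integrable_on {0<..}"
     "integral {0<..} (\<lambda>x. \<bar>c\<bar> *\<^sub>R ?f (c * x)) = Gamma a" by auto
  have eq: "of_real c powr (-a) * (\<bar>c\<bar> *\<^sub>R ?f (c * x)) =
      complex_of_real x powr (a - 1) * of_real (exp (- (c * x)))" if "x \<in> {0<..}" for x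
  proof -
    have "of_real c powr (-a) * (\<bar>c\<bar> *\<^sub>R ?f (c * x)) = 
      (of_real c powr (-a) * of_real c powr 1 * of_real c powr (a - 1)) * of_real x powr (a - 1) * of_real (exp (- (c * x)))"
      using that assms by (simp add: powr_times_real scaleR_conv_of_real)
    also have "of_real c powr (-a) * of_real c powr 1 * of_real c powr (a - 1) = (1::complex)"
      using assms by (simp only: powr_add[symmetric]) simp
    finally show ?thesis by simp
  qed
  have "(\<lambda>x. of_real c powr (-a) * (\<bar>c\<bar> *\<^sub>R ?f (c * x))) absolutely_integrable_on {0<..}"
    using 1(1) by (rule set_integrable_mult_right)
  thus "(\<lambda>y. complex_of_real y powr (a - 1) * of_real (exp (- (c * y)))) absolutely_integrable_on {0<..}"
    by (rule set_integrable_cong[THEN iffD1, rotated -1]) (use eq in auto)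
  have "integral {0<..} (\<lambda>y. complex_of_real y powr (a - 1) * of_real (exp (- (c * y)))) =
    integral {0<..} (\<lambda>x. of_real c powr (-a) * (\<bar>c\<bar> *\<^sub>R ?f (c * x)))"
    by (intro integral_cong) (use eq in auto)
  also have "\<dots> = of_real c powr (-a) * Gamma a"
    by (subst integral_mult_right) (simp only: 1(2))
  finally show "integral {0<..} (\<lambda>y. complex_of_real y powr (a - 1) * of_real (exp (- (c * y)))) = Gamma a * of_real c powr (- a)"
    by simp
qed

text \<open>The norm of the integrand is the same integrand with Re a in place of a, which is real
  and positive.\<close>

lemma scaled_Gamma_integral_norm:
  assumes "c > 0" "Re a > 0"
  shows "integral {0<..} (\<lambda>y. norm (complex_of_real y powr (a - 1) * of_real (exp (- (c * y))))) = Gamma (Re a) * c powr (- Re a)"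
proof -
  let ?g = "\<lambda>y. complex_of_real y powr (of_real (Re a) - 1) * of_real (exp (- (c * y)))"
  have g: "(?g has_integral Gamma (of_real (Re a)) * of_real c powr (- of_real (Re a))) {0<..}"
    using scaled_Gamma_integral[of c "of_real (Re a)"] assms
    by (simp add: has_integral_iff set_lebesgue_integral_eq_integral(1))
  have "Gamma (complex_of_real (Re a)) * of_real c powr (- of_real (Re a)) = of_real (Gamma (Re a) * c powr (- Re a))"
    using assms by (simp add: Gamma_complex_of_real powr_of_real[symmetric])
  with g have "((\<lambda>y. Re (?g y)) has_integral (Gamma (Re a) * c powr (- Re a))) {0<..}"
    using has_integral_Re[OF g] by simp
  moreover have "Re (?g y) = norm (complex_of_real y powr (a - 1) * of_real (exp (- (c * y))))" if "y \<in> {0<..}" for y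
  proof -
    have "complex_of_real y powr (of_real (Re a) - 1) = of_real (y powr (Re a - 1))"
      using that by (metis greaterThan_iff less_imp_le of_real_1 of_real_diff powr_of_real)
    thus ?thesis using that by (simp add: norm_mult norm_of_real_powr)
  qed
  ultimately show ?thesis
    by (metis (no_types, lifting) has_integral_cong integral_unique)
qed

section \<open>Iterated Gamma integrals\<close>

text \<open>One kernel for two integrals over x in (0, \<infinity>): for e = -1 it gives 2 y^(b / 2)
  times the Macdonald function of order b at 2 sqrt y, and for e = b = 1 it gives 1 / (1 +
  y).\<close>

definition gker :: "complex \<Rightarrow> real \<Rightarrow> real \<Rightarrow> real \<Rightarrow> complex" where
  "gker b e y x = of_real x powr (b - 1) * of_real (exp (- (x + y * x powr e)))"

text \<open>With the order of integration reversed, the integral over y is Gamma a times x^(- e a),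
  and what remains over x is Euler's integral for Gamma (b - e a).\<close>

lemma Gamma_Fubini:
  fixes a b :: complex and e :: real
  assumes a: "Re a > 0" and b: "Re (b - of_real e * a) > 0"
    and inner: "\<And>y. y > 0 \<Longrightarrow> gker b e y absolutely_integrable_on {0<..}"
  shows "(\<lambda>y. of_real y powr (a - 1) * integral {0<..} (gker b e y)) absolutely_integrable_on {0<..}"
    and "integral {0<..} (\<lambda>y. of_real y powr (a - 1) * integral {0<..} (gker b e y)) = Gamma a * Gamma (b - of_real e * a)"
proof -
  \<comment> \<open>Complex powers are written with \<open>exp\<close> and \<open>ln\<close> and
    both half lines are put into indicators, so that F is Borel measurable on the whole
    plane.\<close>
  define F :: "real \<times> real \<Rightarrow> complex" where
    "F = (\<lambda>(x, y). indicator {0<..} y *\<^sub>R indicator {0<..} x *\<^sub>R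
       (exp ((a - 1) * of_real (ln y) + (b - 1) * of_real (ln x)) * of_real (exp (- (x + y * x powr e)))))"
  have Fm[measurable]: "F \<in> borel_measurable (borel \<Otimes>\<^sub>M borel)"
    unfolding F_def by measurable
  have F1: "F (x, y) = indicator {0<..} y *\<^sub>R (if x > 0 then (of_real x powr (b - 1) * of_real (exp (- x))) *
       (of_real y powr (a - 1) * of_real (exp (- (x powr e * y)))) else 0)" for x y
    by (auto simp: F_def indicator_def powr_of_real_exp exp_add exp_diff exp_minus mult_ac divide_simps)
  have F2: "F (x, y) = indicator {0<..} x *\<^sub>R (if y > 0 then of_real y powr (a - 1) * gker b e y x else 0)" for x y
    by (auto simp: F_def indicator_def powr_of_real_exp exp_add exp_diff exp_minus mult_ac gker_def)
  have y1: "(\<lambda>y. (of_real x powr (b - 1) * of_real (exp (- x))) *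
       (of_real y powr (a - 1) * of_real (exp (- (x powr e * y))))) absolutely_integrable_on {0<..}"
    if "x > 0" for x
    using scaled_Gamma_integral(1)[of "x powr e" a] a that by (intro set_integrable_mult_right) auto
  have Fx[measurable]: "(\<lambda>y. F (x, y)) \<in> borel_measurable borel" for x by measurable
  have Fy[measurable]: "(\<lambda>x. F (x, y)) \<in> borel_measurable borel" for y by measurable
  have Iy: "integrable lborel (\<lambda>y. F (x, y))"
      "integral\<^sup>L lborel (\<lambda>y. F (x, y)) = indicator {0<..} x *\<^sub>R (of_real x powr (b - of_real e * a - 1) * of_real (exp (- x)) * Gamma a)"
      "integral\<^sup>L lborel (\<lambda>y. norm (F (x, y))) = indicator {0<..} x *\<^sub>R norm (of_real x powr (b - of_real e * a - 1) * of_real (exp (- x)) * of_real (Gamma (Re a)))" for x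
  proof -
    let ?h = "\<lambda>y. (of_real x powr (b - 1) * of_real (exp (- x))) *
       (of_real y powr (a - 1) * of_real (exp (- (x powr e * y)))) :: complex"
    have "integrable lborel (\<lambda>y. F (x, y)) \<and>
      integral\<^sup>L lborel (\<lambda>y. F (x, y)) = indicator {0<..} x *\<^sub>R (of_real x powr (b - of_real e * a - 1) * of_real (exp (- x)) * Gamma a) \<and>
      integral\<^sup>L lborel (\<lambda>y. norm (F (x, y))) = indicator {0<..} x *\<^sub>R norm (of_real x powr (b - of_real e * a - 1) * of_real (exp (- x)) * of_real (Gamma (Re a)))"
    proof (cases "x > 0")
      case True
      have eq: "(\<lambda>y. F (x, y)) = (\<lambda>y. indicator {0<..} y *\<^sub>R ?h y)"
        using True by (simp add: F1 fun_eq_iff)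
      have eqn: "(\<lambda>y. norm (F (x, y))) = (\<lambda>y. indicator {0<..} y *\<^sub>R norm (?h y))"
        using True by (simp add: F1 fun_eq_iff)
      have 1: "integrable lborel (\<lambda>y. indicator {0<..} y *\<^sub>R ?h y)"
        using Fx[of x] y1[OF True] unfolding eq by (rule absolutely_integrable_lborel(1))
      have "integral\<^sup>L lborel (\<lambda>y. F (x, y)) = integral {0<..} ?h"
        unfolding eq using 1 by (rule lborel_absolutely_integrable)
      also have "\<dots> = of_real x powr (b - 1) * of_real (exp (- x)) * (Gamma a * of_real (x powr e) powr (- a))"
        using scaled_Gamma_integral(2)[of "x powr e" a] a True by (subst integral_mult_right) simp
      also have "of_real (x powr e) powr (- a) = complex_of_real x powr (- (of_real e * a))"
        using True by (simp add: powr_of_real_exp ln_powr mult_ac)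
      also have "of_real x powr (b - 1) * of_real (exp (- x)) * (Gamma a * complex_of_real x powr (- (of_real e * a)))
         = (of_real x powr (b - 1) * complex_of_real x powr (- (of_real e * a))) * of_real (exp (- x)) * Gamma a" by simp
      also have "of_real x powr (b - 1) * complex_of_real x powr (- (of_real e * a)) = of_real x powr (b - of_real e * a - 1)"
        by (subst powr_add[symmetric]) (simp add: algebra_simps)
      finally have 2: "integral\<^sup>L lborel (\<lambda>y. F (x, y)) = of_real x powr (b - of_real e * a - 1) * of_real (exp (- x)) * Gamma a" .
      have "integral\<^sup>L lborel (\<lambda>y. norm (F (x, y))) = integral {0<..} (\<lambda>y. norm (?h y))"
        unfolding eqn
      proof (rule lborel_absolutely_integrable)
        show "integrable lborel (\<lambda>y. indicator {0<..} y *\<^sub>R norm (?h y))"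
          using integrable_norm[OF 1] by (simp add: norm_mult)
      qed
      also have "\<dots> = integral {0<..} (\<lambda>y. norm (of_real x powr (b - 1) * complex_of_real (exp (- x))) * norm (of_real y powr (a - 1) * complex_of_real (exp (- (x powr e * y)))))"
        by (simp add: norm_mult)
      also have "\<dots> = norm (of_real x powr (b - 1) * complex_of_real (exp (- x))) * (Gamma (Re a) * (x powr e) powr (- Re a))"
        using scaled_Gamma_integral_norm[of "x powr e" a] a True by (subst integral_mult_right) simp
      also have "\<dots> = norm (of_real x powr (b - of_real e * a - 1) * of_real (exp (- x)) * of_real (Gamma (Re a)))"
        using True a by (simp add: norm_mult norm_of_real_powr powr_powr powr_add[symmetric] algebra_simps)
      finally show ?thesis using True 1 2 by (simp add: eq)
    next
      case False
      thus ?thesis by (simp add: F1)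
    qed
    thus "integrable lborel (\<lambda>y. F (x, y))"
      "integral\<^sup>L lborel (\<lambda>y. F (x, y)) = indicator {0<..} x *\<^sub>R (of_real x powr (b - of_real e * a - 1) * of_real (exp (- x)) * Gamma a)"
      "integral\<^sup>L lborel (\<lambda>y. norm (F (x, y))) = indicator {0<..} x *\<^sub>R norm (of_real x powr (b - of_real e * a - 1) * of_real (exp (- x)) * of_real (Gamma (Re a)))"
      by blast+
  qed
  have x1: "(\<lambda>x. of_real x powr (b - of_real e * a - 1) * of_real (exp (- x)) * c :: complex) absolutely_integrable_on {0<..}" for c
    using scaled_Gamma_integral(1)[of 1 "b - of_real e * a"] b by (intro set_integrable_mult_left) auto
  have x2: "(\<lambda>x. indicator {0<..} x *\<^sub>R (of_real x powr (b - of_real e * a - 1) * of_real (exp (- x)) * c :: complex)) =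
     (\<lambda>x. indicator {0<..} x *\<^sub>R (exp ((b - of_real e * a - 1) * of_real (ln x)) * of_real (exp (- x)) * c))" for c
    by (auto simp: fun_eq_iff indicator_def powr_of_real_exp)
  have x3: "integrable lborel (\<lambda>x. indicator {0<..} x *\<^sub>R (of_real x powr (b - of_real e * a - 1) * of_real (exp (- x)) * c :: complex))" for c
    by (rule absolutely_integrable_lborel[OF _ x1]) (subst x2, measurable)
  \<comment> \<open>The integrated norms are again a Gamma integrand, with Gamma (Re a) in place of
    Gamma a; this is the absolute convergence that Fubini requires.\<close>
  have "integrable lborel (\<lambda>x. norm (indicator {0<..} x *\<^sub>R (of_real x powr (b - of_real e * a - 1) * of_real (exp (- x)) * of_real (Gamma (Re a)) :: complex)))"
    by (intro integrable_norm x3)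
  hence x4: "integrable lborel (\<lambda>x. integral\<^sup>L lborel (\<lambda>y. norm (F (x, y))))"
    by (simp add: Iy(3))
  have Fint: "integrable (lborel \<Otimes>\<^sub>M lborel) F"
    using x4 Iy(1) by (intro lborel_pair.Fubini_integrable) auto
  hence Fint': "integrable (lborel \<Otimes>\<^sub>M lborel) (case_prod (\<lambda>x y. F (x, y)))" by simp
  have "integral\<^sup>L lborel (\<lambda>y. integral\<^sup>L lborel (\<lambda>x. F (x, y))) = integral\<^sup>L lborel (\<lambda>x. integral\<^sup>L lborel (\<lambda>y. F (x, y)))"
    by (rule lborel_pair.Fubini_integral[OF Fint'])
  also have "\<dots> = integral\<^sup>L lborel (\<lambda>x. indicator {0<..} x *\<^sub>R (of_real x powr (b - of_real e * a - 1) * of_real (exp (- x)) * Gamma a))"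
    by (simp only: Iy(2))
  also have "\<dots> = integral {0<..} (\<lambda>x. of_real x powr (b - of_real e * a - 1) * of_real (exp (- x)) * Gamma a)"
    by (rule lborel_absolutely_integrable[OF x3])
  also have "\<dots> = Gamma a * Gamma (b - of_real e * a)"
    using scaled_Gamma_integral(2)[of 1 "b - of_real e * a"] b by (subst integral_mult_left) auto
  finally have val: "integral\<^sup>L lborel (\<lambda>y. integral\<^sup>L lborel (\<lambda>x. F (x, y))) = Gamma a * Gamma (b - of_real e * a)" .
  have int: "integrable lborel (\<lambda>y. integral\<^sup>L lborel (\<lambda>x. F (x, y)))"
    using lborel_pair.integrable_snd[OF Fint'] .
  have inner': "integral\<^sup>L lborel (\<lambda>x. F (x, y)) = indicator {0<..} y *\<^sub>R (of_real y powr (a - 1) * integral {0<..} (gker b e y))" for y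
  proof (cases "y > 0")
    case True
    have eq: "(\<lambda>x. F (x, y)) = (\<lambda>x. indicator {0<..} x *\<^sub>R (of_real y powr (a - 1) * gker b e y x))"
      using True by (simp add: F2)
    have "integrable lborel (\<lambda>x. F (x, y))"
      using Fy[of y] set_integrable_mult_right[OF inner[OF True], of "of_real y powr (a - 1)"]
      unfolding eq by (rule absolutely_integrable_lborel(1))
    hence "integral\<^sup>L lborel (\<lambda>x. F (x, y)) = integral {0<..} (\<lambda>x. of_real y powr (a - 1) * gker b e y x)"
      unfolding eq by (rule lborel_absolutely_integrable)
    thus ?thesis using True by simp
  qed (simp add: F2)
  show "(\<lambda>y. of_real y powr (a - 1) * integral {0<..} (gker b e y)) absolutely_integrable_on {0<..}"
    and "integral {0<..} (\<lambda>y. of_real y powr (a - 1) * integral {0<..} (gker b e y)) = Gamma a * Gamma (b - of_real e * a)"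
    using lborel_absolutely_integrable[of "{0<..}" "\<lambda>y. of_real y powr (a - 1) * integral {0<..} (gker b e y)"] int val
    unfolding inner' by auto
qed

lemma exp_neg_inverse_bound:
  assumes "u > (0::real)"
  shows "exp (- u) * u ^ m \<le> fact m"
proof -
  have s: "(\<lambda>n. u ^ n / fact n) sums exp u"
    using exp_converges[of u] by (simp add: divide_inverse mult.commute)
  have "sum (\<lambda>n. u ^ n / fact n) {m} \<le> (\<Sum>n. u ^ n / fact n)"
    using s assms by (intro sum_le_suminf) (auto simp: sums_iff)
  hence "u ^ m / fact m \<le> exp u"
    using s by (simp add: sums_iff)
  thus ?thesis by (simp add: exp_minus field_simps)
qed

text \<open>For y > 0 the factor exp (- y / x) beats every power of x at 0, so b is arbitrary: m
  powers of x are lent to the Gamma integrand and paid back by exp (- y / x) / x^m \<le> m! /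
  y^m.\<close>

lemma gker_inverse_integrable:
  assumes "y > 0"
  shows "gker b (- 1) y absolutely_integrable_on {0<..}"
proof -
  obtain m :: nat where m: "Re b + real m > 0"
    by (metis add.commute neg_less_iff_less real_0_less_add_iff reals_Archimedean2)
  have f: "(\<lambda>x. of_real x powr (b + of_nat m - 1) * complex_of_real (exp (- x))) absolutely_integrable_on {0<..}"
    using scaled_Gamma_integral(1)[of 1 "b + of_nat m"] m by simp
  have "(\<lambda>x. of_real (exp (- (y / x)) / x ^ m) * (of_real x powr (b + of_nat m - 1) * complex_of_real (exp (- x)))) absolutely_integrable_on {0<..}"
  proof (rule absolutely_integrable_mult_bounded[OF f])
    show "continuous_on {0<..} (\<lambda>x. complex_of_real (exp (- (y / x)) / x ^ m))"
      by (intro continuous_intros) auto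
    show "norm (complex_of_real (exp (- (y / x)) / x ^ m)) \<le> fact m / y ^ m" if "x \<in> {0<..}" for x
      using exp_neg_inverse_bound[of "y / x" m] that assms by (simp add: field_simps norm_divide norm_power)
  qed simp
  thus ?thesis
  proof (rule set_integrable_cong[THEN iffD1, rotated -1])
    fix x :: real assume "x \<in> {0<..}"
    thus "of_real (exp (- (y / x)) / x ^ m) * (of_real x powr (b + of_nat m - 1) * complex_of_real (exp (- x))) = gker b (- 1) y x"
      using exp_add[of "-x" "-(y/x)"] by (simp add: gker_def powr_add powr_diff powr_minus divide_inverse)
  qed auto
qed

section \<open>An integral representation of the Macdonald function\<close>

text \<open>\<open>kk \<nu> y\<close> is \<open>K\<^sub>\<nu>(2 \<surd>y)\<close>, see \<open>besselK_kk\<close> below.\<close>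

definition kk :: "complex \<Rightarrow> real \<Rightarrow> complex" where
  "kk \<nu> y = of_real y powr (\<nu> / 2) / 2 * integral {0<..} (gker (- \<nu>) (- 1) y)"

text \<open>\<open>Gamma_Fubini\<close> with e = -1, b = -\<nu> and a = w + \<nu> / 2, for which b -
  e a = w - \<nu> / 2. The two positivity conditions there combine into the hypothesis on w.\<close>

lemma kk_Mellin:
  assumes w: "Re w > \<bar>Re \<nu>\<bar> / 2"
  shows "(\<lambda>y. of_real y powr (w - 1) * kk \<nu> y) absolutely_integrable_on {0<..}"
    and "integral {0<..} (\<lambda>y. of_real y powr (w - 1) * kk \<nu> y) = Gamma (w + \<nu> / 2) * Gamma (w - \<nu> / 2) / 2"
proof -
  have 1: "Re (w + \<nu> / 2) > 0" "Re (- \<nu> - of_real (- 1) * (w + \<nu> / 2)) > 0"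
    using w by (auto simp: abs_if split: if_splits)
  note G = Gamma_Fubini[OF 1 gker_inverse_integrable]
  have arg: "- \<nu> - of_real (- 1) * (w + \<nu> / 2) = w - \<nu> / 2"
    by (simp add: field_simps)
  have eq: "of_real y powr (w - 1) * kk \<nu> y = of_real y powr (w + \<nu> / 2 - 1) * integral {0<..} (gker (- \<nu>) (- 1) y) * (1 / 2)" for y
    using powr_add[of "complex_of_real y" "w - 1" "\<nu> / 2"] by (simp add: kk_def algebra_simps)
  show "(\<lambda>y. of_real y powr (w - 1) * kk \<nu> y) absolutely_integrable_on {0<..}"
    unfolding eq by (rule set_integrable_mult_left[OF G(1)])
  show "integral {0<..} (\<lambda>y. of_real y powr (w - 1) * kk \<nu> y) = Gamma (w + \<nu> / 2) * Gamma (w - \<nu> / 2) / 2"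
    unfolding eq by (subst integral_mult_left, subst G(2)) (simp only: arg, simp)
qed

lemma powr_le_powr_plus:
  assumes "r > (0::real)" "\<bar>s\<bar> \<le> B"
  shows "r powr s \<le> r powr B + r powr (- B)"
proof (cases "r \<ge> 1")
  case True
  hence "r powr s \<le> r powr B" using assms by (intro powr_mono) auto
  thus ?thesis by (smt (verit) powr_ge_zero)
next
  case False
  hence "r powr s \<le> r powr (- B)" using assms by (intro powr_mono') auto
  thus ?thesis by (smt (verit) powr_ge_zero)
qed

lemma norm_gker: "x > 0 \<Longrightarrow> norm (gker b e y x) = x powr (Re b - 1) * exp (- (x + y * x powr e))"
  by (simp add: gker_def norm_mult norm_of_real_powr)

lemma gker_of_real: "x > 0 \<Longrightarrow> gker (of_real b) e y x = of_real (norm (gker (of_real b) e y x))"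
proof -
  assume "x > 0"
  hence "complex_of_real x powr (of_real b - 1) = of_real (x powr (b - 1))"
    by (metis less_imp_le of_real_1 of_real_diff powr_of_real)
  thus "gker (of_real b) e y x = of_real (norm (gker (of_real b) e y x))"
    by (simp add: gker_def norm_mult)
qed

text \<open>For real order the integrand of \<open>kk\<close> is positive, so norm and integral
  commute. This makes the functions of order \<plusminus>B usable as majorants in
  \<open>kk_bound\<close>.\<close>

lemma norm_kk_of_real:
  assumes "y > 0"
  shows "norm (kk (of_real B) y) = y powr (B / 2) / 2 * integral {0<..} (\<lambda>x. norm (gker (of_real (- B)) (- 1) y x))"
proof -
  have "integral {0<..} (gker (of_real (- B)) (- 1) y) = integral {0<..} (\<lambda>x. complex_of_real (norm (gker (of_real (- B)) (- 1) y x)))"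
    by (intro integral_cong gker_of_real) auto
  also have "\<dots> = of_real (integral {0<..} (\<lambda>x. norm (gker (of_real (- B)) (- 1) y x)))"
    using integral_linear[OF _ bounded_linear_of_real[where 'a = complex], of "\<lambda>x. norm (gker (of_real (- B)) (- 1) y x)" "{0<..}"]
      gker_inverse_integrable[OF assms, of "of_real (- B)"] by (simp add: o_def absolutely_integrable_on_def)
  finally have "norm (integral {0<..} (gker (- of_real B) (- 1) y)) = \<bar>integral {0<..} (\<lambda>x. norm (gker (of_real (- B)) (- 1) y x))\<bar>"
    by simp
  also have "\<dots> = integral {0<..} (\<lambda>x. norm (gker (of_real (- B)) (- 1) y x))"
    by (intro abs_of_nonneg Henstock_Kurzweil_Integration.integral_nonneg)
       (use gker_inverse_integrable[OF assms] in \<open>auto simp: absolutely_integrable_on_def\<close>)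
  finally show ?thesis
    using assms by (simp add: kk_def norm_mult norm_of_real_powr norm_divide)
qed

text \<open>A majorant that is uniform over the strip \<bar>Re \<nu>\<bar> \<le> B and consists
  again of Macdonald functions, so its own integrability follows from
  \<open>kk_Mellin\<close>.\<close>

lemma kk_bound:
  assumes "y > 0" "\<bar>Re \<nu>\<bar> \<le> B"
  shows "norm (kk \<nu> y) \<le> norm (kk (of_real B) y) + norm (kk (of_real (- B)) y)"
proof -
  let ?I = "\<lambda>b. integral {0<..} (\<lambda>x. norm (gker b (- 1) y x))"
  have int: "(\<lambda>x. norm (gker b (- 1) y x)) integrable_on {0<..}" for b
    using gker_inverse_integrable[OF assms(1), of b] by (simp add: absolutely_integrable_on_def)
  have "norm (integral {0<..} (gker (- \<nu>) (- 1) y)) \<le> ?I (- \<nu>)"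
    using gker_inverse_integrable[OF assms(1), of "- \<nu>"] by (intro integral_norm_bound_integral) (auto simp: absolutely_integrable_on_def)
  hence "norm (kk \<nu> y) \<le> y powr (Re \<nu> / 2) / 2 * ?I (- \<nu>)"
    using assms by (simp add: kk_def norm_mult norm_of_real_powr norm_divide)
  also have "\<dots> = integral {0<..} (\<lambda>x. y powr (Re \<nu> / 2) / 2 * norm (gker (- \<nu>) (- 1) y x))"
    by simp
  also have "\<dots> \<le> integral {0<..} (\<lambda>x. y powr (B / 2) / 2 * norm (gker (of_real (- B)) (- 1) y x)
      + y powr (- B / 2) / 2 * norm (gker (of_real B) (- 1) y x))"
  proof (rule integral_le)
    show "y powr (Re \<nu> / 2) / 2 * norm (gker (- \<nu>) (- 1) y x) \<le> y powr (B / 2) / 2 * norm (gker (of_real (- B)) (- 1) y x)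
      + y powr (- B / 2) / 2 * norm (gker (of_real B) (- 1) y x)" if x: "x \<in> {0<..}" for x
    proof -
      define E where "E = exp (- (x + y * x powr (- 1)))"
      \<comment> \<open>Up to a factor free of \<nu>, the integrand together with the prefactor of
        \<open>kk\<close> depends on \<nu> only through the power (sqrt y / x)^\<nu>, whose modulus
        lies below the sum of the two extreme powers.\<close>
      have r: "(sqrt y / x) powr c = y powr (c / 2) * x powr (- c)" for c
      proof -
        have "(sqrt y / x) powr c = (y powr (1 / 2)) powr c / x powr c"
          using x assms by (simp add: powr_divide powr_half_sqrt)
        thus ?thesis by (simp add: powr_powr powr_minus_divide)
      qed
      have "(sqrt y / x) powr Re \<nu> \<le> (sqrt y / x) powr B + (sqrt y / x) powr (- B)"
        using assms x by (intro powr_le_powr_plus) auto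
      hence "y powr (Re \<nu> / 2) * x powr (- Re \<nu>) \<le> y powr (B / 2) * x powr (- B) + y powr (- B / 2) * x powr B"
        unfolding r by simp
      hence "(y powr (Re \<nu> / 2) * x powr (- Re \<nu>)) * (E / (2 * x))
         \<le> (y powr (B / 2) * x powr (- B) + y powr (- B / 2) * x powr B) * (E / (2 * x))"
        using x by (intro mult_right_mono) (auto simp: E_def)
      moreover have "norm (gker b (- 1) y x) = x powr Re b / x * E" for b
        using x by (simp add: norm_gker powr_diff E_def)
      ultimately show ?thesis
        by (simp add: field_simps add_divide_distrib)
    qed
  qed (intro integrable_add integrable_on_mult_right int)+
  also have "\<dots> = y powr (B / 2) / 2 * ?I (of_real (- B)) + y powr (- B / 2) / 2 * ?I (of_real B)"
    by (subst integral_add) (intro integrable_on_mult_right int | simp)+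
  also have "\<dots> = norm (kk (of_real B) y) + norm (kk (of_real (- B)) y)"
    using norm_kk_of_real[OF assms(1), of B] norm_kk_of_real[OF assms(1), of "- B"] by simp
  finally show ?thesis .
qed

text \<open>Continuity in the order, integers included, by dominated convergence; it later supplies
  the limit that defines \<open>besselK\<close> at integer order. A convergent sequence is bounded,
  which gives B.\<close>

lemma kk_tendsto:
  assumes y: "y > 0" and lim: "X \<longlonglongrightarrow> \<nu>"
  shows "(\<lambda>n. kk (X n) y) \<longlonglongrightarrow> kk \<nu> y"
proof -
  obtain B where B: "\<And>n. norm (X n) \<le> B"
    using lim convergent_imp_Bseq[of X] by (auto simp: convergent_def Bseq_def)
  have B': "\<bar>- Re (X n)\<bar> \<le> B" for n
    using B[of n] abs_Re_le_cmod[of "X n"] by linarith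
  have int: "(\<lambda>x. norm (gker b (- 1) y x)) integrable_on {0<..}" "gker b (- 1) y integrable_on {0<..}" for b
    using gker_inverse_integrable[OF assms(1), of b] by (simp_all add: absolutely_integrable_on_def)
  have "(\<lambda>n. integral {0<..} (gker (- X n) (- 1) y)) \<longlonglongrightarrow> integral {0<..} (gker (- \<nu>) (- 1) y)"
  proof (rule dominated_convergence)
    show "gker (- X n) (- 1) y integrable_on {0<..}" for n by (rule int)
    show "(\<lambda>x. norm (gker (of_real B) (- 1) y x) + norm (gker (of_real (- B)) (- 1) y x)) integrable_on {0<..}"
      by (intro integrable_add int)
    show "norm (gker (- X n) (- 1) y x) \<le> norm (gker (of_real B) (- 1) y x) + norm (gker (of_real (- B)) (- 1) y x)"
      if "x \<in> {0<..}" for n x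
    proof -
      define E where "E = exp (- (x + y * x powr (- 1)))"
      have "x powr (- Re (X n)) * (E / x) \<le> (x powr B + x powr (- B)) * (E / x)"
        using that B'[of n] by (intro mult_right_mono powr_le_powr_plus) (auto simp: E_def)
      moreover have "norm (gker b (- 1) y x) = x powr Re b / x * E" for b
        using that by (simp add: norm_gker powr_diff E_def)
      ultimately show ?thesis by (simp add: field_simps add_divide_distrib)
    qed
    show "(\<lambda>n. gker (- X n) (- 1) y x) \<longlonglongrightarrow> gker (- \<nu>) (- 1) y x" if "x \<in> {0<..}" for x
      using that lim unfolding gker_def by (auto intro!: tendsto_intros simp: powr_of_real_exp)
  qed
  moreover have "(\<lambda>n. complex_of_real y powr (X n / 2)) \<longlonglongrightarrow> of_real y powr (\<nu> / 2)"
    using y lim by (auto intro!: tendsto_intros simp: powr_of_real_exp)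
  ultimately show ?thesis
    unfolding kk_def by (intro tendsto_mult tendsto_divide tendsto_const) auto
qed

lemma integral_inversion:
  fixes f :: "real \<Rightarrow> complex"
  assumes T: "T > 0" and f: "(\<lambda>t. f (1 / t) / of_real t) absolutely_integrable_on {1/T<..}"
  shows "(\<lambda>u. f u / of_real u) absolutely_integrable_on {0<..<T}"
    and "integral {0<..<T} (\<lambda>u. f u / of_real u) = integral {1/T<..} (\<lambda>t. f (1 / t) / of_real t)"
proof -
  have pos: "t > 0" if "t \<in> {1/T<..}" for t
  proof -
    have "0 < 1 / T" using T by simp
    also have "1 / T < t" using that by simp
    finally show ?thesis .
  qed
  have img: "(\<lambda>t. 1 / t) ` {1/T<..} = {0<..<T}"
  proof (intro equalityI subsetI)
    fix u assume u: "u \<in> {0<..<T}"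
    thus "u \<in> (\<lambda>t. 1 / t) ` {1/T<..}"
      using T by (intro image_eqI[of _ _ "1 / u"]) (auto simp: field_simps)
  qed (use T pos in \<open>auto simp: field_simps\<close>)
  let ?g = "\<lambda>t. \<bar>- 1 / t\<^sup>2\<bar> *\<^sub>R (f (1 / t) / of_real (1 / t))"
  have eq: "?g t = f (1 / t) / of_real t" if "t \<in> {1/T<..}" for t
    using pos[OF that] by (simp add: scaleR_conv_of_real power2_eq_square field_simps)
  have g: "?g absolutely_integrable_on {1/T<..}"
    by (rule set_integrable_cong[THEN iffD1, OF refl refl eq[symmetric] f])
  have "((\<lambda>u. f u / of_real u) absolutely_integrable_on {0<..<T}) \<and>
      integral {0<..<T} (\<lambda>u. f u / of_real u) = integral {1/T<..} ?g"
    unfolding img[symmetric]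
  proof (subst has_absolute_integral_change_of_variables_real[symmetric])
    show "((\<lambda>t. 1 / t) has_field_derivative - 1 / t\<^sup>2) (at t within {1/T<..})" if "t \<in> {1/T<..}" for t :: real
      using pos[OF that] by (auto intro!: derivative_eq_intros simp: power2_eq_square)
    show "inj_on ((/) (1::real)) {1/T<..}"
      using pos by (auto simp: inj_on_def)
  qed (use g in auto)
  moreover have "integral {1/T<..} ?g = integral {1/T<..} (\<lambda>t. f (1 / t) / of_real t)"
    by (rule integral_cong) (rule eq)
  ultimately show "(\<lambda>u. f u / of_real u) absolutely_integrable_on {0<..<T}"
    and "integral {0<..<T} (\<lambda>u. f u / of_real u) = integral {1/T<..} (\<lambda>t. f (1 / t) / of_real t)"
    by auto
qed

section \<open>Finite-part moments and the Parseval identity\<close>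

text \<open>Exponents are complex and unordered and the index type is arbitrary, so that the two
  ladders \<plusminus>\<nu> / 2 + k of the Macdonald function form one family. Absolute summability
  at the end point T is what the termwise integrations below rest on.\<close>

definition expands :: "(real \<Rightarrow> complex) \<Rightarrow> ('i \<Rightarrow> complex) \<Rightarrow> ('i \<Rightarrow> complex) \<Rightarrow> real \<Rightarrow> bool" where
  "expands f c p T \<longleftrightarrow> T > 0 \<and> (\<lambda>i. norm (c i) * T powr Re (p i)) summable_on UNIV \<and>
     (\<forall>t\<in>{0<..T}. ((\<lambda>i. c i * of_real t powr p i) has_sum f t) UNIV)"

text \<open>If \<open>f\<close> has the expansion \<open>\<Sum>i. c\<^sub>i t powr p\<^sub>i\<close> on \<open>(0, T]\<close>, then \<open>fpm f c p T s\<close> is the Hadamard finite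
  part of the integral of \<open>f t * t powr (s - 1)\<close> over \<open>(0, \<infinity>)\<close>.\<close>

definition fpm :: "(real \<Rightarrow> complex) \<Rightarrow> ('i \<Rightarrow> complex) \<Rightarrow> ('i \<Rightarrow> complex) \<Rightarrow> real \<Rightarrow> complex \<Rightarrow> complex" where
  "fpm f c p T s = integral {T<..} (\<lambda>t. f t * of_real t powr (s - 1)) +
     (\<Sum>\<^sub>\<infinity>i. c i * of_real T powr (p i + s) / (p i + s))"

text \<open>For t > T the argument 1 / t lies in the range of the expansion of \<psi>. Since Q
  bounds the exponents from below, t^(Q - q j) is largest at t = T, and one integrability condition
  with exponent Q dominates every term.\<close>

lemma tail_expansion:
  fixes d :: "'j::countable \<Rightarrow> complex"
  assumes T: "T > 0" and \<psi>: "expands \<psi> d q (1 / T)" and Q: "\<And>j. Q \<le> Re (q j)"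
    and \<phi>: "(\<lambda>t. \<phi> t * of_real t powr (- of_real Q - 1)) absolutely_integrable_on {T<..}"
  shows "(\<lambda>t. \<phi> t * \<psi> (1 / t) / of_real t) absolutely_integrable_on {T<..}"
    and "((\<lambda>j. d j * integral {T<..} (\<lambda>t. \<phi> t * of_real t powr (- q j - 1))) has_sum
          integral {T<..} (\<lambda>t. \<phi> t * \<psi> (1 / t) / of_real t)) UNIV"
proof -
  let ?\<phi> = "\<lambda>t. \<phi> t * complex_of_real t powr (- of_real Q - 1)"
  define f where "f j t = d j * (\<phi> t * complex_of_real t powr (- q j - 1))" for j t
  have split: "\<phi> t * complex_of_real t powr (- q j - 1) = of_real t powr (of_real Q - q j) * ?\<phi> t" for t j
    using powr_add[of "complex_of_real t" "of_real Q - q j" "- of_real Q - 1"] by simp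
  have bd: "norm (complex_of_real t powr (of_real Q - q j)) \<le> T powr (Q - Re (q j))" if "t \<in> {T<..}" for t j
    using that T Q[of j] by (simp add: norm_of_real_powr powr_mono2')
  have aint1: "(\<lambda>t. \<phi> t * of_real t powr (- q j - 1)) absolutely_integrable_on {T<..}" for j
    unfolding split by (rule absolutely_integrable_mult_bounded[OF \<phi> _ _ bd]) (use T in \<open>auto intro!: continuous_intros\<close>)
  have f: "f j absolutely_integrable_on {T<..}" for j
    unfolding f_def by (rule set_integrable_mult_right[OF aint1])
  have nrm: "integral {T<..} (\<lambda>t. norm (f j t)) \<le> norm (d j) * (1 / T) powr Re (q j) * (T powr Q * integral {T<..} (\<lambda>t. norm (?\<phi> t)))" for j
  proof -
    have "integral {T<..} (\<lambda>t. norm (f j t)) \<le> integral {T<..} (\<lambda>t. (norm (d j) * T powr (Q - Re (q j))) * norm (?\<phi> t))"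
    proof (rule integral_le)
      show "(\<lambda>t. norm (f j t)) integrable_on {T<..}" using f by (simp add: absolutely_integrable_on_def)
      show "(\<lambda>t. (norm (d j) * T powr (Q - Re (q j))) * norm (?\<phi> t)) integrable_on {T<..}"
        using \<phi> by (intro integrable_on_mult_right) (simp add: absolutely_integrable_on_def)
      show "norm (f j t) \<le> (norm (d j) * T powr (Q - Re (q j))) * norm (?\<phi> t)" if "t \<in> {T<..}" for t
      proof -
        have "norm (f j t) = norm (d j) * (norm (complex_of_real t powr (of_real Q - q j)) * norm (?\<phi> t))"
          unfolding f_def split by (simp only: norm_mult)
        also have "\<dots> \<le> norm (d j) * (T powr (Q - Re (q j)) * norm (?\<phi> t))"
          by (intro mult_left_mono mult_right_mono bd that) auto
        finally show ?thesis by (simp only: mult.assoc)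
      qed
    qed
    also have "\<dots> = norm (d j) * (T powr (- Re (q j)) * T powr Q) * integral {T<..} (\<lambda>t. norm (?\<phi> t))"
      by (subst integral_mult_right) (simp add: powr_add[symmetric])
    also have "T powr (- Re (q j)) = (1 / T) powr Re (q j)"
      using T by (simp add: powr_divide powr_minus_divide)
    finally show ?thesis by (simp only: mult.assoc)
  qed
  have sm: "(\<lambda>j. integral {T<..} (\<lambda>t. norm (f j t))) summable_on UNIV"
  proof (rule summable_on_comparison_test)
    show "(\<lambda>j. norm (d j) * (1 / T) powr Re (q j) * (T powr Q * integral {T<..} (\<lambda>t. norm (?\<phi> t)))) summable_on UNIV"
      using \<psi> by (intro summable_on_cmult_left) (auto simp: expands_def)
    show "0 \<le> integral {T<..} (\<lambda>t. norm (f j t))" for j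
      using f[of j] by (intro Henstock_Kurzweil_Integration.integral_nonneg) (auto simp: absolutely_integrable_on_def)
  qed (use nrm in auto)
  have hs: "((\<lambda>j. f j t) has_sum (\<phi> t * \<psi> (1 / t) / of_real t)) UNIV" if t: "t \<in> {T<..}" for t
  proof -
    have "((\<lambda>j. d j * of_real (1 / t) powr q j) has_sum \<psi> (1 / t)) UNIV"
    proof -
      have "1 / t \<in> {0<..1 / T}" using t T by (auto intro!: divide_left_mono)
      thus ?thesis using \<psi> unfolding expands_def by blast
    qed
    hence "((\<lambda>j. (\<phi> t / of_real t) * (d j * of_real (1 / t) powr q j)) has_sum (\<phi> t / of_real t) * \<psi> (1 / t)) UNIV"
      by (rule has_sum_cmult_right)
    moreover have "(\<phi> t / of_real t) * (d j * of_real (1 / t) powr q j) = f j t" for j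
    proof -
      have "complex_of_real (1 / t) powr q j = of_real t powr (- q j)"
        using t T powr_of_real_exp[of "1 / t" "q j"] by (simp add: powr_of_real_exp ln_div del: of_real_divide)
      moreover have "complex_of_real t powr (- q j - 1) = of_real t powr (- q j) / of_real t"
        using t T by (simp add: powr_diff)
      ultimately show ?thesis by (simp add: f_def del: of_real_divide)
    qed
    ultimately show ?thesis by simp
  qed
  note I = integral_infsum[OF f _ sm hs]
  show "(\<lambda>t. \<phi> t * \<psi> (1 / t) / of_real t) absolutely_integrable_on {T<..}"
    by (rule I) auto
  have "((\<lambda>j. integral {T<..} (f j)) has_sum
          integral {T<..} (\<lambda>t. \<phi> t * \<psi> (1 / t) / of_real t)) UNIV"
    by (rule I) auto
  thus "((\<lambda>j. d j * integral {T<..} (\<lambda>t. \<phi> t * of_real t powr (- q j - 1))) has_sum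
          integral {T<..} (\<lambda>t. \<phi> t * \<psi> (1 / t) / of_real t)) UNIV"
    by (simp add: f_def[abs_def])
qed

text \<open>Each half of the cut integral gives a series of tail integrals only. Adding the double
  series of the \<open>a i j\<close> to one of them and subtracting it from the other completes both
  to finite-part moments, because p i - q j changes sign when the roles are exchanged. The gap
  \<delta> between the two sets of exponents makes the double series absolutely summable.
  Summability of the second series is claimed separately because \<open>infsum\<close> is 0 on
  families that are not summable.\<close>

lemma Mellin_Parseval:
  fixes c p :: "'i::countable \<Rightarrow> complex" and d q :: "'j::countable \<Rightarrow> complex"
  assumes \<phi>: "expands \<phi> c p T" and \<psi>: "expands \<psi> d q (1 / T)"
    and P: "\<And>i. P \<le> Re (p i)" and Q: "\<And>j. Q \<le> Re (q j)"
    and I\<phi>: "(\<lambda>t. \<phi> t * of_real t powr (- of_real Q - 1)) absolutely_integrable_on {T<..}"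
    and I\<psi>: "(\<lambda>t. \<psi> t * of_real t powr (- of_real P - 1)) absolutely_integrable_on {1/T<..}"
    and \<delta>: "\<delta> > 0" "\<And>i j. \<delta> \<le> norm (p i - q j)"
  shows "(\<lambda>t. \<phi> t * \<psi> (1 / t) / of_real t) absolutely_integrable_on {0<..}"
    and "integral {0<..} (\<lambda>t. \<phi> t * \<psi> (1 / t) / of_real t) =
      (\<Sum>\<^sub>\<infinity>i. c i * fpm \<psi> d q (1 / T) (- p i)) + (\<Sum>\<^sub>\<infinity>j. d j * fpm \<phi> c p T (- q j))"
    and "(\<lambda>j. d j * fpm \<phi> c p T (- q j)) summable_on UNIV"
proof -
  have T: "T > 0" using \<phi> by (simp add: expands_def)
  define F where "F t = \<phi> t * \<psi> (1 / t)" for t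
  note A = tail_expansion[OF T \<psi> Q I\<phi>]
  have \<phi>': "expands \<phi> c p (1 / (1 / T))" using \<phi> by simp
  have T': "1 / T > 0" using T by simp
  note B = tail_expansion[OF T' \<phi>' P I\<psi>]
  have B': "(\<lambda>t. F (1 / t) / of_real t) absolutely_integrable_on {1/T<..}"
    using B(1) by (simp add: F_def mult.commute)
  note C = integral_inversion[OF T B']
  have eqB: "integral {1/T<..} (\<lambda>t. F (1 / t) / of_real t) = integral {1/T<..} (\<lambda>t. \<psi> t * \<phi> (1 / t) / of_real t)"
    by (simp add: F_def mult.commute)
  have A1: "(\<lambda>t. F t / of_real t) absolutely_integrable_on {T<..}" using A(1) by (simp add: F_def)
  have C1: "(\<lambda>t. F t / of_real t) absolutely_integrable_on {0<..T}"
    by (rule absolutely_integrable_spike_set[OF C(1)]) (rule negligible_subset[of "{T}"], auto)+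
  have C2: "integral {0<..T} (\<lambda>t. F t / of_real t) = integral {0<..<T} (\<lambda>t. F t / of_real t)"
    by (rule integral_spike_set) (rule negligible_subset[of "{T}"], auto)+
  have un: "{0<..} = {0<..T} \<union> {T<..}" using T by auto
  show "(\<lambda>t. \<phi> t * \<psi> (1 / t) / of_real t) absolutely_integrable_on {0<..}"
    unfolding un F_def[symmetric] using C1 A1 by (intro set_integrable_Un) auto
  have "((\<lambda>t. F t / of_real t) has_integral (integral {0<..T} (\<lambda>t. F t / of_real t) + integral {T<..} (\<lambda>t. F t / of_real t))) ({0<..T} \<union> {T<..})"
  proof (intro has_integral_Un integrable_integral)
    have "{0<..T} \<inter> {T<..} = {}" by auto
    thus "negligible ({0<..T} \<inter> {T<..})" by simp
  qed (use C1 A1 in \<open>auto simp: absolutely_integrable_on_def\<close>)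
  hence total: "integral {0<..} (\<lambda>t. F t / of_real t) = integral {1/T<..} (\<lambda>t. \<psi> t * \<phi> (1 / t) / of_real t) + integral {T<..} (\<lambda>t. F t / of_real t)"
    unfolding un[symmetric] C2 C(2) eqB by (rule integral_unique)
  define a where "a i j = c i * d j * of_real T powr (p i - q j) / (p i - q j)" for i j
  have "(\<lambda>(i, j). (norm (c i) * T powr Re (p i)) * (norm (d j) * (1 / T) powr Re (q j))) summable_on UNIV \<times> UNIV"
  proof -
    have *: "(\<lambda>i. norm (c i) * T powr Re (p i)) summable_on UNIV"
      "(\<lambda>j. norm (d j) * (1 / T) powr Re (q j)) summable_on UNIV"
      using \<phi> \<psi> by (simp_all add: expands_def)
    show ?thesis
    proof (rule summable_on_SigmaI)
      fix i
      show "((\<lambda>j. case (i, j) of (i, j) \<Rightarrow> (norm (c i) * T powr Re (p i)) * (norm (d j) * (1 / T) powr Re (q j)))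
        has_sum (norm (c i) * T powr Re (p i)) * (\<Sum>\<^sub>\<infinity>j. norm (d j) * (1 / T) powr Re (q j))) UNIV"
        using *(2) by (auto intro!: has_sum_cmult_right)
    qed (use *(1) in \<open>auto intro!: summable_on_cmult_left\<close>)
  qed
  hence "(\<lambda>x. (case x of (i, j) \<Rightarrow> (norm (c i) * T powr Re (p i)) * (norm (d j) * (1 / T) powr Re (q j))) * (1 / \<delta>)) summable_on UNIV \<times> UNIV"
    by (rule summable_on_cmult_left)
  hence "(\<lambda>x. norm (case x of (i, j) \<Rightarrow> a i j)) summable_on UNIV \<times> UNIV"
  proof (rule summable_on_comparison_test)
    fix x :: "'i \<times> 'j"
    obtain i j where x: "x = (i, j)" by force
    have "norm (a i j) = norm (c i) * norm (d j) * T powr (Re (p i) - Re (q j)) / norm (p i - q j)"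
      using T by (simp add: a_def norm_mult norm_divide norm_of_real_powr)
    also have "\<dots> \<le> norm (c i) * norm (d j) * T powr (Re (p i) - Re (q j)) / \<delta>"
      using \<delta>(1) \<delta>(2)[of i j] by (intro divide_left_mono mult_pos_pos) auto
    also have "T powr (Re (p i) - Re (q j)) = T powr Re (p i) * (1 / T) powr Re (q j)"
      using T by (simp add: powr_diff powr_divide)
    finally show "norm (case x of (i, j) \<Rightarrow> a i j) \<le> (case x of (i, j) \<Rightarrow> (norm (c i) * T powr Re (p i)) * (norm (d j) * (1 / T) powr Re (q j))) * (1 / \<delta>)"
      by (simp add: x mult_ac)
  qed auto
  hence as: "(\<lambda>(i, j). a i j) summable_on UNIV \<times> UNIV"
    by (rule abs_summable_summable)
  hence as': "(\<lambda>(j, i). a i j) summable_on UNIV \<times> UNIV"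
    by (subst summable_on_swap) (simp add: case_prod_unfold)
  have swap: "(\<Sum>\<^sub>\<infinity>i. \<Sum>\<^sub>\<infinity>j. a i j) = (\<Sum>\<^sub>\<infinity>j. \<Sum>\<^sub>\<infinity>i. a i j)"
    using as by (rule infsum_swap_banach)
  have s1: "(\<lambda>i. \<Sum>\<^sub>\<infinity>j. a i j) summable_on UNIV"
    using summable_on_Sigma_banach[OF as] .
  have s2: "(\<lambda>j. \<Sum>\<^sub>\<infinity>i. a i j) summable_on UNIV"
    using summable_on_Sigma_banach[OF as'] .
  have f1: "c i * fpm \<psi> d q (1 / T) (- p i) = c i * integral {1/T<..} (\<lambda>t. \<psi> t * of_real t powr (- p i - 1)) - (\<Sum>\<^sub>\<infinity>j. a i j)" for i
  proof -
    have "c i * (\<Sum>\<^sub>\<infinity>j. d j * of_real (1 / T) powr (q j + - p i) / (q j + - p i)) = (\<Sum>\<^sub>\<infinity>j. c i * (d j * of_real (1 / T) powr (q j + - p i) / (q j + - p i)))"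
      by (rule infsum_cmult_right'[symmetric])
    also have "\<dots> = (\<Sum>\<^sub>\<infinity>j. - a i j)"
    proof (rule infsum_cong)
      fix j
      have "p i - q j \<noteq> 0" using \<delta>(1) \<delta>(2)[of i j] by auto
      moreover have "complex_of_real (1 / T) powr (q j + - p i) = of_real T powr (p i - q j)"
        using T powr_of_real_exp[of "1 / T" "q j + - p i"]
        by (simp add: powr_of_real_exp ln_div algebra_simps del: of_real_divide)
      ultimately show "c i * (d j * of_real (1 / T) powr (q j + - p i) / (q j + - p i)) = - a i j"
        by (simp add: a_def field_simps)
    qed
    finally show ?thesis by (simp add: fpm_def distrib_left infsum_uminus)
  qed
  have f2: "d j * fpm \<phi> c p T (- q j) = d j * integral {T<..} (\<lambda>t. \<phi> t * of_real t powr (- q j - 1)) + (\<Sum>\<^sub>\<infinity>i. a i j)" for j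
    by (simp add: fpm_def distrib_left infsum_cmult_right'[symmetric] a_def mult_ac)
  have "(\<Sum>\<^sub>\<infinity>i. c i * fpm \<psi> d q (1 / T) (- p i)) = integral {1/T<..} (\<lambda>t. \<psi> t * \<phi> (1 / t) / of_real t) - (\<Sum>\<^sub>\<infinity>i. \<Sum>\<^sub>\<infinity>j. a i j)"
    unfolding f1 diff_conv_add_uminus using s1 B(2)
    by (subst infsum_add) (auto simp: has_sum_iff infsum_uminus summable_on_uminus)
  moreover show "(\<lambda>j. d j * fpm \<phi> c p T (- q j)) summable_on UNIV"
    unfolding f2 using s2 A(2) by (intro summable_on_add) (auto simp: has_sum_iff)
  moreover have "(\<Sum>\<^sub>\<infinity>j. d j * fpm \<phi> c p T (- q j)) = integral {T<..} (\<lambda>t. F t / of_real t) + (\<Sum>\<^sub>\<infinity>j. \<Sum>\<^sub>\<infinity>i. a i j)"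
    unfolding f2 using s2 A(2) by (subst infsum_add) (auto simp: has_sum_iff F_def)
  ultimately show "integral {0<..} (\<lambda>t. \<phi> t * \<psi> (1 / t) / of_real t) =
      (\<Sum>\<^sub>\<infinity>i. c i * fpm \<psi> d q (1 / T) (- p i)) + (\<Sum>\<^sub>\<infinity>j. d j * fpm \<phi> c p T (- q j))"
    using total swap by (simp add: F_def)
qed

text \<open>Serves the recurrences: S raises the power by one step, and h carries a weight that
  vanishes at the lowest powers, which S does not reach.\<close>

lemma has_sum_shift_iff:
  assumes "inj S" "\<And>i. i \<notin> range S \<Longrightarrow> h i = 0"
  shows "((\<lambda>i. h (S i)) has_sum v) UNIV \<longleftrightarrow> (h has_sum v) UNIV"
proof -
  have "(h has_sum v) UNIV \<longleftrightarrow> (h has_sum v) (range S)"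
    using assms(2) by (intro has_sum_cong_neutral) auto
  also have "\<dots> \<longleftrightarrow> ((\<lambda>i. h (S i)) has_sum v) UNIV"
    using has_sum_reindex[OF assms(1), of h v] by (simp add: o_def)
  finally show ?thesis by simp
qed

lemma has_integral_remove_left_endpoint:
  fixes f :: "real \<Rightarrow> 'a::banach"
  shows "(f has_integral v) {a<..} \<longleftrightarrow> (f has_integral v) {a..}"
    and "(f has_integral v) {a<..b} \<longleftrightarrow> (f has_integral v) {a..b}"
  by (rule has_integral_spike_set_eq; rule negligible_subset[of "{a}"]; force)+

lemma power_integral:
  assumes w: "Re w > 0" and T: "T > 0"
  shows "(\<lambda>t. complex_of_real t powr (w - 1)) absolutely_integrable_on {0<..T}"
    and "integral {0<..T} (\<lambda>t. complex_of_real t powr (w - 1)) = of_real T powr w / w"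
    and "integral {0<..T} (\<lambda>t. norm (complex_of_real t powr (w - 1))) = T powr Re w / Re w"
proof -
  have w0: "w \<noteq> 0" using w by auto
  have r: "((\<lambda>t. t powr (Re w - 1)) has_integral (T powr Re w / Re w)) {0..T}"
    using has_integral_powr_from_0[of "Re w - 1" T] w T by simp
  have rn: "((\<lambda>t. norm (complex_of_real t powr (w - 1))) has_integral (T powr Re w / Re w)) {0<..T}"
  proof -
    have "((\<lambda>t. norm (complex_of_real t powr (w - 1))) has_integral (T powr Re w / Re w)) {0..T}"
      by (rule has_integral_spike_finite[OF _ _ r, of "{0}"]) (auto simp: norm_of_real_powr)
    thus ?thesis by (simp only: has_integral_remove_left_endpoint)
  qed
  \<comment> \<open>The continuity rule for positive arguments would be tried on the closed interval
    and fail at 0; there the primitive is continuous because Re w > 0.\<close>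
  note [continuous_intros del] = continuous_on_of_real_powr
  have "((\<lambda>t. complex_of_real t powr (w - 1)) has_integral (of_real T powr w / w - of_real 0 powr w / w)) {0..T}"
    using w T w0
    by (intro fundamental_theorem_of_calculus_interior)
       (auto intro!: continuous_intros derivative_eq_intros has_vector_derivative_real_field)
  hence c: "((\<lambda>t. complex_of_real t powr (w - 1)) has_integral (of_real T powr w / w)) {0<..T}"
    using w0 by (simp add: has_integral_remove_left_endpoint)
  show "(\<lambda>t. complex_of_real t powr (w - 1)) absolutely_integrable_on {0<..T}"
    using c rn by (auto simp: absolutely_integrable_on_def integrable_on_def)
  show "integral {0<..T} (\<lambda>t. complex_of_real t powr (w - 1)) = of_real T powr w / w"
    and "integral {0<..T} (\<lambda>t. norm (complex_of_real t powr (w - 1))) = T powr Re w / Re w"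
    using c rn by (auto intro: integral_unique)
qed

lemma absolutely_integrable_Un_split:
  fixes f :: "real \<Rightarrow> complex"
  assumes "T > 0" "f absolutely_integrable_on {0<..T}" "f absolutely_integrable_on {T<..}"
  shows "f absolutely_integrable_on {0<..}"
    and "integral {0<..} f = integral {0<..T} f + integral {T<..} f"
proof -
  have un: "{0<..} = {0<..T} \<union> {T<..}" using assms(1) by auto
  show "f absolutely_integrable_on {0<..}"
    unfolding un using assms by (intro set_integrable_Un) auto
  have "(f has_integral (integral {0<..T} f + integral {T<..} f)) ({0<..T} \<union> {T<..})"
  proof (intro has_integral_Un integrable_integral)
    have "{0<..T} \<inter> {T<..} = {}" by auto
    thus "negligible ({0<..T} \<inter> {T<..})" by simp
  qed (use assms in \<open>auto simp: absolutely_integrable_on_def\<close>)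
  thus "integral {0<..} f = integral {0<..T} f + integral {T<..} f"
    unfolding un[symmetric] by (rule integral_unique)
qed

text \<open>If all p i + s have real part at least a fixed P > 0, the series may be integrated
  termwise over (0, T], and the series part of \<open>fpm\<close> is exactly that integral. This is
  where the recurrences for the moments start.\<close>

lemma fpm_eq_integral:
  fixes c p :: "'i::countable \<Rightarrow> complex"
  assumes e: "expands f c p T" and P: "P > 0" "\<And>i. P \<le> Re (p i + s)"
    and f: "(\<lambda>t. f t * of_real t powr (s - 1)) absolutely_integrable_on {T<..}"
  shows "(\<lambda>t. f t * of_real t powr (s - 1)) absolutely_integrable_on {0<..}"
    and "fpm f c p T s = integral {0<..} (\<lambda>t. f t * of_real t powr (s - 1))"
proof -
  have T: "T > 0" using e by (simp add: expands_def)
  define g where "g i t = c i * complex_of_real t powr (p i + s - 1)" for i t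
  have pos: "Re (p i + s) > 0" for i using P(1) P(2)[of i] by linarith
  have g: "g i absolutely_integrable_on {0<..T}" for i
    unfolding g_def by (intro set_integrable_mult_right power_integral pos T)
  have sm: "(\<lambda>i. integral {0<..T} (\<lambda>t. norm (g i t))) summable_on UNIV"
  proof (rule summable_on_comparison_test)
    show "(\<lambda>i. norm (c i) * T powr Re (p i) * (T powr Re s / P)) summable_on UNIV"
      using e by (intro summable_on_cmult_left) (auto simp: expands_def)
    fix i
    have eq: "integral {0<..T} (\<lambda>t. norm (g i t)) = norm (c i) * (T powr Re (p i + s) / Re (p i + s))"
      using power_integral(3)[OF pos T, of i] by (simp add: g_def norm_mult)
    also have "\<dots> \<le> norm (c i) * (T powr Re (p i + s) / P)"
      using P(1) P(2)[of i] pos[of i] by (intro mult_left_mono divide_left_mono) auto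
    also have "\<dots> = norm (c i) * T powr Re (p i) * (T powr Re s / P)"
      by (simp add: powr_add)
    finally show "integral {0<..T} (\<lambda>t. norm (g i t)) \<le> norm (c i) * T powr Re (p i) * (T powr Re s / P)" .
    show "0 \<le> integral {0<..T} (\<lambda>t. norm (g i t))"
      unfolding eq using pos[of i] by simp
  qed
  have hs: "((\<lambda>i. g i t) has_sum (f t * of_real t powr (s - 1))) UNIV" if t: "t \<in> {0<..T}" for t
  proof -
    have "((\<lambda>i. c i * of_real t powr p i * of_real t powr (s - 1)) has_sum (f t * of_real t powr (s - 1))) UNIV"
      using e t unfolding expands_def by (intro has_sum_cmult_left) blast
    moreover have "c i * of_real t powr p i * of_real t powr (s - 1) = g i t" for i
      using powr_add[of "complex_of_real t" "p i" "s - 1"] by (simp add: g_def add_diff_eq)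
    ultimately show ?thesis by simp
  qed
  note I = integral_infsum[OF g _ sm hs]
  have I1: "(\<lambda>t. f t * of_real t powr (s - 1)) absolutely_integrable_on {0<..T}"
    by (rule I) auto
  have "((\<lambda>i. integral {0<..T} (g i)) has_sum integral {0<..T} (\<lambda>t. f t * of_real t powr (s - 1))) UNIV"
    by (rule I) auto
  moreover have "integral {0<..T} (g i) = c i * of_real T powr (p i + s) / (p i + s)" for i
    using power_integral(2)[OF pos T, of i] by (simp add: g_def[abs_def])
  ultimately have "(\<Sum>\<^sub>\<infinity>i. c i * of_real T powr (p i + s) / (p i + s)) = integral {0<..T} (\<lambda>t. f t * of_real t powr (s - 1))"
    by (simp add: infsumI)
  thus "fpm f c p T s = integral {0<..} (\<lambda>t. f t * of_real t powr (s - 1))"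
    "(\<lambda>t. f t * of_real t powr (s - 1)) absolutely_integrable_on {0<..}"
    using absolutely_integrable_Un_split[OF T I1 f] by (simp_all add: fpm_def)
qed

lemma expands_summable:
  fixes c p :: "'i::countable \<Rightarrow> complex"
  assumes e: "expands f c p T" and \<delta>: "\<delta> > 0" "\<And>i. \<delta> \<le> norm (p i + s)"
  shows "(\<lambda>i. c i * of_real T powr (p i + s) / (p i + s)) summable_on UNIV"
proof (rule abs_summable_summable, rule summable_on_comparison_test)
  have T: "T > 0" using e by (simp add: expands_def)
  show "(\<lambda>i. norm (c i) * T powr Re (p i) * (T powr Re s / \<delta>)) summable_on UNIV"
    using e by (intro summable_on_cmult_left) (auto simp: expands_def)
  fix i
  have "norm (c i * of_real T powr (p i + s) / (p i + s)) = norm (c i) * (T powr Re (p i + s) / norm (p i + s))"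
    using T by (simp add: norm_mult norm_divide norm_of_real_powr)
  also have "\<dots> \<le> norm (c i) * (T powr Re (p i + s) / \<delta>)"
    using \<delta>(1) \<delta>(2)[of i] by (intro mult_left_mono divide_left_mono mult_pos_pos) auto
  also have "\<dots> = norm (c i) * T powr Re (p i) * (T powr Re s / \<delta>)"
    by (simp add: powr_add)
  finally show "norm (c i * of_real T powr (p i + s) / (p i + s)) \<le> norm (c i) * T powr Re (p i) * (T powr Re s / \<delta>)" .
qed auto

lemma fpm_powr_times:
  "fpm (\<lambda>t. of_real t powr b * f t) c (\<lambda>i. p i + b) T s = fpm f c p T (s + b)" if "T > 0"
proof -
  have "integral {T<..} (\<lambda>t. of_real t powr b * f t * of_real t powr (s - 1)) = integral {T<..} (\<lambda>t. f t * of_real t powr (s + b - 1))"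
  proof (rule integral_cong)
    show "of_real t powr b * f t * of_real t powr (s - 1) = f t * of_real t powr (s + b - 1)" for t
      using powr_add[of "complex_of_real t" b "s - 1"] by (simp add: algebra_simps)
  qed
  thus ?thesis by (simp add: fpm_def add_ac)
qed

lemma expands_powr_times:
  assumes "expands f c p T"
  shows "expands (\<lambda>t. of_real t powr b * f t) c (\<lambda>i. p i + b) T"
proof -
  have T: "T > 0" using assms by (simp add: expands_def)
  have "(\<lambda>i. norm (c i) * T powr Re (p i) * T powr Re b) summable_on UNIV"
    using assms by (intro summable_on_cmult_left) (simp add: expands_def)
  moreover have "((\<lambda>i. of_real t powr b * (c i * of_real t powr p i)) has_sum (of_real t powr b * f t)) UNIV" if "t \<in> {0<..T}" for t
    using assms that unfolding expands_def by (intro has_sum_cmult_right) blast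
  ultimately show ?thesis
    using T by (simp add: expands_def powr_add mult_ac)
qed

lemma nonint_dist:
  fixes z :: complex
  assumes "z \<notin> \<int>"
  obtains \<delta> where "\<delta> > 0" "\<And>m. m \<in> \<int> \<Longrightarrow> \<delta> \<le> norm (z - m)"
proof
  show "infdist z \<int> > 0"
    using assms closed_Ints[where 'a = complex] infdist_nonneg[of z \<int>]
    by (metis Ints_0 empty_iff in_closed_iff_infdist_zero less_eq_real_def)
  show "infdist z \<int> \<le> norm (z - m)" if "m \<in> \<int>" for m
    using infdist_le[OF that, of z] by (simp add: dist_norm)
qed

section \<open>Tail integrals and partial integration\<close>

lemma integral_tail_tendsto:
  fixes f :: "real \<Rightarrow> complex"
  assumes "f absolutely_integrable_on {T<..}"
  shows "(\<lambda>n. integral {T..T + real n} f) \<longlonglongrightarrow> integral {T<..} f"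
proof -
  let ?f = "\<lambda>n t. if t \<in> {T<..T + real n} then f t else 0"
  have "(\<lambda>n. integral {T<..} (?f n)) \<longlonglongrightarrow> integral {T<..} f"
  proof (rule dominated_convergence)
    fix n
    have "f absolutely_integrable_on {T<..T + real n}"
      by (rule set_integrable_subset[OF assms]) auto
    hence "f integrable_on {T<..T + real n}" by (simp add: absolutely_integrable_on_def)
    thus "?f n integrable_on {T<..}"
      by (subst integrable_restrict_Int) (simp add: Int_absorb2 Ioc_subset_iff subset_eq)
  next
    show "(\<lambda>t. norm (f t)) integrable_on {T<..}"
      using assms by (simp add: absolutely_integrable_on_def)
    show "norm (?f n t) \<le> norm (f t)" for n t by simp
    show "(\<lambda>n. ?f n t) \<longlonglongrightarrow> f t" if "t \<in> {T<..}" for t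
    proof (rule tendsto_eventually)
      have "eventually (\<lambda>n. real n \<ge> t - T) sequentially"
        using filterlim_real_sequentially filterlim_at_top by blast
      thus "eventually (\<lambda>n. ?f n t = f t) sequentially"
        by eventually_elim (use that in auto)
    qed
  qed
  moreover have "integral {T<..} (?f n) = integral {T..T + real n} f" for n
  proof -
    have "integral {T<..} (?f n) = integral {T<..T + real n} f"
    proof -
      have "{T<..T + real n} \<inter> {T<..} = {T<..T + real n}" by auto
      thus ?thesis by (simp only: Henstock_Kurzweil_Integration.integral_restrict_Int)
    qed
    also have "\<dots> = integral {T..T + real n} f"
      by (rule integral_spike_set) (rule negligible_subset[of "{T}"], auto)+
    finally show ?thesis .
  qed
  ultimately show ?thesis by simp
qed

text \<open>Absolute integrability is known beforehand, so it is enough to follow the primitive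
  along the end points T + n.\<close>

lemma FTC_tail:
  fixes f F :: "real \<Rightarrow> complex"
  assumes "f absolutely_integrable_on {T<..}"
    and "\<And>t. t \<ge> T \<Longrightarrow> (F has_vector_derivative f t) (at t)"
    and "(\<lambda>n. F (T + real n)) \<longlonglongrightarrow> 0"
  shows "integral {T<..} f = - F T"
proof -
  have "integral {T..T + real n} f = F (T + real n) - F T" for n
    using assms(2) by (intro integral_unique fundamental_theorem_of_calculus)
       (auto intro: has_vector_derivative_at_within)
  with integral_tail_tendsto[OF assms(1)] have "(\<lambda>n. F (T + real n) - F T) \<longlonglongrightarrow> integral {T<..} f"
    by simp
  moreover have "(\<lambda>n. F (T + real n) - F T) \<longlonglongrightarrow> 0 - F T"
    by (intro tendsto_intros assms)
  ultimately show ?thesis using LIMSEQ_unique by fastforce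
qed

lemma power_tail_integral:
  assumes T: "T > 0" and s: "Re s < 0"
  shows "(\<lambda>t. complex_of_real t powr (s - 1)) absolutely_integrable_on {T<..}"
    and "integral {T<..} (\<lambda>t. complex_of_real t powr (s - 1)) = - (of_real T powr s / s)"
proof -
  have r: "((\<lambda>t. t powr (Re s - 1)) has_integral - (T powr Re s) / Re s) {T..}"
    using has_integral_powr_to_inf[of "Re s - 1" T] s T by simp
  have "(\<lambda>t. t powr (Re s - 1)) integrable_on {T<..}"
    using r unfolding integrable_on_def has_integral_remove_left_endpoint by blast
  thus 1: "(\<lambda>t. complex_of_real t powr (s - 1)) absolutely_integrable_on {T<..}"
    by (rule measurable_bounded_by_integrable_imp_absolutely_integrable[rotated 2])
       (use T in \<open>auto simp: norm_of_real_powr intro!: continuous_imp_measurable_on_sets_lebesgue continuous_intros\<close>)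
  show "integral {T<..} (\<lambda>t. complex_of_real t powr (s - 1)) = - (of_real T powr s / s)"
  proof (rule FTC_tail[OF 1])
    show "((\<lambda>t. complex_of_real t powr s / s) has_vector_derivative complex_of_real t powr (s - 1)) (at t)" if "t \<ge> T" for t
      using that T s by (auto intro!: derivative_eq_intros has_vector_derivative_real_field)
    have "(\<lambda>n. (T + real n) powr Re s) \<longlonglongrightarrow> 0"
    proof (rule tendsto_neg_powr[OF s])
      show "filterlim (\<lambda>n. T + real n) at_top sequentially"
        by (rule filterlim_tendsto_add_at_top[OF tendsto_const filterlim_real_sequentially])
    qed
    hence "(\<lambda>n. norm (complex_of_real (T + real n) powr s)) \<longlonglongrightarrow> 0"
      using T by (simp add: norm_of_real_powr add_pos_nonneg del: of_real_add)
    hence "(\<lambda>n. complex_of_real (T + real n) powr s) \<longlonglongrightarrow> 0"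
      by (rule tendsto_norm_zero_cancel)
    moreover have "s \<noteq> 0" using s by auto
    ultimately show "(\<lambda>n. complex_of_real (T + real n) powr s / s) \<longlonglongrightarrow> 0"
      using tendsto_divide[OF _ tendsto_const, of _ 0 sequentially s] by auto
  qed
qed

section \<open>Finite-part moments of the exponential\<close>

definition expc :: "real \<Rightarrow> nat \<Rightarrow> complex" where
  "expc y k = (- of_real y) ^ k / fact k"

lemma expc_Suc: "of_nat (Suc k) * expc y (Suc k) = - of_real y * expc y k"
  by (simp add: expc_def field_simps del: of_nat_Suc)

lemma expands_exp:
  assumes "T > 0"
  shows "expands (\<lambda>t. of_real (exp (- (y * t)))) (expc y) of_nat T"
proof -
  have n: "summable (\<lambda>k. norm (expc y k * of_real t ^ k))" for t
  proof -
    have "norm (expc y k * of_real t ^ k) = \<bar>y * t\<bar> ^ k /\<^sub>R fact k" for k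
    proof -
      have "norm (expc y k * of_real t ^ k) = \<bar>y * t\<bar> ^ k / fact k"
        by (simp add: expc_def norm_mult norm_divide norm_power abs_mult power_mult_distrib)
      thus ?thesis by (simp add: divide_inverse mult.commute)
    qed
    thus ?thesis using summable_exp_generic[of "\<bar>y * t\<bar>"] by simp
  qed
  have h: "((\<lambda>k. expc y k * of_real t ^ k) has_sum (of_real (exp (- (y * t))))) UNIV" for t
  proof (rule norm_summable_imp_has_sum[OF n])
    have "(- complex_of_real (y * t)) ^ k /\<^sub>R fact k = expc y k * of_real t ^ k" for k
      by (simp add: expc_def scaleR_conv_of_real divide_inverse power_mult_distrib[symmetric])
    moreover have "complex_of_real (exp (- (y * t))) = exp (- complex_of_real (y * t))"
      by (simp add: exp_of_real[symmetric])
    ultimately show "(\<lambda>k. expc y k * of_real t ^ k) sums of_real (exp (- (y * t)))"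
      using exp_converges[of "- complex_of_real (y * t)"] by simp
  qed
  have "(\<lambda>k. norm (expc y k * of_real T ^ k)) summable_on UNIV"
    using n by (intro summable_nonneg_imp_summable_on) auto
  thus ?thesis
    using assms h by (auto simp: expands_def powr_nat norm_mult norm_power powr_realpow)
qed

lemma exp_tail_integrable:
  assumes y: "y > 0" and T: "T > 0"
  shows "(\<lambda>t. of_real (exp (- (y * t))) * complex_of_real t powr (s - 1)) absolutely_integrable_on {T<..}"
proof (cases "Re s < 0")
  case True
  show ?thesis
    using T y True by (intro absolutely_integrable_mult_bounded[OF power_tail_integral(1)[OF T], where B = 1]) (auto intro!: continuous_intros)
next
  case False
  \<comment> \<open>A larger exponent m whose Gamma integral converges; on (T, \<infinity>) the
    remaining power s - m is bounded.\<close>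
  obtain m :: nat where m: "Re s < real m" using reals_Archimedean2 by blast
  have f: "(\<lambda>t. complex_of_real t powr (of_nat m - 1) * of_real (exp (- (y * t)))) absolutely_integrable_on {T<..}"
    by (rule set_integrable_subset[OF scaled_Gamma_integral(1)[OF y]]) (use False T m in auto)
  have "(\<lambda>t. complex_of_real t powr (s - of_nat m) * (complex_of_real t powr (of_nat m - 1) * of_real (exp (- (y * t))))) absolutely_integrable_on {T<..}"
  proof (rule absolutely_integrable_mult_bounded[OF f])
    show "norm (complex_of_real t powr (s - of_nat m)) \<le> T powr (Re s - real m)" if "t \<in> {T<..}" for t
      using that T m by (simp add: norm_of_real_powr powr_mono2')
  qed (use T in \<open>auto intro!: continuous_intros\<close>)
  moreover have "complex_of_real t powr (s - of_nat m) * (complex_of_real t powr (of_nat m - 1) * of_real (exp (- (y * t)))) =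
     of_real (exp (- (y * t))) * complex_of_real t powr (s - 1)" for t
    using powr_add[of "complex_of_real t" "s - of_nat m" "of_nat m - 1"] by simp
  ultimately show ?thesis by simp
qed

lemma has_sum_minus:
  fixes f g :: "'i \<Rightarrow> complex"
  assumes "(f has_sum a) A" "(g has_sum b) A"
  shows "((\<lambda>i. f i - g i) has_sum (a - b)) A"
  using has_sum_add[OF assms(1) has_sum_uminusI[OF assms(2)]] by simp

text \<open>Partial integration on (T, \<infinity>) leaves a boundary value at T. The series part
  leaves the opposite one: multiplying its terms by k + s removes the denominators, and they add up
  to the expansion of the function at T. So finite parts obey partial integration without boundary
  terms.\<close>

lemma fpm_exp_rec:
  assumes y: "y > 0" and T: "T > 0" and s: "s \<notin> \<int>"
  shows "of_real y * fpm (\<lambda>t. of_real (exp (- (y * t)))) (expc y) of_nat T (s + 1) =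
         s * fpm (\<lambda>t. of_real (exp (- (y * t)))) (expc y) of_nat T s"
proof -
  let ?f = "\<lambda>t. complex_of_real (exp (- (y * t)))"
  define I where "I s = integral {T<..} (\<lambda>t. ?f t * of_real t powr (s - 1))" for s
  have i: "(\<lambda>t. ?f t * of_real t powr (s - 1)) integrable_on {T<..}" for s
    using exp_tail_integrable[OF y T] by (simp add: absolutely_integrable_on_def)
  obtain \<delta> where d: "\<delta> > 0" "\<And>m. m \<in> \<int> \<Longrightarrow> \<delta> \<le> norm (s - m)" using nonint_dist[OF s] by metis
  have d0: "\<delta> \<le> norm (of_nat k + s)" for k
    using d(2)[of "- of_nat k"] by (simp add: add.commute)
  have d1: "\<delta> \<le> norm (of_nat k + (s + 1))" for k
    using d0[of "Suc k"] by (simp add: add_ac)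
  have nz: "of_nat k + s \<noteq> 0" for k using d0[of k] d(1) by auto
  define h0 where "h0 k = expc y k * of_real T powr (of_nat k + s) / (of_nat k + s)" for k
  define h1 where "h1 k = expc y k * of_real T powr (of_nat k + (s + 1)) / (of_nat k + (s + 1))" for k
  have S0: "(h0 has_sum infsum h0 UNIV) UNIV" and S1: "(h1 has_sum infsum h1 UNIV) UNIV"
    using expands_summable[OF expands_exp[OF T] d(1) d0] expands_summable[OF expands_exp[OF T] d(1) d1]
    by (simp_all add: h0_def[abs_def] h1_def[abs_def])
  have h1: "of_real y * h1 k = - of_nat (Suc k) * h0 (Suc k)" for k
    using expc_Suc[of k y] by (simp add: h0_def h1_def add_ac mult.assoc[symmetric] del: of_nat_Suc) (simp add: add_ac)
  have "((\<lambda>k. - of_nat (Suc k) * h0 (Suc k)) has_sum of_real y * infsum h1 UNIV) UNIV"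
    using has_sum_cmult_right[OF S1, of "of_real y"] unfolding h1 .
  \<comment> \<open>The term k = 0, which the shift by \<open>Suc\<close> misses, has weight
    0.\<close>
  hence "((\<lambda>k. - of_nat k * h0 k) has_sum of_real y * infsum h1 UNIV) UNIV"
    using has_sum_shift_iff[of Suc "\<lambda>k. - of_nat k * h0 k"] by (auto simp: image_iff) (metis not0_implies_Suc)
  from has_sum_minus[OF this has_sum_cmult_right[OF S0, of s]]
  have "((\<lambda>k. - (expc y k * of_real T powr of_nat k) * of_real T powr s) has_sum (of_real y * infsum h1 UNIV - s * infsum h0 UNIV)) UNIV"
  proof (rule has_sum_cong[THEN iffD1, rotated])
    fix k
    have "- of_nat k * h0 k - s * h0 k = - ((of_nat k + s) * h0 k)" by (simp add: algebra_simps)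
    also have "(of_nat k + s) * h0 k = expc y k * of_real T powr (of_nat k + s)"
      using nz[of k] by (simp add: h0_def)
    finally show "- of_nat k * h0 k - s * h0 k = - (expc y k * of_real T powr of_nat k) * of_real T powr s"
      by (simp add: powr_add)
  qed
  moreover have "((\<lambda>k. - (expc y k * of_real T powr of_nat k) * of_real T powr s) has_sum (- ?f T * of_real T powr s)) UNIV"
    using expands_exp[OF T, of y] T by (intro has_sum_cmult_left has_sum_uminusI) (auto simp: expands_def)
  ultimately have S: "of_real y * infsum h1 UNIV - s * infsum h0 UNIV = - ?f T * of_real T powr s"
    by (rule has_sum_unique)
  have "integral {T<..} (\<lambda>t. s * (?f t * of_real t powr (s - 1)) - of_real y * (?f t * of_real t powr (s + 1 - 1))) = - (of_real T powr s * ?f T)"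
  proof (rule FTC_tail)
    show "(\<lambda>t. s * (?f t * of_real t powr (s - 1)) - of_real y * (?f t * of_real t powr (s + 1 - 1))) absolutely_integrable_on {T<..}"
      by (intro set_integral_diff(1) set_integrable_mult_right exp_tail_integrable y T)
    show "((\<lambda>t. of_real t powr s * ?f t) has_vector_derivative s * (?f t * of_real t powr (s - 1)) - of_real y * (?f t * of_real t powr (s + 1 - 1))) (at t)" if "t \<ge> T" for t
    proof -
      have 1: "((\<lambda>t. complex_of_real t powr s) has_vector_derivative (s * of_real t powr (s - 1))) (at t)"
        using that T by (auto intro!: derivative_eq_intros has_vector_derivative_real_field)
      have 2: "(?f has_vector_derivative of_real (- y * exp (- (y * t)))) (at t)"
        by (intro has_vector_derivative_of_real) (auto intro!: derivative_eq_intros)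
      from has_vector_derivative_mult[OF 1 2] show ?thesis by (simp add: algebra_simps)
    qed
    have "(\<lambda>n. (T + real n) powr Re s * exp (- (y * (T + real n)))) \<longlonglongrightarrow> 0"
      using y by real_asymp
    hence "(\<lambda>n. norm (complex_of_real (T + real n) powr s * ?f (T + real n))) \<longlonglongrightarrow> 0"
      using T by (simp add: norm_mult norm_of_real_powr add_pos_nonneg del: of_real_add)
    thus "(\<lambda>n. complex_of_real (T + real n) powr s * ?f (T + real n)) \<longlonglongrightarrow> 0"
      by (rule tendsto_norm_zero_cancel)
  qed
  hence "s * I s - of_real y * I (s + 1) = - (of_real T powr s * ?f T)"
    unfolding I_def using i[of s] i[of "s + 1"] by (subst (asm) integral_diff) (auto intro!: integrable_on_mult_right)
  with S have "of_real y * infsum h1 UNIV - s * infsum h0 UNIV = s * I s - of_real y * I (s + 1)"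
    by simp
  hence "of_real y * (I (s + 1) + infsum h1 UNIV) = s * (I s + infsum h0 UNIV)"
    by (simp only: ring_distribs diff_eq_eq) (simp add: algebra_simps)
  moreover have "fpm ?f (expc y) of_nat T s = I s + infsum h0 UNIV"
    "fpm ?f (expc y) of_nat T (s + 1) = I (s + 1) + infsum h1 UNIV"
    by (simp_all add: fpm_def I_def h0_def[abs_def] h1_def[abs_def])
  ultimately show ?thesis by simp
qed

text \<open>The n of the induction counts the unit steps from s into the half plane of convergence;
  the recurrence, which Gamma obeys as well, carries Euler's integral back to the left.\<close>

lemma fpm_exp:
  assumes y: "y > 0" and T: "T > 0" and s: "s \<notin> \<int>"
  shows "fpm (\<lambda>t. of_real (exp (- (y * t)))) (expc y) of_nat T s = of_real y powr (- s) * Gamma s"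
proof -
  have "fpm (\<lambda>t. of_real (exp (- (y * t)))) (expc y) of_nat T s = of_real y powr (- s) * Gamma s"
    if "Re s + real n > 0" "s \<notin> \<int>" for n
    using that
  proof (induction n arbitrary: s)
    case 0
    have "fpm (\<lambda>t. of_real (exp (- (y * t)))) (expc y) of_nat T s =
        integral {0<..} (\<lambda>t. of_real (exp (- (y * t))) * of_real t powr (s - 1))"
      using 0 by (intro fpm_eq_integral(2)[OF expands_exp[OF T], of "Re s"] exp_tail_integrable y T) auto
    also have "\<dots> = of_real y powr (- s) * Gamma s"
      using scaled_Gamma_integral(2)[OF y, of s] 0 by (simp add: mult.commute)
    finally show ?case .
  next
    case (Suc n)
    have s1: "s + 1 \<notin> \<int>" using Suc.prems(2) by (metis Ints_1 Ints_diff add_diff_cancel_right')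
    have s0: "s \<noteq> 0" using Suc.prems(2) by auto
    have "of_real y * (of_real y powr (- (s + 1)) * Gamma (s + 1)) = s * fpm (\<lambda>t. of_real (exp (- (y * t)))) (expc y) of_nat T s"
      using Suc.IH[OF _ s1] Suc.prems fpm_exp_rec[OF y T Suc.prems(2)] by (simp add: add_ac)
    moreover have "of_real y * of_real y powr (- (s + 1)) = complex_of_real y powr (- s)"
      using powr_add[of "complex_of_real y" 1 "- (s + 1)"] y by simp
    moreover have "Gamma (s + 1) = s * Gamma s"
      using Suc.prems(2) by (intro Gamma_plus1) (use nonpos_Ints_Int in blast)
    ultimately have "s * fpm (\<lambda>t. of_real (exp (- (y * t)))) (expc y) of_nat T s = s * (of_real y powr (- s) * Gamma s)"
      by (metis mult.assoc mult.left_commute)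
    thus ?case using s0 by simp
  qed
  moreover obtain n where "Re s + real n > 0"
    by (metis add.commute neg_less_iff_less real_0_less_add_iff reals_Archimedean2)
  ultimately show ?thesis using s by blast
qed

section \<open>The series of the Macdonald function\<close>

text \<open>The regularized hypergeometric series 0F1(; w + 1; x), the factor that
  \<open>besselI\<close> and \<open>besselJ\<close> have in common.\<close>

definition bsum :: "complex \<Rightarrow> complex \<Rightarrow> complex" where
  "bsum w x = (\<Sum>k. x ^ k / of_nat (fact k) * rGamma (w + of_nat k + 1))"

lemma besselI_bsum: "besselI w z = (z / 2) powr w * bsum w ((z / 2)\<^sup>2)"
  by (simp add: besselI_def bsum_def power_mult)

lemma besselJ_bsum: "besselJ w z = (z / 2) powr w * bsum w (- ((z / 2)\<^sup>2))"
proof -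
  have "(- ((z / 2)\<^sup>2)) ^ k = (- 1) ^ k * (z / 2) ^ (2 * k)" for k
    by (subst power_minus) (simp add: power_mult)
  thus ?thesis by (simp add: besselJ_def bsum_def)
qed

text \<open>The quadratic weight is there for \<open>kL_integral\<close>, whose terms carry the
  factor kp^2 - w^2.\<close>

lemma Gamma_shift_summable:
  fixes w :: complex
  assumes w: "w \<notin> \<int>" and B: "B \<ge> 1" and R: "R \<ge> 0"
  shows "summable (\<lambda>k. norm (Gamma (- w - of_nat k) / fact k) * (real k + B)\<^sup>2 * R ^ k)"
proof -
  \<comment> \<open>N \<ge> norm w gives norm (w + k + 1) \<ge> 1, so the Gamma factor does not
    grow. The quadratic weight grows by at most the factor 4, and R \<le> (k + 1) / 8 then still
    leaves the ratio 1/2.\<close>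
  obtain N :: nat where N: "real N \<ge> norm w" "real N \<ge> 8 * R"
    by (metis max.bounded_iff real_arch_simple)
  show ?thesis
  proof (rule summable_ratio_test[of "1/2" N])
    fix k :: nat assume k: "k \<ge> N"
    have nz: "w + of_nat (Suc k) \<noteq> 0"
      using w by (metis Ints_minus Ints_of_nat eq_neg_iff_add_eq_0)
    have "- w - of_nat (Suc k) \<notin> \<int>"
      using w by (metis Ints_diff Ints_minus Ints_of_nat add.commute diff_add_cancel minus_diff_eq uminus_add_conv_diff)
    hence "Gamma (- w - of_nat (Suc k) + 1) = (- w - of_nat (Suc k)) * Gamma (- w - of_nat (Suc k))"
      by (intro Gamma_plus1) (use nonpos_Ints_Int in blast)
    hence g: "Gamma (- w - of_nat k) = (- w - of_nat (Suc k)) * Gamma (- w - of_nat (Suc k))"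
      by (simp add: algebra_simps)
    have "norm (- w - of_nat (Suc k)) = norm (of_nat (Suc k) + w)"
      by (metis add.commute minus_add_distrib norm_minus_cancel uminus_add_conv_diff diff_conv_add_uminus)
    also have "\<dots> \<ge> real (Suc k) - norm w"
      by (metis norm_diff_ineq norm_of_nat)
    finally have n1: "norm (- w - of_nat (Suc k)) \<ge> 1"
      using N(1) k by simp
    let ?G = "norm (Gamma (- w - of_nat (Suc k)))"
    have G: "?G \<le> norm (Gamma (- w - of_nat k))"
      unfolding g norm_mult using n1 by (simp add: mult_right_mono mult_le_cancel_right1)
    have "(real (Suc k) + B)\<^sup>2 \<le> (2 * (real k + B))\<^sup>2"
      using B by (intro power_mono) auto
    hence B4: "(real (Suc k) + B)\<^sup>2 \<le> 4 * (real k + B)\<^sup>2"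
      by (simp only: power_mult_distrib) simp
    have R8: "R \<le> real (Suc k) / 8" using N(2) k by simp
    have "?G * (real (Suc k) + B)\<^sup>2 * R \<le> norm (Gamma (- w - of_nat k)) * (4 * (real k + B)\<^sup>2) * (real (Suc k) / 8)"
      by (intro mult_mono G B4 R8 mult_nonneg_nonneg) (use R in auto)
    hence "(?G * (real (Suc k) + B)\<^sup>2 * R) * (R ^ k / fact (Suc k)) \<le> (norm (Gamma (- w - of_nat k)) * (4 * (real k + B)\<^sup>2) * (real (Suc k) / 8)) * (R ^ k / fact (Suc k))"
      using R by (intro mult_right_mono) auto
    also have "\<dots> = norm (Gamma (- w - of_nat k)) * (real k + B)\<^sup>2 * R ^ k / (2 * fact k)"
      by (simp add: divide_simps del: of_nat_Suc)
    finally show "norm (norm (Gamma (- w - of_nat (Suc k)) / fact (Suc k)) * (real (Suc k) + B)\<^sup>2 * R ^ Suc k)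
        \<le> 1 / 2 * norm (norm (Gamma (- w - of_nat k) / fact k) * (real k + B)\<^sup>2 * R ^ k)"
      using R by (simp add: norm_divide mult_ac abs_mult del: fact_Suc of_nat_Suc)
  qed simp
qed

text \<open>The reflection formula, in which the sine of pi (- w - k) yields the sign (-1)^k. It
  carries the Gamma values of the finite-part moments into the reciprocal Gamma values of the Bessel
  series.\<close>

lemma Gamma_rGamma_shift:
  fixes w :: complex
  assumes w: "w \<notin> \<int>"
  shows "(- 1) ^ k * Gamma (- w - of_nat k) = - (of_real pi / sin (w * of_real pi)) * rGamma (w + of_nat k + 1)"
proof -
  have s: "sin (of_real pi * (- w - of_nat k)) = - ((- 1) ^ k * sin (w * of_real pi))"
  proof -
    have "sin (of_real pi * (- w - of_nat k)) = - sin (of_real pi * w + of_nat k * of_real pi)"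
      by (subst sin_minus[symmetric]) (simp add: algebra_simps)
    also have "sin (of_real pi * w + of_nat k * of_real pi) = (- 1) ^ k * sin (w * of_real pi)"
    proof (induction k)
      case (Suc k)
      have "sin (of_real pi * w + of_nat (Suc k) * of_real pi) = sin ((of_real pi * w + of_nat k * of_real pi) + of_real pi)"
        by (simp add: algebra_simps)
      also have "\<dots> = - sin (of_real pi * w + of_nat k * of_real pi)" by (simp add: sin_add)
      finally show ?case using Suc by simp
    qed (simp add: mult.commute)
    finally show ?thesis .
  qed
  have ni: "w + of_nat k + 1 \<notin> \<int>"
    using w by (metis Ints_1 Ints_add Ints_diff Ints_of_nat add_diff_cancel_right')
  have eq: "1 - (- w - of_nat k) = w + of_nat k + 1" by simp
  have "Gamma (- w - of_nat k) * Gamma (w + of_nat k + 1) = of_real pi / - ((- 1) ^ k * sin (w * of_real pi))"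
    using Gamma_reflection_complex[of "- w - of_nat k"] unfolding s eq .
  moreover have "Gamma (w + of_nat k + 1) \<noteq> 0"
    using ni by (metis Gamma_eq_zero_iff nonpos_Ints_Int)
  ultimately have "Gamma (- w - of_nat k) = of_real pi / - ((- 1) ^ k * sin (w * of_real pi)) / Gamma (w + of_nat k + 1)"
    using eq_divide_imp by blast
  hence "Gamma (- w - of_nat k) = of_real pi / - ((- 1) ^ k * sin (w * of_real pi)) * rGamma (w + of_nat k + 1)"
    by (simp only: rGamma_inverse_Gamma divide_inverse)
  thus ?thesis by (cases "even k") auto
qed

lemma sin_pi_nonint: "w \<notin> \<int> \<Longrightarrow> sin (w * of_real pi) \<noteq> (0 :: complex)"
proof
  assume w: "w \<notin> \<int>" and "sin (w * of_real pi) = 0"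
  then obtain n where n: "w * of_real pi = of_real (of_int n * pi)"
    by (auto simp: sin_eq_0)
  hence "w * of_real pi = of_int n * of_real pi" by simp
  hence "w = of_int n" by simp
  thus False using w by simp
qed

lemma bsum_has_sum:
  assumes w: "w \<notin> \<int>"
  shows "((\<lambda>k. x ^ k / of_nat (fact k) * rGamma (w + of_nat k + 1)) has_sum bsum w x) UNIV"
proof -
  have "summable (\<lambda>k. norm (Gamma (- w - of_nat k) / fact k) * (real k + 1)\<^sup>2 * norm x ^ k)"
    by (rule Gamma_shift_summable[OF w]) auto
  hence "summable (\<lambda>k. norm (sin (w * of_real pi) / of_real pi) * (norm (Gamma (- w - of_nat k) / fact k) * (real k + 1)\<^sup>2 * norm x ^ k))"
    by (rule summable_mult)
  hence S: "summable (\<lambda>k. norm (x ^ k / of_nat (fact k) * rGamma (w + of_nat k + 1)))"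
  proof (rule summable_comparison_test')
    fix k :: nat assume "k \<ge> 0"
    have r: "rGamma (w + of_nat k + 1) = - (sin (w * of_real pi) / of_real pi) * ((- 1) ^ k * Gamma (- w - of_nat k))"
      using sin_pi_nonint[OF w] by (subst Gamma_rGamma_shift[OF w]) simp
    have "norm (x ^ k / of_nat (fact k) * rGamma (w + of_nat k + 1)) = 
       norm (sin (w * of_real pi) / of_real pi) * (norm (Gamma (- w - of_nat k) / fact k) * 1 * norm x ^ k)"
      unfolding r by (simp add: norm_mult norm_divide norm_power mult_ac)
    also have "\<dots> \<le> norm (sin (w * of_real pi) / of_real pi) * (norm (Gamma (- w - of_nat k) / fact k) * (real k + 1)\<^sup>2 * norm x ^ k)"
      by (intro mult_left_mono mult_right_mono) (auto simp: one_le_power)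
    finally show "norm (norm (x ^ k / of_nat (fact k) * rGamma (w + of_nat k + 1))) \<le>
        norm (sin (w * of_real pi) / of_real pi) * (norm (Gamma (- w - of_nat k) / fact k) * (real k + 1)\<^sup>2 * norm x ^ k)"
      by simp
  qed
  have "summable (\<lambda>k. x ^ k / of_nat (fact k) * rGamma (w + of_nat k + 1))"
    using S by (rule summable_norm_cancel)
  hence "(\<lambda>k. x ^ k / of_nat (fact k) * rGamma (w + of_nat k + 1)) sums bsum w x"
    unfolding bsum_def by (rule summable_sums)
  with S show ?thesis by (rule norm_summable_imp_has_sum)
qed

definition signed_order :: "bool \<Rightarrow> complex \<Rightarrow> complex" where "signed_order b \<nu> = (if b then \<nu> else - \<nu>)"

text \<open>The coefficients \<open>kc\<close> and exponents \<open>kp\<close> of the expansion of \<open>kk \<nu>\<close> for non-integer \<open>\<nu>\<close>; the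
  boolean index selects the part from \<open>I\<^sub>\<nu>\<close> or that from \<open>I\<^sub>-\<^sub>\<nu>\<close>.\<close>

definition kc :: "complex \<Rightarrow> bool \<times> nat \<Rightarrow> complex" where
  "kc \<nu> = (\<lambda>(b, k). (- 1) ^ k * Gamma (- signed_order b \<nu> - of_nat k) / (2 * fact k))"

definition kp :: "complex \<Rightarrow> bool \<times> nat \<Rightarrow> complex" where
  "kp \<nu> = (\<lambda>(b, k). signed_order b \<nu> / 2 + of_nat k)"

lemma has_sum_bool_times:
  fixes f :: "bool \<times> nat \<Rightarrow> 'a::{topological_comm_monoid_add,t2_space}"
  assumes "((\<lambda>k. f (True, k)) has_sum a) UNIV" "((\<lambda>k. f (False, k)) has_sum b) UNIV"
  shows "(f has_sum (a + b)) UNIV"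
proof -
  have *: "(f has_sum c) (range (Pair d))" if "((\<lambda>k. f (d, k)) has_sum c) UNIV" for c d
    using that has_sum_reindex[of "Pair d" UNIV f c] by (simp add: o_def inj_on_def)
  have "(f has_sum (a + b)) (range (Pair True) \<union> range (Pair False))"
    by (intro has_sum_Un_disjoint * assms) auto
  moreover have "range (Pair True) \<union> range (Pair False) = (UNIV :: (bool \<times> nat) set)"
    by (auto simp: image_iff)
  ultimately show ?thesis by simp
qed

lemma signed_order_nonint: "\<nu> \<notin> \<int> \<Longrightarrow> signed_order b \<nu> \<notin> \<int>"
  by (auto simp: signed_order_def minus_in_Ints_iff)

lemma kc_weighted_summable:
  assumes \<nu>: "\<nu> \<notin> \<int>" and T: "T > 0" and B: "B \<ge> 1"
  shows "(\<lambda>i. norm (kc \<nu> i) * (real (snd i) + B)\<^sup>2 * T powr Re (kp \<nu> i)) summable_on UNIV"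
proof -
  have "(\<lambda>k. norm (kc \<nu> (b, k)) * (real k + B)\<^sup>2 * T powr Re (kp \<nu> (b, k))) summable_on UNIV" for b
  proof -
    have "summable (\<lambda>k. T powr (Re (signed_order b \<nu>) / 2) / 2 * (norm (Gamma (- signed_order b \<nu> - of_nat k) / fact k) * (real k + B)\<^sup>2 * T ^ k))"
      by (intro summable_mult Gamma_shift_summable signed_order_nonint \<nu> B) (use T in auto)
    moreover have eq: "norm (kc \<nu> (b, k)) * (real k + B)\<^sup>2 * T powr Re (kp \<nu> (b, k)) =
        T powr (Re (signed_order b \<nu>) / 2) / 2 * (norm (Gamma (- signed_order b \<nu> - of_nat k) / fact k) * (real k + B)\<^sup>2 * T ^ k)" for k
      using T by (simp add: kc_def kp_def norm_mult norm_divide norm_power powr_add powr_realpow)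
    ultimately show ?thesis
      unfolding eq by (intro summable_nonneg_imp_summable_on) (use T in auto)
  qed
  from this[of True] this[of False] show ?thesis
    using has_sum_imp_summable[OF has_sum_bool_times[of "\<lambda>i. norm (kc \<nu> i) * (real (snd i) + B)\<^sup>2 * T powr Re (kp \<nu> i)"]]
    by (auto simp: summable_on_def)
qed

lemma kc_summable:
  assumes \<nu>: "\<nu> \<notin> \<int>" and T: "T > 0"
  shows "(\<lambda>i. norm (kc \<nu> i) * T powr Re (kp \<nu> i)) summable_on UNIV"
proof (rule summable_on_comparison_test[OF kc_weighted_summable[OF \<nu> T, of 1]])
  fix i
  have "norm (kc \<nu> i) * 1 * T powr Re (kp \<nu> i) \<le> norm (kc \<nu> i) * (real (snd i) + 1)\<^sup>2 * T powr Re (kp \<nu> i)"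
    by (intro mult_right_mono mult_left_mono) (auto simp: one_le_power)
  thus "norm (kc \<nu> i) * T powr Re (kp \<nu> i) \<le> norm (kc \<nu> i) * (real (snd i) + 1)\<^sup>2 * T powr Re (kp \<nu> i)"
    by simp
qed auto

text \<open>Both expansions converge everywhere, so the cut may be at T = 1. The exponents k of one
  function and j + \<nu> of the other keep a positive distance because \<nu> is not an
  integer.\<close>

lemma kk_series:
  assumes y: "y > 0" and \<nu>: "\<nu> \<notin> \<int>"
  shows "((\<lambda>i. kc \<nu> i * of_real y powr kp \<nu> i) has_sum kk \<nu> y) UNIV"
proof -
  let ?\<phi> = "\<lambda>t. complex_of_real (exp (- (1 * t)))" and ?e = "\<lambda>t. complex_of_real (exp (- (y * t)))"
  let ?\<psi> = "\<lambda>t. of_real t powr \<nu> * ?e t"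
  have e1: "expands ?\<phi> (expc 1) of_nat 1" by (rule expands_exp) simp
  have e2: "expands ?\<psi> (expc y) (\<lambda>j. of_nat j + \<nu>) (1 / 1)"
    using expands_powr_times[OF expands_exp[of 1 y]] by simp
  obtain \<delta> where d: "\<delta> > 0" "\<And>m. m \<in> \<int> \<Longrightarrow> \<delta> \<le> norm (\<nu> - m)" using nonint_dist[OF \<nu>] by metis
  have d': "\<delta> \<le> norm (of_nat k - (of_nat j + \<nu>))" for k j
    using d(2)[of "of_nat k - of_nat j"] by (metis Ints_diff Ints_of_nat diff_diff_eq norm_minus_commute)
  have I1: "(\<lambda>t. ?\<phi> t * of_real t powr (- of_real (Re \<nu>) - 1)) absolutely_integrable_on {1<..}"
    by (rule exp_tail_integrable) auto
  have I2: "(\<lambda>t. ?\<psi> t * of_real t powr (- of_real 0 - 1)) absolutely_integrable_on {1/1<..}"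
  proof -
    have eq: "?\<psi> t * of_real t powr (- of_real 0 - 1) = ?e t * of_real t powr (\<nu> - 1)" for t
      using powr_add[of "complex_of_real t" \<nu> "- 1"] by (simp add: mult_ac)
    show ?thesis unfolding eq using exp_tail_integrable[OF y, of 1 \<nu>] by simp
  qed
  have "integral {0<..} (\<lambda>t. ?\<phi> t * ?\<psi> (1 / t) / of_real t) =
      (\<Sum>\<^sub>\<infinity>i. expc 1 i * fpm ?\<psi> (expc y) (\<lambda>j. of_nat j + \<nu>) (1 / 1) (- of_nat i)) +
      (\<Sum>\<^sub>\<infinity>j. expc y j * fpm ?\<phi> (expc 1) of_nat 1 (- (of_nat j + \<nu>)))"
    by (rule Mellin_Parseval(2)[OF e1 e2 _ _ I1 I2 d(1) d']) auto
  also have "integral {0<..} (\<lambda>t. ?\<phi> t * ?\<psi> (1 / t) / of_real t) = integral {0<..} (gker (- \<nu>) (- 1) y)"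
  proof (rule integral_cong)
    fix t :: real assume t: "t \<in> {0<..}"
    have "complex_of_real (1 / t) powr \<nu> = of_real t powr (- \<nu>)"
      using t powr_of_real_exp[of "1 / t" "\<nu>"] by (simp add: powr_of_real_exp ln_div del: of_real_divide)
    moreover have "complex_of_real t powr (- \<nu> - 1) = of_real t powr (- \<nu>) / of_real t"
      using t by (simp add: powr_diff)
    moreover have "complex_of_real (exp (- (t + y * t powr - 1))) = ?\<phi> t * ?e (1 / t)"
      using t by (simp add: powr_minus exp_add[symmetric] divide_inverse flip: of_real_mult)
    ultimately show "?\<phi> t * ?\<psi> (1 / t) / of_real t = gker (- \<nu>) (- 1) y t"
      by (simp add: gker_def del: of_real_divide)
  qed
  \<comment> \<open>The Taylor coefficients of exp (- x) against the moments of the other factor: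
    the part that comes from the modified Bessel function of order -\<nu>.\<close>
  also have "(\<lambda>i. expc 1 i * fpm ?\<psi> (expc y) (\<lambda>j. of_nat j + \<nu>) (1 / 1) (- of_nat i)) =
     (\<lambda>i. 2 / of_real y powr (\<nu> / 2) * (kc \<nu> (False, i) * of_real y powr kp \<nu> (False, i)))"
  proof
    fix k
    have ni: "- of_nat k + \<nu> \<notin> \<int>"
      using \<nu> by (metis Ints_add Ints_of_nat add.commute uminus_add_conv_diff diff_add_cancel)
    have "fpm ?\<psi> (expc y) (\<lambda>j. of_nat j + \<nu>) (1 / 1) (- of_nat k) = of_real y powr (- (- of_nat k + \<nu>)) * Gamma (- of_nat k + \<nu>)"
      using fpm_powr_times[of 1 \<nu> ?e "expc y" of_nat "- of_nat k"] fpm_exp[OF y zero_less_one ni] by simp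
    also have "of_real y powr (- (- of_nat k + \<nu>)) = of_real y powr kp \<nu> (False, k) / of_real y powr (\<nu> / 2)"
      unfolding powr_diff[symmetric] by (simp add: kp_def signed_order_def)
    finally have F: "fpm ?\<psi> (expc y) (\<lambda>j. of_nat j + \<nu>) (1 / 1) (- of_nat k) =
       of_real y powr kp \<nu> (False, k) / of_real y powr (\<nu> / 2) * Gamma (- of_nat k + \<nu>)" .
    show "expc 1 k * fpm ?\<psi> (expc y) (\<lambda>j. of_nat j + \<nu>) (1 / 1) (- of_nat k) =
       2 / of_real y powr (\<nu> / 2) * (kc \<nu> (False, k) * of_real y powr kp \<nu> (False, k))"
      by (simp only: F) (simp add: expc_def kc_def signed_order_def mult_ac)
  qed
  \<comment> \<open>The reverse pairing gives the part of order \<nu>.\<close>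
  also have "(\<lambda>j. expc y j * fpm ?\<phi> (expc 1) of_nat 1 (- (of_nat j + \<nu>))) =
     (\<lambda>i. 2 / of_real y powr (\<nu> / 2) * (kc \<nu> (True, i) * of_real y powr kp \<nu> (True, i)))"
  proof
    fix k
    have ni: "- (of_nat k + \<nu>) \<notin> \<int>"
      using \<nu> by (metis Ints_diff Ints_minus Ints_of_nat add_diff_cancel_left' minus_minus)
    have arg: "- (of_nat k + \<nu>) = - \<nu> - of_nat k" by simp
    have "fpm ?\<phi> (expc 1) of_nat 1 (- (of_nat k + \<nu>)) = Gamma (- \<nu> - of_nat k)"
      using fpm_exp[OF zero_less_one zero_less_one ni] unfolding arg by simp
    moreover have "complex_of_real y ^ k = of_real y powr kp \<nu> (True, k) / of_real y powr (\<nu> / 2)"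
      unfolding powr_diff[symmetric] using y by (simp add: kp_def signed_order_def powr_nat)
    ultimately show "expc y k * fpm ?\<phi> (expc 1) of_nat 1 (- (of_nat k + \<nu>)) =
       2 / of_real y powr (\<nu> / 2) * (kc \<nu> (True, k) * of_real y powr kp \<nu> (True, k))"
      by (simp add: expc_def kc_def signed_order_def power_minus[of "of_real y"])
  qed
  finally have "integral {0<..} (gker (- \<nu>) (- 1) y) = 2 / of_real y powr (\<nu> / 2) *
     ((\<Sum>\<^sub>\<infinity>k. kc \<nu> (True, k) * of_real y powr kp \<nu> (True, k)) + (\<Sum>\<^sub>\<infinity>k. kc \<nu> (False, k) * of_real y powr kp \<nu> (False, k)))"
    by (simp only: infsum_cmult_right' distrib_left add.commute)
  hence kk: "kk \<nu> y = (\<Sum>\<^sub>\<infinity>k. kc \<nu> (True, k) * of_real y powr kp \<nu> (True, k)) + (\<Sum>\<^sub>\<infinity>k. kc \<nu> (False, k) * of_real y powr kp \<nu> (False, k))"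
    using y by (simp add: kk_def)
  have "(\<lambda>i. norm (kc \<nu> i * of_real y powr kp \<nu> i)) summable_on UNIV"
    using kc_summable[OF \<nu> y] y by (simp add: norm_mult norm_of_real_powr)
  hence s: "(\<lambda>i. kc \<nu> i * of_real y powr kp \<nu> i) summable_on UNIV"
    by (rule abs_summable_summable)
  have "(\<lambda>k. kc \<nu> (b, k) * of_real y powr kp \<nu> (b, k)) summable_on UNIV" for b
  proof -
    have "(\<lambda>i. kc \<nu> i * of_real y powr kp \<nu> i) summable_on (range (Pair b))"
      by (rule summable_on_subset_banach[OF s]) auto
    thus ?thesis by (subst (asm) summable_on_reindex) (auto simp: o_def inj_on_def)
  qed
  thus ?thesis unfolding kk by (intro has_sum_bool_times) auto
qed

lemma expands_kk:
  assumes "T > 0" "\<nu> \<notin> \<int>"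
  shows "expands (kk \<nu>) (kc \<nu>) (kp \<nu>) T"
  using assms kc_summable kk_series by (auto simp: expands_def)

lemma kc_bessel:
  assumes "\<nu> \<notin> \<int>"
  shows "kc \<nu> (b, k) = (if b then - 1 else 1) * (of_real pi / (2 * sin (\<nu> * of_real pi))) * (rGamma (signed_order b \<nu> + of_nat k + 1) / fact k)"
  using Gamma_rGamma_shift[OF signed_order_nonint[OF assms], of k b] by (cases b) (simp_all add: kc_def signed_order_def)

lemma besselK_aux_kk:
  assumes t: "t > 0" and \<nu>: "\<nu> \<notin> \<int>"
  shows "besselK_aux \<nu> (of_real t) = kk \<nu> (t\<^sup>2 / 4)"
proof -
  let ?y = "t\<^sup>2 / 4"
  have y: "?y > 0" using t by simp
  have p: "complex_of_real ?y powr kp \<nu> (b, k) = (of_real t / 2) powr signed_order b \<nu> * ((of_real t / 2)\<^sup>2) ^ k" for b k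
  proof -
    have "ln ?y = 2 * ln (t / 2)"
      using t by (simp add: ln_div ln_realpow ln_powr[of 2 2, symmetric])
    hence "complex_of_real ?y powr (signed_order b \<nu> / 2) = complex_of_real (t / 2) powr signed_order b \<nu>"
      using t y powr_of_real_exp[of "t / 2" "signed_order b \<nu>"] powr_of_real_exp[of ?y "signed_order b \<nu> / 2"] by simp
    moreover have "complex_of_real ?y powr of_nat k = ((of_real t / 2)\<^sup>2) ^ k"
      using t by (simp add: powr_nat power_divide)
    ultimately show ?thesis by (simp add: kp_def powr_add)
  qed
  let ?s = "\<lambda>b. (if b then - 1 else 1) * (of_real pi / (2 * sin (\<nu> * of_real pi)))"
  have "((\<lambda>k. kc \<nu> (b, k) * complex_of_real ?y powr kp \<nu> (b, k)) has_sum ?s b * besselI (signed_order b \<nu>) (of_real t)) UNIV" for b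
  proof -
    have "((\<lambda>k. (?s b * (of_real t / 2) powr signed_order b \<nu>) * (((of_real t / 2)\<^sup>2) ^ k / of_nat (fact k) * rGamma (signed_order b \<nu> + of_nat k + 1)))
       has_sum (?s b * (of_real t / 2) powr signed_order b \<nu>) * bsum (signed_order b \<nu>) ((of_real t / 2)\<^sup>2)) UNIV"
      by (intro has_sum_cmult_right bsum_has_sum signed_order_nonint \<nu>)
    moreover have "(?s b * (of_real t / 2) powr signed_order b \<nu>) * (((of_real t / 2)\<^sup>2) ^ k / of_nat (fact k) * rGamma (signed_order b \<nu> + of_nat k + 1)) =
       kc \<nu> (b, k) * complex_of_real ?y powr kp \<nu> (b, k)" for k
      unfolding p kc_bessel[OF \<nu>] by simp
    ultimately show ?thesis by (simp add: besselI_bsum mult.assoc)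
  qed
  from has_sum_unique[OF kk_series[OF y \<nu>] has_sum_bool_times[OF this this]]
  show ?thesis by (simp add: besselK_aux_def signed_order_def algebra_simps diff_divide_distrib)
qed

text \<open>At integer order \<open>besselK\<close> is a \<open>Lim\<close>. The punctured disc of
  radius 1 around \<nu> has no integers, so \<open>besselK_aux\<close> equals \<open>kk\<close>
  there, and continuity of \<open>kk\<close> in the order gives the limit.\<close>

lemma besselK_kk:
  assumes t: "t > 0"
  shows "besselK \<nu> (of_real t) = kk \<nu> (t\<^sup>2 / 4)"
proof (cases "\<nu> \<in> \<int>")
  case False
  thus ?thesis using t by (simp add: besselK_def besselK_aux_kk)
next
  case True
  have ev: "eventually (\<lambda>m. besselK_aux m (of_real t) = kk m (t\<^sup>2 / 4)) (at \<nu>)"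
  proof -
    have "eventually (\<lambda>m. m \<in> ball \<nu> 1 - {\<nu>}) (at \<nu>)"
      by (intro eventually_at_in_open) auto
    thus ?thesis
    proof eventually_elim
      case (elim m)
      have "m \<notin> \<int>"
      proof
        assume "m \<in> \<int>"
        with True obtain a b where "m = of_int a" "\<nu> = of_int b" by (auto elim!: Ints_cases)
        with elim have "norm (complex_of_int (b - a)) < 1" "a \<noteq> b" by (auto simp: dist_norm)
        thus False by (simp only: norm_of_int)
      qed
      thus ?case using t by (simp add: besselK_aux_kk)
    qed
  qed
  have "((\<lambda>m. kk m (t\<^sup>2 / 4)) \<longlongrightarrow> kk \<nu> (t\<^sup>2 / 4)) (at \<nu>)"
    using t by (auto simp: tendsto_at_iff_sequentially o_def intro!: kk_tendsto)
  hence "((\<lambda>m. besselK_aux m (of_real t)) \<longlongrightarrow> kk \<nu> (t\<^sup>2 / 4)) (at \<nu>)"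
    using ev by (subst tendsto_cong)
  thus ?thesis using True by (simp add: besselK_def tendsto_Lim)
qed

section \<open>Finite-part moments of the Macdonald function\<close>

lemma Int_shift_iff: "w + of_nat k \<in> \<int> \<longleftrightarrow> (w::complex) \<in> \<int>"
  by (metis Ints_add Ints_diff Ints_of_nat add_diff_cancel_right')

lemma kp_norm: "norm (kp \<nu> i) \<le> real (snd i) + norm \<nu> / 2"
proof -
  have "norm (kp \<nu> i) \<le> norm (signed_order (fst i) \<nu> / 2) + norm (of_nat (snd i) :: complex)"
    unfolding kp_def case_prod_unfold by (rule norm_triangle_ineq)
  thus ?thesis by (auto simp: signed_order_def norm_divide split: if_splits)
qed

lemma kp_Suc: "kp \<nu> (map_prod id Suc i) = kp \<nu> i + 1"
  by (cases i) (simp add: kp_def)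

text \<open>The Bessel equation (y d/dy)^2 k = (y + \<nu>^2 / 4) k, read off
  coefficientwise.\<close>

lemma kc_Suc:
  assumes "\<nu> \<notin> \<int>"
  shows "kc \<nu> (map_prod id Suc i) * ((kp \<nu> (map_prod id Suc i))\<^sup>2 - \<nu>\<^sup>2 / 4) = kc \<nu> i"
proof -
  obtain b k where i: "i = (b, k)" by force
  let ?w = "signed_order b \<nu>"
  have w: "?w \<notin> \<int>" using assms by (rule signed_order_nonint)
  have "- ?w - of_nat (Suc k) \<notin> \<int>"
    using w Int_shift_iff[of "?w" "Suc k"] by (metis minus_in_Ints_iff minus_add_distrib diff_conv_add_uminus)
  hence "Gamma (- ?w - of_nat (Suc k) + 1) = (- ?w - of_nat (Suc k)) * Gamma (- ?w - of_nat (Suc k))"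
    by (intro Gamma_plus1) (use nonpos_Ints_Int in blast)
  moreover have "- ?w - of_nat (Suc k) + 1 = - ?w - of_nat k" by simp
  ultimately have g: "Gamma (- ?w - of_nat k) = (- ?w - of_nat (Suc k)) * Gamma (- ?w - of_nat (Suc k))"
    by (simp only:)
  have "(kp \<nu> (b, Suc k))\<^sup>2 - \<nu>\<^sup>2 / 4 = of_nat (Suc k) * (?w + of_nat (Suc k))"
    by (auto simp: kp_def signed_order_def power2_eq_square field_simps)
  hence "kc \<nu> (b, Suc k) * ((kp \<nu> (b, Suc k))\<^sup>2 - \<nu>\<^sup>2 / 4) = kc \<nu> (b, k)"
    by (simp add: kc_def g field_simps del: of_nat_Suc)
  thus ?thesis by (simp add: i)
qed

text \<open>The lowest exponents \<plusminus>\<nu> / 2 are the roots of the indicial equation, so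
  the index shift in \<open>kk_ode_sum\<close> and \<open>fpm_kk_rec\<close> loses no terms.\<close>

lemma kp_0: "i \<notin> range (map_prod id Suc) \<Longrightarrow> (kp \<nu> i)\<^sup>2 - \<nu>\<^sup>2 / 4 = 0"
proof -
  assume "i \<notin> range (map_prod id Suc)"
  obtain b k where i: "i = (b, k)" by force
  have "k = 0"
  proof (rule ccontr)
    assume "k \<noteq> 0"
    then obtain k' where "k = Suc k'" by (metis not0_implies_Suc)
    hence "i = map_prod id Suc (b, k')" using i by simp
    with \<open>i \<notin> range (map_prod id Suc)\<close> show False by blast
  qed
  thus ?thesis by (auto simp: i kp_def signed_order_def power2_eq_square)
qed

lemma inj_shift: "inj (map_prod id Suc :: bool \<times> nat \<Rightarrow> bool \<times> nat)"
  by (auto simp: inj_on_def)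

lemma kk_tail_integrable:
  assumes T: "T > 0"
  shows "(\<lambda>t. kk \<nu> t * of_real t powr (w - 1)) absolutely_integrable_on {T<..}"
proof -
  \<comment> \<open>v moves w into the half plane of \<open>kk_Mellin\<close>; on (T, \<infinity>)
    the factor t^(w - v) is bounded since Re w \<le> Re v.\<close>
  define v where "v = complex_of_real (max (Re w) (\<bar>Re \<nu>\<bar>  / 2 + 1))"
  have "\<bar>Re \<nu>\<bar> / 2 + 1 \<le> Re v" "Re w \<le> Re v" by (simp_all add: v_def)
  hence v: "Re v > \<bar>Re \<nu>\<bar> / 2" "Re v \<ge> Re w" by linarith+
  have f: "(\<lambda>t. of_real t powr (v - 1) * kk \<nu> t) absolutely_integrable_on {T<..}"
    by (rule set_integrable_subset[OF kk_Mellin(1)[OF v(1)]]) (use T in auto)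
  have "(\<lambda>t. of_real t powr (w - v) * (of_real t powr (v - 1) * kk \<nu> t)) absolutely_integrable_on {T<..}"
  proof (rule absolutely_integrable_mult_bounded[OF f])
    show "norm (complex_of_real t powr (w - v)) \<le> T powr (Re w - Re v)" if "t \<in> {T<..}" for t
      using that T v by (simp add: norm_of_real_powr powr_mono2')
  qed (use T in \<open>auto intro!: continuous_intros\<close>)
  moreover have "of_real t powr (w - v) * (of_real t powr (v - 1) * kk \<nu> t) = kk \<nu> t * of_real t powr (w - 1)" for t
    using powr_add[of "complex_of_real t" "w - v" "v - 1"] by simp
  ultimately show ?thesis by simp
qed

text \<open>\<open>kL \<nu> w y\<close> is \<open>y powr w * (y * k'(y) - w * k(y))\<close> for \<open>k = kk \<nu>\<close>. By the Bessel equation its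
  derivative is \<open>y powr (w - 1) * (y + \<nu>\<^sup>2 / 4 - w\<^sup>2) * k(y)\<close>, which is integrable at infinity; so it
  converges there for every \<open>w\<close>, and \<open>kL_reduce\<close> turns convergence into convergence to \<open>0\<close>.\<close>

definition kL :: "complex \<Rightarrow> complex \<Rightarrow> real \<Rightarrow> complex" where
  "kL \<nu> w y = (\<Sum>\<^sub>\<infinity>i. kc \<nu> i * (kp \<nu> i - w) * of_real y powr (kp \<nu> i + w))"

lemma kL_has_sum:
  assumes \<nu>: "\<nu> \<notin> \<int>" and y: "y > 0"
  shows "((\<lambda>i. kc \<nu> i * (kp \<nu> i - w) * of_real y powr (kp \<nu> i + w)) has_sum kL \<nu> w y) UNIV"
proof -
  define B where "B = norm \<nu> / 2 + norm w + 1"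
  have "(\<lambda>i. norm (kc \<nu> i) * (real (snd i) + B)\<^sup>2 * y powr Re (kp \<nu> i) * y powr Re w) summable_on UNIV"
    by (intro summable_on_cmult_left kc_weighted_summable \<nu> y) (simp add: B_def)
  hence "(\<lambda>i. norm (kc \<nu> i * (kp \<nu> i - w) * of_real y powr (kp \<nu> i + w))) summable_on UNIV"
  proof (rule summable_on_comparison_test)
    fix i
    have "norm (kp \<nu> i - w) \<le> real (snd i) + B"
      using norm_triangle_ineq4[of "kp \<nu> i" w] kp_norm[of \<nu> i] by (simp add: B_def)
    also have "\<dots> \<le> (real (snd i) + B)\<^sup>2"
      by (simp add: power2_eq_square mult_le_cancel_right1 B_def add_nonneg_nonneg)
    finally have "norm (kc \<nu> i) * norm (kp \<nu> i - w) * (y powr Re (kp \<nu> i) * y powr Re w) \<le> norm (kc \<nu> i) * (real (snd i) + B)\<^sup>2 * (y powr Re (kp \<nu> i) * y powr Re w)"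
      by (intro mult_right_mono mult_left_mono) auto
    thus "norm (kc \<nu> i * (kp \<nu> i - w) * of_real y powr (kp \<nu> i + w)) \<le> norm (kc \<nu> i) * (real (snd i) + B)\<^sup>2 * y powr Re (kp \<nu> i) * y powr Re w"
      using y by (simp add: norm_mult norm_of_real_powr powr_add mult_ac)
  qed auto
  thus ?thesis
    unfolding kL_def by (rule has_sum_infsum[OF abs_summable_summable])
qed

text \<open>The factor kp - w is affine in w, so it equals twice its value at w + 1 minus its value
  at w + 2; the powers of y compensate the shifts.\<close>

lemma kL_reduce:
  assumes \<nu>: "\<nu> \<notin> \<int>" and y: "y > 0"
  shows "kL \<nu> w y = 2 * kL \<nu> (w + 1) y / of_real y - kL \<nu> (w + 2) y / (of_real y)\<^sup>2"
proof (rule has_sum_unique[OF kL_has_sum[OF assms]])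
  have "((\<lambda>i. 2 * (kc \<nu> i * (kp \<nu> i - (w + 1)) * of_real y powr (kp \<nu> i + (w + 1))) / of_real y - 
      (kc \<nu> i * (kp \<nu> i - (w + 2)) * of_real y powr (kp \<nu> i + (w + 2))) / (of_real y)\<^sup>2)
      has_sum (2 * kL \<nu> (w + 1) y / of_real y - kL \<nu> (w + 2) y / (of_real y)\<^sup>2)) UNIV"
    by (intro has_sum_minus has_sum_divide_const has_sum_cmult_right kL_has_sum assms)
  moreover have "2 * (kc \<nu> i * (kp \<nu> i - (w + 1)) * of_real y powr (kp \<nu> i + (w + 1))) / of_real y - 
      (kc \<nu> i * (kp \<nu> i - (w + 2)) * of_real y powr (kp \<nu> i + (w + 2))) / (of_real y)\<^sup>2
      = kc \<nu> i * (kp \<nu> i - w) * of_real y powr (kp \<nu> i + w)" for i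
  proof -
    have 1: "complex_of_real y powr (kp \<nu> i + (w + 1)) = of_real y powr (kp \<nu> i + w) * of_real y"
      using powr_add[of "complex_of_real y" "kp \<nu> i + w" 1] y by (simp add: add.assoc)
    have 2: "complex_of_real y powr (kp \<nu> i + (w + 2)) = of_real y powr (kp \<nu> i + w) * (of_real y)\<^sup>2"
      using powr_add[of "complex_of_real y" "kp \<nu> i + w" 2] powr_nat[of "complex_of_real y" 2] y by (simp add: add.assoc)
    show ?thesis unfolding 1 2 using y by (simp add: field_simps power2_eq_square)
  qed
  ultimately show "((\<lambda>i. kc \<nu> i * (kp \<nu> i - w) * of_real y powr (kp \<nu> i + w)) has_sum
      (2 * kL \<nu> (w + 1) y / of_real y - kL \<nu> (w + 2) y / (of_real y)\<^sup>2)) UNIV" by simp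
qed

text \<open>The series is the termwise derivative of \<open>kL\<close>. The factor kp^2 - w^2 is
  split at \<nu>^2 / 4, and \<open>kc_Suc\<close> reindexes the first part into y times the series
  of \<open>kk\<close>.\<close>

lemma kk_ode_sum:
  assumes \<nu>: "\<nu> \<notin> \<int>" and y: "y > 0"
  shows "((\<lambda>i. kc \<nu> i * ((kp \<nu> i)\<^sup>2 - w\<^sup>2) * of_real y powr (kp \<nu> i + w - 1)) has_sum
           (kk \<nu> y * of_real y powr (w + 1 - 1) + (\<nu>\<^sup>2 / 4 - w\<^sup>2) * (kk \<nu> y * of_real y powr (w - 1)))) UNIV"
proof -
  have K: "((\<lambda>i. kc \<nu> i * of_real y powr kp \<nu> i) has_sum kk \<nu> y) UNIV" by (rule kk_series[OF y \<nu>])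
  have "((\<lambda>i. kc \<nu> i * of_real y powr kp \<nu> i * of_real y) has_sum kk \<nu> y * of_real y) UNIV"
    by (rule has_sum_cmult_left[OF K])
  moreover have "kc \<nu> i * of_real y powr kp \<nu> i * of_real y =
      kc \<nu> (map_prod id Suc i) * ((kp \<nu> (map_prod id Suc i))\<^sup>2 - \<nu>\<^sup>2 / 4) * of_real y powr kp \<nu> (map_prod id Suc i)" for i
    using y by (subst kc_Suc[OF \<nu>]) (simp add: kp_Suc powr_add)
  ultimately have "((\<lambda>i. kc \<nu> (map_prod id Suc i) * ((kp \<nu> (map_prod id Suc i))\<^sup>2 - \<nu>\<^sup>2 / 4) * of_real y powr kp \<nu> (map_prod id Suc i)) has_sum kk \<nu> y * of_real y) UNIV"
    by simp
  hence "((\<lambda>i. kc \<nu> i * ((kp \<nu> i)\<^sup>2 - \<nu>\<^sup>2 / 4) * of_real y powr kp \<nu> i) has_sum kk \<nu> y * of_real y) UNIV"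
    by (subst (asm) has_sum_shift_iff[OF inj_shift, where h = "\<lambda>i. kc \<nu> i * ((kp \<nu> i)\<^sup>2 - \<nu>\<^sup>2 / 4) * of_real y powr kp \<nu> i"]) (use kp_0 in force)
  from has_sum_add[OF this has_sum_cmult_right[OF K, of "\<nu>\<^sup>2 / 4 - w\<^sup>2"]]
  have "((\<lambda>i. (kc \<nu> i * ((kp \<nu> i)\<^sup>2 - \<nu>\<^sup>2 / 4) * of_real y powr kp \<nu> i + (\<nu>\<^sup>2 / 4 - w\<^sup>2) * (kc \<nu> i * of_real y powr kp \<nu> i)) * of_real y powr (w - 1))
     has_sum (kk \<nu> y * of_real y + (\<nu>\<^sup>2 / 4 - w\<^sup>2) * kk \<nu> y) * of_real y powr (w - 1)) UNIV"
    by (rule has_sum_cmult_left)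
  moreover have "(kc \<nu> i * ((kp \<nu> i)\<^sup>2 - \<nu>\<^sup>2 / 4) * of_real y powr kp \<nu> i + (\<nu>\<^sup>2 / 4 - w\<^sup>2) * (kc \<nu> i * of_real y powr kp \<nu> i)) * of_real y powr (w - 1)
      = kc \<nu> i * ((kp \<nu> i)\<^sup>2 - w\<^sup>2) * of_real y powr (kp \<nu> i + w - 1)" for i
    using powr_add[of "complex_of_real y" "kp \<nu> i" "w - 1"] by (simp add: algebra_simps)
  moreover have "(kk \<nu> y * of_real y + (\<nu>\<^sup>2 / 4 - w\<^sup>2) * kk \<nu> y) * of_real y powr (w - 1) =
     kk \<nu> y * of_real y powr (w + 1 - 1) + (\<nu>\<^sup>2 / 4 - w\<^sup>2) * (kk \<nu> y * of_real y powr (w - 1))"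
    using powr_add[of "complex_of_real y" 1 "w - 1"] y by (simp add: algebra_simps)
  ultimately show ?thesis by simp
qed

text \<open>The series of the derivative is integrated term by term over [a, b], so that neither
  \<open>kk\<close> nor \<open>kL\<close> has to be shown differentiable.\<close>

lemma kL_integral:
  assumes \<nu>: "\<nu> \<notin> \<int>" and a: "0 < a" "a \<le> b" and nz: "\<And>i. kp \<nu> i + w \<noteq> 0"
  shows "integral {a..b} (\<lambda>y. kk \<nu> y * of_real y powr (w + 1 - 1) + (\<nu>\<^sup>2 / 4 - w\<^sup>2) * (kk \<nu> y * of_real y powr (w - 1))) = kL \<nu> w b - kL \<nu> w a"
proof -
  define f where "f i y = kc \<nu> i * ((kp \<nu> i)\<^sup>2 - w\<^sup>2) * complex_of_real y powr (kp \<nu> i + w - 1)" for i y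
  \<comment> \<open>Both norm (kp + w) and norm (kp - w) are at most k + B; the product of the two
    bounds is the weight of \<open>kc_weighted_summable\<close>.\<close>
  define B where "B = norm \<nu> / 2 + norm w + 1"
  have b: "b > 0" using a by simp
  have cont: "continuous_on {a..b} (f i)" for i
    unfolding f_def using a by (intro continuous_intros) auto
  have fi: "f i absolutely_integrable_on {a..b}" for i
    using cont[of i] by (rule absolutely_integrable_continuous_real)
  define C where "C = (a powr (Re w - 1) + b powr (Re w - 1))"
  have mono: "y powr r \<le> a powr r + b powr r" if "y \<in> {a..b}" for y r
  proof (cases "r \<ge> 0")
    case True
    hence "y powr r \<le> b powr r" using that a by (intro powr_mono2) auto
    thus ?thesis by (smt (verit) powr_ge_zero)
  next
    case False
    hence "y powr r \<le> a powr r" using that a by (intro powr_mono2') auto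
    thus ?thesis by (smt (verit) powr_ge_zero)
  qed
  let ?h = "\<lambda>i. norm (kc \<nu> i) * (real (snd i) + B)\<^sup>2 * a powr Re (kp \<nu> i) + norm (kc \<nu> i) * (real (snd i) + B)\<^sup>2 * b powr Re (kp \<nu> i)"
  have bd: "norm (f i y) \<le> ?h i * C" if y: "y \<in> {a..b}" for i y
  proof -
    have "norm ((kp \<nu> i)\<^sup>2 - w\<^sup>2) = norm (kp \<nu> i + w) * norm (kp \<nu> i - w)"
      by (simp add: norm_mult[symmetric] power2_eq_square algebra_simps)
    also have "\<dots> \<le> (real (snd i) + B) * (real (snd i) + B)"
      using norm_triangle_ineq4[of "kp \<nu> i" w] norm_triangle_ineq[of "kp \<nu> i" w] kp_norm[of \<nu> i]
      by (intro mult_mono) (auto simp: B_def)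
    finally have 1: "norm ((kp \<nu> i)\<^sup>2 - w\<^sup>2) \<le> (real (snd i) + B)\<^sup>2" by (simp add: power2_eq_square)
    have "norm (f i y) = norm (kc \<nu> i) * norm ((kp \<nu> i)\<^sup>2 - w\<^sup>2) * (y powr Re (kp \<nu> i) * y powr (Re w - 1))"
      using y a by (simp add: f_def norm_mult norm_of_real_powr powr_add[symmetric] add_diff_eq del: powr_add)
    also have "\<dots> \<le> norm (kc \<nu> i) * (real (snd i) + B)\<^sup>2 * ((a powr Re (kp \<nu> i) + b powr Re (kp \<nu> i)) * C)"
      unfolding C_def by (intro mult_mono mult_nonneg_nonneg add_nonneg_nonneg 1 mono y) auto
    finally show ?thesis by (simp add: algebra_simps)
  qed
  have h: "?h summable_on UNIV"
    by (intro summable_on_add kc_weighted_summable \<nu> a b) (auto simp: B_def)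
  have sm: "(\<lambda>i. integral {a..b} (\<lambda>y. norm (f i y))) summable_on UNIV"
  proof (rule summable_on_comparison_test)
    show "(\<lambda>i. ?h i * (C * (b - a))) summable_on UNIV"
      by (rule summable_on_cmult_left[OF h])
    fix i
    have n: "(\<lambda>y. norm (f i y)) integrable_on {a..b}"
      using fi by (simp add: absolutely_integrable_on_def)
    show "0 \<le> integral {a..b} (\<lambda>y. norm (f i y))"
      by (rule Henstock_Kurzweil_Integration.integral_nonneg[OF n]) auto
    have "integral {a..b} (\<lambda>y. norm (f i y)) \<le> integral {a..b} (\<lambda>y. ?h i * C)"
      by (rule integral_le[OF n]) (auto intro: bd)
    thus "integral {a..b} (\<lambda>y. norm (f i y)) \<le> ?h i * (C * (b - a))"
      using a by (simp add: mult_ac)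
  qed
  have "((\<lambda>i. integral {a..b} (f i)) has_sum integral {a..b} (\<lambda>y. kk \<nu> y * of_real y powr (w + 1 - 1) + (\<nu>\<^sup>2 / 4 - w\<^sup>2) * (kk \<nu> y * of_real y powr (w - 1)))) UNIV"
  proof (rule integral_infsum(2)[OF fi _ sm])
    show "((\<lambda>i. f i y) has_sum kk \<nu> y * of_real y powr (w + 1 - 1) + (\<nu>\<^sup>2 / 4 - w\<^sup>2) * (kk \<nu> y * of_real y powr (w - 1))) UNIV"
      if "y \<in> {a..b}" for y
      unfolding f_def using that a by (intro kk_ode_sum[OF \<nu>]) auto
  qed simp
  moreover have "integral {a..b} (f i) = kc \<nu> i * (kp \<nu> i - w) * of_real b powr (kp \<nu> i + w) - kc \<nu> i * (kp \<nu> i - w) * of_real a powr (kp \<nu> i + w)" for i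
  proof (rule integral_unique, rule fundamental_theorem_of_calculus)
    show "((\<lambda>y. kc \<nu> i * (kp \<nu> i - w) * complex_of_real y powr (kp \<nu> i + w)) has_vector_derivative f i y) (at y within {a..b})"
      if "y \<in> {a..b}" for y
    proof -
      have "((\<lambda>y. kc \<nu> i * (kp \<nu> i - w) * complex_of_real y powr (kp \<nu> i + w)) has_vector_derivative 
          (kc \<nu> i * (kp \<nu> i - w) * ((kp \<nu> i + w) * complex_of_real y powr (kp \<nu> i + w - 1)))) (at y)"
        using that a by (auto intro!: derivative_eq_intros has_vector_derivative_real_field)
      moreover have "kc \<nu> i * (kp \<nu> i - w) * ((kp \<nu> i + w) * complex_of_real y powr (kp \<nu> i + w - 1)) = f i y"
        by (simp add: f_def power2_eq_square algebra_simps)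
      ultimately show ?thesis by (simp add: has_vector_derivative_at_within)
    qed
  qed (rule a)
  moreover have "((\<lambda>i. kc \<nu> i * (kp \<nu> i - w) * of_real b powr (kp \<nu> i + w) - kc \<nu> i * (kp \<nu> i - w) * of_real a powr (kp \<nu> i + w)) has_sum (kL \<nu> w b - kL \<nu> w a)) UNIV"
    by (intro has_sum_minus kL_has_sum \<nu> a b)
  ultimately show ?thesis
    by (simp only:) (metis (no_types, lifting) has_sum_unique)
qed

lemma kp_dist:
  assumes "w + \<nu> / 2 \<notin> \<int>" "w - \<nu> / 2 \<notin> \<int>"
  obtains d where "d > 0" "\<And>i m. m \<in> \<int> \<Longrightarrow> d \<le> norm (kp \<nu> i + w - m)"
proof -
  have nonint: "w + signed_order b \<nu> / 2 \<notin> \<int>" for b using assms by (auto simp: signed_order_def)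
  obtain d1 where d1: "d1 > 0" "\<And>m. m \<in> \<int> \<Longrightarrow> d1 \<le> norm (w + signed_order True \<nu> / 2 - m)" using nonint_dist[OF nonint] by metis
  obtain d2 where d2: "d2 > 0" "\<And>m. m \<in> \<int> \<Longrightarrow> d2 \<le> norm (w + signed_order False \<nu> / 2 - m)" using nonint_dist[OF nonint] by metis
  have "min d1 d2 \<le> norm (kp \<nu> i + w - m)" if "m \<in> \<int>" for i m
  proof -
    obtain b k where i: "i = (b, k)" by force
    have eq: "kp \<nu> i + w - m = w + signed_order b \<nu> / 2 - (m - of_nat k)" by (simp add: i kp_def)
    have "m - of_nat k \<in> \<int>" using that by simp
    from d1(2)[OF this] d2(2)[OF this] show ?thesis
      unfolding eq by (cases b) auto
  qed
  with d1 d2 show ?thesis using that[of "min d1 d2"] by simp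
qed

text \<open>As in \<open>fpm_exp_rec\<close>, the boundary values at T of the tail integrals and of
  the series cancel. Here both are values of \<open>kL\<close>, since the recurrence reflects a
  second-order equation.\<close>

lemma fpm_kk_rec:
  assumes \<nu>: "\<nu> \<notin> \<int>" and T: "T > 0" and w: "w + \<nu> / 2 \<notin> \<int>" "w - \<nu> / 2 \<notin> \<int>"
  shows "fpm (kk \<nu>) (kc \<nu>) (kp \<nu>) T (w + 1) = (w\<^sup>2 - \<nu>\<^sup>2 / 4) * fpm (kk \<nu>) (kc \<nu>) (kp \<nu>) T w"
proof -
  obtain d where d: "d > 0" "\<And>i m. m \<in> \<int> \<Longrightarrow> d \<le> norm (kp \<nu> i + w - m)"
    using kp_dist[OF w] by metis
  have dk: "d \<le> norm (kp \<nu> i + (w + of_nat n))" for i n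
    using d(2)[of "- of_nat n" i] by (simp add: add.assoc)
  have nz: "kp \<nu> i + (w + of_nat n) \<noteq> 0" for i n
    using dk[of i n] d(1) by auto
  define J where "J w = (\<lambda>y. kk \<nu> y * of_real y powr (w + 1 - 1) + (\<nu>\<^sup>2 / 4 - w\<^sup>2) * (kk \<nu> y * of_real y powr (w - 1)))" for w
  have Ji: "J w absolutely_integrable_on {T<..}" for w
    unfolding J_def by (intro set_integral_add(1) set_integrable_mult_right kk_tail_integrable T)
  have conv: "(\<lambda>n. kL \<nu> (w + of_nat m) (T + real n)) \<longlonglongrightarrow> kL \<nu> (w + of_nat m) T + integral {T<..} (J (w + of_nat m))" for m
  proof -
    have "integral {T..T + real n} (J (w + of_nat m)) = kL \<nu> (w + of_nat m) (T + real n) - kL \<nu> (w + of_nat m) T" for n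
      unfolding J_def by (rule kL_integral[OF \<nu> T _ nz]) simp
    hence eq: "kL \<nu> (w + of_nat m) (T + real n) = kL \<nu> (w + of_nat m) T + integral {T..T + real n} (J (w + of_nat m))" for n
      by simp
    show ?thesis unfolding eq by (intro tendsto_intros integral_tail_tendsto Ji)
  qed
  have inv: "(\<lambda>n. 1 / complex_of_real (T + real n)) \<longlonglongrightarrow> 0"
  proof -
    have "(\<lambda>n. 1 / (T + real n)) \<longlonglongrightarrow> 0"
      by real_asymp
    from tendsto_of_real[OF this, where 'a = complex] show ?thesis by simp
  qed
  \<comment> \<open>The values at w + 1 and w + 2 converge by \<open>conv\<close>;
    \<open>kL_reduce\<close> divides them by T + n and by its square, so the limit at w is
    0.\<close>
  have "(\<lambda>n. 2 * kL \<nu> (w + of_nat 1) (T + real n) * (1 / complex_of_real (T + real n)) - kL \<nu> (w + of_nat 2) (T + real n) * (1 / complex_of_real (T + real n))\<^sup>2)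
    \<longlonglongrightarrow> 2 * (kL \<nu> (w + of_nat 1) T + integral {T<..} (J (w + of_nat 1))) * 0 - (kL \<nu> (w + of_nat 2) T + integral {T<..} (J (w + of_nat 2))) * 0\<^sup>2"
    by (intro tendsto_intros conv inv)
  moreover have "2 * kL \<nu> (w + of_nat 1) (T + real n) * (1 / complex_of_real (T + real n)) - kL \<nu> (w + of_nat 2) (T + real n) * (1 / complex_of_real (T + real n))\<^sup>2 = kL \<nu> w (T + real n)" for n
    using T by (subst kL_reduce[OF \<nu>, of "T + real n" w]) (simp_all add: power_divide)
  ultimately have "(\<lambda>n. kL \<nu> w (T + real n)) \<longlonglongrightarrow> 0" by simp
  moreover have "(\<lambda>n. kL \<nu> w (T + real n)) \<longlonglongrightarrow> kL \<nu> w T + integral {T<..} (J w)"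
    using conv[of 0] by simp
  ultimately have 1: "integral {T<..} (J w) = - kL \<nu> w T"
    using LIMSEQ_unique by (metis add_eq_0_iff2 add.commute)
  define I where "I w = integral {T<..} (\<lambda>y. kk \<nu> y * of_real y powr (w - 1))" for w
  have i: "(\<lambda>y. kk \<nu> y * of_real y powr (w - 1)) integrable_on {T<..}" for w
    using kk_tail_integrable[OF T] by (simp add: absolutely_integrable_on_def)
  have 2: "integral {T<..} (J w) = I (w + 1) + (\<nu>\<^sup>2 / 4 - w\<^sup>2) * I w"
    unfolding J_def I_def using i[of w] i[of "w + 1"]
    by (subst integral_add) (auto intro!: integrable_on_mult_right)
  define h0 where "h0 i = kc \<nu> i * of_real T powr (kp \<nu> i + w) / (kp \<nu> i + w)" for i
  define h1 where "h1 i = kc \<nu> i * of_real T powr (kp \<nu> i + (w + 1)) / (kp \<nu> i + (w + 1))" for i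
  have S0: "(h0 has_sum infsum h0 UNIV) UNIV" and S1: "(h1 has_sum infsum h1 UNIV) UNIV"
    using expands_summable[OF expands_kk[OF T \<nu>] d(1) dk[of _ 0]] expands_summable[OF expands_kk[OF T \<nu>] d(1) dk[of _ 1]]
    by (simp_all add: h0_def[abs_def] h1_def[abs_def])
  have h1: "h1 i = ((kp \<nu> (map_prod id Suc i))\<^sup>2 - \<nu>\<^sup>2 / 4) * h0 (map_prod id Suc i)" for i
    unfolding h0_def h1_def kc_Suc[OF \<nu>, of i, symmetric] by (simp add: kp_Suc add_ac)
  have S1': "((\<lambda>i. ((kp \<nu> i)\<^sup>2 - \<nu>\<^sup>2 / 4) * h0 i) has_sum infsum h1 UNIV) UNIV"
    using S1 unfolding h1
    by (subst (asm) has_sum_shift_iff[OF inj_shift, where h = "\<lambda>i. ((kp \<nu> i)\<^sup>2 - \<nu>\<^sup>2 / 4) * h0 i"]) (use kp_0 in force)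
  have "((\<lambda>i. ((kp \<nu> i)\<^sup>2 - \<nu>\<^sup>2 / 4) * h0 i - (w\<^sup>2 - \<nu>\<^sup>2 / 4) * h0 i) has_sum (infsum h1 UNIV - (w\<^sup>2 - \<nu>\<^sup>2 / 4) * infsum h0 UNIV)) UNIV"
    by (intro has_sum_minus S1' has_sum_cmult_right S0)
  moreover have "((kp \<nu> i)\<^sup>2 - \<nu>\<^sup>2 / 4) * h0 i - (w\<^sup>2 - \<nu>\<^sup>2 / 4) * h0 i = kc \<nu> i * (kp \<nu> i - w) * of_real T powr (kp \<nu> i + w)" for i
  proof -
    have "((kp \<nu> i)\<^sup>2 - \<nu>\<^sup>2 / 4) * h0 i - (w\<^sup>2 - \<nu>\<^sup>2 / 4) * h0 i = (kp \<nu> i - w) * ((kp \<nu> i + w) * h0 i)"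
      by (simp add: algebra_simps power2_eq_square)
    thus ?thesis using nz[of i 0] by (simp add: h0_def)
  qed
  ultimately have S: "infsum h1 UNIV - (w\<^sup>2 - \<nu>\<^sup>2 / 4) * infsum h0 UNIV = kL \<nu> w T"
    using has_sum_unique[OF kL_has_sum[OF \<nu> T, of w]] by simp
  have "fpm (kk \<nu>) (kc \<nu>) (kp \<nu>) T (w + 1) = I (w + 1) + infsum h1 UNIV"
    "fpm (kk \<nu>) (kc \<nu>) (kp \<nu>) T w = I w + infsum h0 UNIV"
    by (simp_all add: fpm_def I_def h0_def[abs_def] h1_def[abs_def])
  moreover have "I (w + 1) + infsum h1 UNIV = (w\<^sup>2 - \<nu>\<^sup>2 / 4) * (I w + infsum h0 UNIV)"
  proof -
    have "a + h = (q - n) * (b + g)" if "a + (n - q) * b = - L" "h - (q - n) * g = L" for a b g h n q L :: complex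
      using that by algebra
    from this[OF 1[unfolded 2] S] show ?thesis .
  qed
  ultimately show ?thesis by simp
qed

text \<open>The moment is an ordinary one for large Re w. Each step to the left costs the factors w
  + \<nu> / 2 and w - \<nu> / 2, one from each Gamma function.\<close>

lemma fpm_kk:
  assumes \<nu>: "\<nu> \<notin> \<int>" and T: "T > 0" and w: "w + \<nu> / 2 \<notin> \<int>" "w - \<nu> / 2 \<notin> \<int>"
  shows "fpm (kk \<nu>) (kc \<nu>) (kp \<nu>) T w = Gamma (w + \<nu> / 2) * Gamma (w - \<nu> / 2) / 2"
proof -
  have "fpm (kk \<nu>) (kc \<nu>) (kp \<nu>) T w = Gamma (w + \<nu> / 2) * Gamma (w - \<nu> / 2) / 2"
    if "Re w + real n > \<bar>Re \<nu>\<bar> / 2" "w + \<nu> / 2 \<notin> \<int>" "w - \<nu> / 2 \<notin> \<int>" for n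
    using that
  proof (induction n arbitrary: w)
    case 0
    have P: "Re w - \<bar>Re \<nu>\<bar> / 2 \<le> Re (kp \<nu> i + w)" for i
      by (cases i) (auto simp: kp_def signed_order_def abs_if)
    have "fpm (kk \<nu>) (kc \<nu>) (kp \<nu>) T w = integral {0<..} (\<lambda>t. kk \<nu> t * of_real t powr (w - 1))"
      using 0 by (intro fpm_eq_integral(2)[OF expands_kk[OF T \<nu>] _ P] kk_tail_integrable T) auto
    also have "\<dots> = Gamma (w + \<nu> / 2) * Gamma (w - \<nu> / 2) / 2"
      using kk_Mellin(2)[of \<nu> w] 0 by (simp add: mult.commute)
    finally show ?case .
  next
    case (Suc n)
    have s1: "w + 1 + \<nu> / 2 \<notin> \<int>" "w + 1 - \<nu> / 2 \<notin> \<int>"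
      using Suc.prems Int_shift_iff[of "w + \<nu> / 2" 1] Int_shift_iff[of "w - \<nu> / 2" 1] by (simp_all add: algebra_simps)
    have nz: "w + \<nu> / 2 \<noteq> 0" "w - \<nu> / 2 \<noteq> 0" using Suc.prems by auto
    have "Gamma (w + \<nu> / 2 + 1) = (w + \<nu> / 2) * Gamma (w + \<nu> / 2)" "Gamma (w - \<nu> / 2 + 1) = (w - \<nu> / 2) * Gamma (w - \<nu> / 2)"
      using Suc.prems by (intro Gamma_plus1; use nonpos_Ints_Int in blast)+
    moreover have "w + 1 + \<nu> / 2 = w + \<nu> / 2 + 1" "w + 1 - \<nu> / 2 = w - \<nu> / 2 + 1" by simp_all
    ultimately have "Gamma (w + 1 + \<nu> / 2) * Gamma (w + 1 - \<nu> / 2) / 2 = ((w + \<nu> / 2) * (w - \<nu> / 2)) * (Gamma (w + \<nu> / 2) * Gamma (w - \<nu> / 2) / 2)"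
      by (simp only: times_divide_eq_right mult_ac)
    moreover have "(w + \<nu> / 2) * (w - \<nu> / 2) = w\<^sup>2 - \<nu>\<^sup>2 / 4"
      by (simp add: power2_eq_square algebra_simps)
    moreover have "fpm (kk \<nu>) (kc \<nu>) (kp \<nu>) T (w + 1) = Gamma (w + 1 + \<nu> / 2) * Gamma (w + 1 - \<nu> / 2) / 2"
      using Suc.prems s1 by (intro Suc.IH) auto
    ultimately have "((w + \<nu> / 2) * (w - \<nu> / 2)) * fpm (kk \<nu>) (kc \<nu>) (kp \<nu>) T w = ((w + \<nu> / 2) * (w - \<nu> / 2)) * (Gamma (w + \<nu> / 2) * Gamma (w - \<nu> / 2) / 2)"
      using fpm_kk_rec[OF \<nu> T Suc.prems(2,3)] by simp
    thus ?case using nz by simp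
  qed
  moreover obtain n where "\<bar>Re \<nu>\<bar> / 2 - Re w < real n"
    using reals_Archimedean2 by blast
  hence "Re w + real n > \<bar>Re \<nu>\<bar> / 2" by linarith
  ultimately show ?thesis using w by blast
qed

section \<open>Finite-part moments of the Cauchy kernel\<close>

definition cauchyk :: "complex \<Rightarrow> real \<Rightarrow> complex" where
  "cauchyk \<zeta> u = of_real u / (1 + \<zeta> * of_real u)"

text \<open>norm (1 + w u) is u times the distance of w from -1 / u, a point of the slit. Halving
  the distance of \<zeta> from the slit leaves room for all w in a disc around \<zeta>, and this
  uniformity is what differentiation in \<zeta> under the integral needs.\<close>

lemma slit_plane_lower_bound:
  fixes \<zeta> :: complex
  assumes "\<zeta> \<notin> \<real>\<^sub>\<le>\<^sub>0"
  obtains m where "m > 0" "\<And>w u. \<lbrakk>norm (w - \<zeta>) < m; u > 0\<rbrakk> \<Longrightarrow> m * u \<le> norm (1 + w * of_real u)"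
proof -
  define m where "m = infdist \<zeta> (\<real>\<^sub>\<le>\<^sub>0) / 2"
  have "infdist \<zeta> (\<real>\<^sub>\<le>\<^sub>0) \<noteq> 0"
    using assms closed_nonpos_Reals_complex in_closed_iff_infdist_zero[of "\<real>\<^sub>\<le>\<^sub>0 :: complex set" \<zeta>]
    by (metis empty_iff nonpos_Reals_zero_I)
  hence m: "m > 0" using infdist_nonneg[of \<zeta> "\<real>\<^sub>\<le>\<^sub>0"] by (simp add: m_def)
  have "m * u \<le> norm (1 + w * of_real u)" if w: "norm (w - \<zeta>) < m" and u: "u > 0" for w u
  proof -
    have "2 * m \<le> dist \<zeta> (- complex_of_real (1 / u))"
      unfolding m_def using u infdist_le[of "- complex_of_real (1 / u)" "\<real>\<^sub>\<le>\<^sub>0" \<zeta>]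
      by (simp add: complex_nonpos_Reals_iff)
    also have "\<dots> = norm ((\<zeta> - w) + (w + of_real (1 / u)))" by (simp add: dist_norm)
    also have "\<dots> \<le> norm (w - \<zeta>) + norm (w + of_real (1 / u))"
      using norm_triangle_ineq[of "\<zeta> - w" "w + of_real (1 / u)"] by (simp add: norm_minus_commute)
    finally have "m \<le> norm (w + of_real (1 / u))" using w by simp
    hence "m * u \<le> norm (w + of_real (1 / u)) * u" using u by (intro mult_right_mono) auto
    also have "\<dots> = norm ((w + of_real (1 / u)) * of_real u)" using u by (simp add: norm_mult)
    also have "(w + of_real (1 / u)) * of_real u = 1 + w * of_real u" using u by (simp add: field_simps)
    finally show ?thesis .
  qed
  with m show ?thesis using that by blast
qed

lemma slit_plane_nz:
  assumes "\<zeta> \<notin> \<real>\<^sub>\<le>\<^sub>0" "u \<ge> 0"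
  shows "1 + \<zeta> * complex_of_real u \<noteq> 0"
proof (cases "u = 0")
  case False
  hence u: "u > 0" using assms by simp
  obtain m where "m > 0" "\<And>w u. \<lbrakk>norm (w - \<zeta>) < m; u > 0\<rbrakk> \<Longrightarrow> m * u \<le> norm (1 + w * of_real u)"
    using slit_plane_lower_bound[OF assms(1)] by metis
  from this(2)[of \<zeta> u] this(1) u have "0 < norm (1 + \<zeta> * of_real u)"
    by (smt (verit) diff_self mult_pos_pos norm_zero)
  thus ?thesis by auto
qed simp

lemma cauchyk_bound:
  assumes "\<zeta> \<notin> \<real>\<^sub>\<le>\<^sub>0"
  obtains m where "m > 0" "\<And>w u. \<lbrakk>norm (w - \<zeta>) < m; u > 0\<rbrakk> \<Longrightarrow> norm (cauchyk w u) \<le> 1 / m"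
    "\<And>w u. \<lbrakk>norm (w - \<zeta>) < m; u > 0\<rbrakk> \<Longrightarrow> 1 + w * of_real u \<noteq> 0"
proof -
  obtain m where m: "m > 0" "\<And>w u. \<lbrakk>norm (w - \<zeta>) < m; u > 0\<rbrakk> \<Longrightarrow> m * u \<le> norm (1 + w * of_real u)"
    using slit_plane_lower_bound[OF assms(1)] by metis
  have nz: "1 + w * of_real u \<noteq> 0" if "norm (w - \<zeta>) < m" "u > 0" for w u
    using m(2)[OF that] m(1) that by (metis mult_pos_pos norm_zero not_less)
  have "norm (cauchyk w u) \<le> 1 / m" if "norm (w - \<zeta>) < m" "u > 0" for w u
  proof -
    have "u / norm (1 + w * of_real u) \<le> u / (m * u)"
      using m that nz[OF that] by (intro divide_left_mono m(2) mult_pos_pos) auto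
    thus ?thesis using that m by (simp add: cauchyk_def norm_divide)
  qed
  with m nz show ?thesis using that by blast
qed

lemma continuous_on_cauchyk:
  assumes "\<zeta> \<notin> \<real>\<^sub>\<le>\<^sub>0" "\<And>u. u \<in> S \<Longrightarrow> u \<ge> 0"
  shows "continuous_on S (cauchyk \<zeta>)"
  unfolding cauchyk_def using assms by (intro continuous_intros ballI slit_plane_nz) auto

lemma cauchyk_tail_integrable:
  assumes \<zeta>: "\<zeta> \<notin> \<real>\<^sub>\<le>\<^sub>0" and T: "T > 0" and s: "Re s < 0"
  shows "(\<lambda>t. cauchyk \<zeta> t * of_real t powr (s - 1)) absolutely_integrable_on {T<..}"
proof -
  obtain m where m: "m > 0" "\<And>w u. \<lbrakk>norm (w - \<zeta>) < m; u > 0\<rbrakk> \<Longrightarrow> norm (cauchyk w u) \<le> 1 / m"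
    using cauchyk_bound[OF \<zeta>] by metis
  show ?thesis
  proof (rule absolutely_integrable_mult_bounded[OF power_tail_integral(1)[OF T s]])
    show "norm (cauchyk \<zeta> x) \<le> 1 / m" if "x \<in> {T<..}" for x
      using m that T by auto
  qed (use T in \<open>auto intro!: continuous_on_cauchyk[OF \<zeta>]\<close>)
qed

lemma stieltjes_integrable:
  assumes \<zeta>: "\<zeta> \<notin> \<real>\<^sub>\<le>\<^sub>0" and s: "-1 < Re s" "Re s < 0"
  shows "(\<lambda>t. cauchyk \<zeta> t * of_real t powr (s - 1)) absolutely_integrable_on {0<..}"
proof (rule absolutely_integrable_Un_split(1)[of 1])
  show "(\<lambda>t. cauchyk \<zeta> t * of_real t powr (s - 1)) absolutely_integrable_on {1<..}"
    using cauchyk_tail_integrable[OF \<zeta> _ s(2), of 1] by simp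
  obtain m where m: "m > 0" "\<And>w u. \<lbrakk>norm (w - \<zeta>) < m; u > 0\<rbrakk> \<Longrightarrow> norm (cauchyk w u) \<le> 1 / m"
    using cauchyk_bound[OF \<zeta>] by metis
  \<comment> \<open>Near 0 the identity cauchyk = t (1 - \<zeta> cauchyk) releases one power of t,
    and Re s > -1 makes the result integrable.\<close>
  have "(\<lambda>t. (1 - \<zeta> * cauchyk \<zeta> t) * of_real t powr (s + 1 - 1)) absolutely_integrable_on {0<..1}"
  proof (rule absolutely_integrable_mult_bounded[OF power_integral(1)])
    show "continuous_on {0<..1} (\<lambda>x. 1 - \<zeta> * cauchyk \<zeta> x)"
      by (intro continuous_intros continuous_on_cauchyk[OF \<zeta>]) auto
    show "norm (1 - \<zeta> * cauchyk \<zeta> x) \<le> 1 + norm \<zeta> * (1 / m)" if "x \<in> {0<..1}" for x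
    proof -
      have "norm (1 - \<zeta> * cauchyk \<zeta> x) \<le> 1 + norm \<zeta> * norm (cauchyk \<zeta> x)"
        using norm_triangle_ineq4[of 1 "\<zeta> * cauchyk \<zeta> x"] by (simp add: norm_mult)
      also have "\<dots> \<le> 1 + norm \<zeta> * (1 / m)"
        using m that by (intro add_left_mono mult_left_mono) auto
      finally show ?thesis .
    qed
  qed (use s in auto)
  moreover have "(1 - \<zeta> * cauchyk \<zeta> t) * of_real t powr (s + 1 - 1) = cauchyk \<zeta> t * of_real t powr (s - 1)" if "t \<in> {0<..1}" for t
    using that slit_plane_nz[OF \<zeta>, of t] powr_add[of "complex_of_real t" 1 "s - 1"] by (simp add: cauchyk_def field_simps)
  ultimately show "(\<lambda>t. cauchyk \<zeta> t * of_real t powr (s - 1)) absolutely_integrable_on {0<..1}"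
    by (rule set_integrable_cong[THEN iffD1, OF refl refl, rotated])
qed simp

lemma stieltjes_square_integrable:
  assumes \<zeta>: "\<zeta> \<notin> \<real>\<^sub>\<le>\<^sub>0" and s: "-1 < Re s" "Re s < 0"
  shows "(\<lambda>t. cauchyk \<zeta> t * (cauchyk \<zeta> t * of_real t powr (s - 1))) absolutely_integrable_on {0<..}"
proof -
  obtain m where m: "m > 0" "\<And>w u. \<lbrakk>norm (w - \<zeta>) < m; u > 0\<rbrakk> \<Longrightarrow> norm (cauchyk w u) \<le> 1 / m"
    using cauchyk_bound[OF \<zeta>] by metis
  show ?thesis
  proof (rule absolutely_integrable_mult_bounded[OF stieltjes_integrable[OF \<zeta> s]])
    show "norm (cauchyk \<zeta> x) \<le> 1 / m" if "x \<in> {0<..}" for x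
      using m that by auto
  qed (auto intro!: continuous_on_cauchyk[OF \<zeta>])
qed

definition stieltjes :: "complex \<Rightarrow> complex \<Rightarrow> complex" where
  "stieltjes s \<zeta> = integral {0<..} (\<lambda>t. cauchyk \<zeta> t * of_real t powr (s - 1))"

text \<open>The function t^(s + 1) / (1 + \<zeta> t) vanishes at 0 because Re s > -1 and at infinity
  because Re s < 0, so its derivative has integral 0. With \<open>stieltjes_deriv\<close> this
  becomes a first-order equation for \<open>stieltjes s\<close> in \<zeta>.\<close>

lemma stieltjes_by_parts:
  assumes \<zeta>: "\<zeta> \<notin> \<real>\<^sub>\<le>\<^sub>0" and s: "-1 < Re s" "Re s < 0"
  shows "(s + 1) * stieltjes s \<zeta> = \<zeta> * integral {0<..} (\<lambda>t. cauchyk \<zeta> t * (cauchyk \<zeta> t * of_real t powr (s - 1)))"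
proof -
  define F where "F t = of_real t powr (s + 1) / (1 + \<zeta> * of_real t)" for t
  define f where "f t = (s + 1) * (cauchyk \<zeta> t * of_real t powr (s - 1)) - \<zeta> * (cauchyk \<zeta> t * (cauchyk \<zeta> t * of_real t powr (s - 1)))" for t
  have fi: "f absolutely_integrable_on {0<..}"
    unfolding f_def by (intro set_integral_diff(1) set_integrable_mult_right stieltjes_integrable stieltjes_square_integrable \<zeta> s)
  have deriv: "(F has_vector_derivative f t) (at t)" if t: "t > 0" for t
  proof -
    have nz: "1 + \<zeta> * of_real t \<noteq> 0" using slit_plane_nz[OF \<zeta>] t by simp
    have "(F has_vector_derivative ((s + 1) * of_real t powr s * (1 + \<zeta> * of_real t) - of_real t powr (s + 1) * \<zeta>) / ((1 + \<zeta> * of_real t) * (1 + \<zeta> * of_real t))) (at t)"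
      unfolding F_def using t nz by (auto intro!: derivative_eq_intros has_vector_derivative_real_field)
    moreover have "complex_of_real t powr s = of_real t * of_real t powr (s - 1)"
      using t powr_add[of "complex_of_real t" 1 "s - 1"] by simp
    moreover have "complex_of_real t powr (s + 1) = of_real t * (of_real t * of_real t powr (s - 1))"
      using t powr_add[of "complex_of_real t" 2 "s - 1"] powr_nat[of "complex_of_real t" 2] by (simp add: power2_eq_square add.commute)
    ultimately have "(F has_vector_derivative ((s + 1) * (of_real t * of_real t powr (s - 1)) * (1 + \<zeta> * of_real t) - (of_real t * (of_real t * of_real t powr (s - 1))) * \<zeta>) / ((1 + \<zeta> * of_real t) * (1 + \<zeta> * of_real t))) (at t)"
      by simp
    also have "((s + 1) * (of_real t * of_real t powr (s - 1)) * (1 + \<zeta> * of_real t) - (of_real t * (of_real t * of_real t powr (s - 1))) * \<zeta>) / ((1 + \<zeta> * of_real t) * (1 + \<zeta> * of_real t)) = f t"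
      using nz by (simp add: f_def cauchyk_def divide_simps)
    finally show ?thesis .
  qed
  have f1: "f absolutely_integrable_on {1<..}" by (rule set_integrable_subset[OF fi]) auto
  have f0: "f absolutely_integrable_on {0<..1}" by (rule set_integrable_subset[OF fi]) auto
  have tail: "integral {1<..} f = - F 1"
  proof (rule FTC_tail[OF f1])
    show "(F has_vector_derivative f t) (at t)" if "1 \<le> t" for t using deriv that by simp
    obtain m where m: "m > 0" "\<And>w u. \<lbrakk>norm (w - \<zeta>) < m; u > 0\<rbrakk> \<Longrightarrow> norm (cauchyk w u) \<le> 1 / m"
      using cauchyk_bound[OF \<zeta>] by metis
    have "(\<lambda>n. (1 + real n) powr Re s * (1 / m)) \<longlonglongrightarrow> 0 * (1 / m)"
    proof (intro tendsto_mult tendsto_const tendsto_neg_powr[OF s(2)])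
      show "filterlim (\<lambda>n. 1 + real n) at_top sequentially"
        by (rule filterlim_tendsto_add_at_top[OF tendsto_const filterlim_real_sequentially])
    qed
    hence lim: "(\<lambda>n. (1 + real n) powr Re s * (1 / m)) \<longlonglongrightarrow> 0" by simp
    show "(\<lambda>n. F (1 + real n)) \<longlonglongrightarrow> 0"
    proof (rule Lim_null_comparison[OF _ lim], rule always_eventually, rule allI)
      fix n
      have "F (1 + real n) = of_real (1 + real n) powr s * cauchyk \<zeta> (1 + real n)"
        using powr_add[of "complex_of_real (1 + real n)" s 1] by (simp add: F_def cauchyk_def add_eq_0_iff)
      also have "norm \<dots> \<le> (1 + real n) powr Re s * (1 / m)"
        unfolding norm_mult using m by (intro mult_mono) (auto simp: norm_of_real_powr add_pos_nonneg simp del: of_real_add)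
      finally show "norm (F (1 + real n)) \<le> (1 + real n) powr Re s * (1 / m)" .
    qed
  qed
  \<comment> \<open>As in \<open>power_integral\<close>, continuity is needed up to the end point
    0.\<close>
  note [continuous_intros del] = continuous_on_of_real_powr
  have "(f has_integral (F 1 - F 0)) {0..1}"
  proof (rule fundamental_theorem_of_calculus_interior)
    show "continuous_on {0..1} F"
      unfolding F_def using s by (auto intro!: continuous_intros slit_plane_nz[OF \<zeta>])
    show "(F has_vector_derivative f t) (at t)" if "t \<in> {0<..<1}" for t using deriv that by simp
  qed simp
  hence "integral {0<..1} f = F 1"
    unfolding has_integral_remove_left_endpoint(2)[symmetric] using s by (auto simp: F_def intro!: integral_unique)
  hence "integral {0<..} f = 0"
    using absolutely_integrable_Un_split(2)[OF _ f0 f1] tail by simp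
  moreover have "integral {0<..} f = (s + 1) * stieltjes s \<zeta> - \<zeta> * integral {0<..} (\<lambda>t. cauchyk \<zeta> t * (cauchyk \<zeta> t * of_real t powr (s - 1)))"
    unfolding f_def stieltjes_def
    using stieltjes_integrable[OF \<zeta> s] stieltjes_square_integrable[OF \<zeta> s]
    by (subst integral_diff) (auto intro!: integrable_on_mult_right simp: absolutely_integrable_on_def)
  ultimately show ?thesis by simp
qed

text \<open>The difference quotient is explicit under the integral, as cauchyk w - cauchyk \<zeta> =
  - (w - \<zeta>) cauchyk w cauchyk \<zeta>. Only the factor cauchyk w varies, and it is bounded
  uniformly near \<zeta>.\<close>

lemma stieltjes_deriv:
  assumes \<zeta>: "\<zeta> \<notin> \<real>\<^sub>\<le>\<^sub>0" and s: "-1 < Re s" "Re s < 0"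
  shows "(stieltjes s has_field_derivative - integral {0<..} (\<lambda>t. cauchyk \<zeta> t * (cauchyk \<zeta> t * of_real t powr (s - 1)))) (at \<zeta>)"
  unfolding has_field_derivative_iff tendsto_at_iff_sequentially
proof (intro allI impI)
  fix X :: "nat \<Rightarrow> complex"
  assume X: "\<forall>i. X i \<in> UNIV - {\<zeta>}" "X \<longlonglongrightarrow> \<zeta>"
  obtain m where m: "m > 0" "\<And>w u. \<lbrakk>norm (w - \<zeta>) < m; u > 0\<rbrakk> \<Longrightarrow> norm (cauchyk w u) \<le> 1 / m"
     "\<And>w u. \<lbrakk>norm (w - \<zeta>) < m; u > 0\<rbrakk> \<Longrightarrow> 1 + w * of_real u \<noteq> 0"
    using cauchyk_bound[OF \<zeta>] by metis
  have "eventually (\<lambda>n. X n \<in> ball \<zeta> m - \<real>\<^sub>\<le>\<^sub>0) sequentially"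
    using X(2) m(1) \<zeta> by (intro topological_tendstoD) (auto intro!: open_Diff closed_nonpos_Reals_complex)
  then obtain N where N: "\<And>n. n \<ge> N \<Longrightarrow> X n \<in> ball \<zeta> m - \<real>\<^sub>\<le>\<^sub>0"
    by (auto simp: eventually_sequentially)
  \<comment> \<open>Dropping finitely many terms keeps the sequence off the slit and inside the disc
    of the uniform bound.\<close>
  define Y where "Y n = X (n + N)" for n
  have Y: "Y n \<noteq> \<zeta>" "norm (Y n - \<zeta>) < m" "Y n \<notin> \<real>\<^sub>\<le>\<^sub>0" for n
    using X(1) N[of "n + N"] by (auto simp: Y_def dist_norm norm_minus_commute)
  have Ylim: "Y \<longlonglongrightarrow> \<zeta>" unfolding Y_def using X(2) by (rule LIMSEQ_ignore_initial_segment)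
  let ?g = "\<lambda>t. cauchyk \<zeta> t * complex_of_real t powr (s - 1)"
  have bounded: "(\<lambda>t. cauchyk (Y n) t * ?g t) absolutely_integrable_on {0<..}" for n
  proof (rule absolutely_integrable_mult_bounded[OF stieltjes_integrable[OF \<zeta> s]])
    show "norm (cauchyk (Y n) x) \<le> 1 / m" if "x \<in> {0<..}" for x
      using m Y that by auto
  qed (auto intro!: continuous_on_cauchyk Y)
  have "(\<lambda>n. integral {0<..} (\<lambda>t. cauchyk (Y n) t * ?g t)) \<longlonglongrightarrow> integral {0<..} (\<lambda>t. cauchyk \<zeta> t * ?g t)"
  proof (rule dominated_convergence)
    show "(\<lambda>t. cauchyk (Y n) t * ?g t) integrable_on {0<..}" for n
      using bounded by (simp add: absolutely_integrable_on_def)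
    show "(\<lambda>t. 1 / m * norm (?g t)) integrable_on {0<..}"
      using stieltjes_integrable[OF \<zeta> s] by (intro integrable_on_mult_right) (simp add: absolutely_integrable_on_def)
    show "norm (cauchyk (Y n) t * ?g t) \<le> 1 / m * norm (?g t)" if "t \<in> {0<..}" for n t
      unfolding norm_mult[of "cauchyk (Y n) t"] using m Y that by (intro mult_right_mono) auto
    show "(\<lambda>n. cauchyk (Y n) t * ?g t) \<longlonglongrightarrow> cauchyk \<zeta> t * ?g t" if "t \<in> {0<..}" for t
      unfolding cauchyk_def using that slit_plane_nz[OF \<zeta>, of t] by (intro tendsto_intros Ylim) auto
  qed
  moreover have "(stieltjes s (Y n) - stieltjes s \<zeta>) / (Y n - \<zeta>) = - integral {0<..} (\<lambda>t. cauchyk (Y n) t * ?g t)" for n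
  proof -
    have "stieltjes s (Y n) - stieltjes s \<zeta> = integral {0<..} (\<lambda>t. cauchyk (Y n) t * complex_of_real t powr (s - 1) - ?g t)"
      unfolding stieltjes_def using stieltjes_integrable[OF \<zeta> s] stieltjes_integrable[OF Y(3) s, of n]
      by (subst integral_diff) (auto simp: absolutely_integrable_on_def)
    also have "\<dots> = integral {0<..} (\<lambda>t. (- (Y n - \<zeta>)) * (cauchyk (Y n) t * ?g t))"
    proof (rule integral_cong)
      fix t :: real assume t: "t \<in> {0<..}"
      have "1 + Y n * of_real t \<noteq> 0" "1 + \<zeta> * of_real t \<noteq> 0"
        using t slit_plane_nz[OF \<zeta>, of t] slit_plane_nz[OF Y(3), of t n] by auto
      hence "cauchyk (Y n) t - cauchyk \<zeta> t = (- (Y n - \<zeta>)) * (cauchyk (Y n) t * cauchyk \<zeta> t)"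
        by (simp add: cauchyk_def divide_simps) (simp add: algebra_simps)
      thus "cauchyk (Y n) t * complex_of_real t powr (s - 1) - ?g t = (- (Y n - \<zeta>)) * (cauchyk (Y n) t * ?g t)"
        by (metis left_diff_distrib mult.assoc)
    qed
    also have "\<dots> = (- (Y n - \<zeta>)) * integral {0<..} (\<lambda>t. cauchyk (Y n) t * ?g t)"
      by (rule integral_mult_right)
    finally show ?thesis using Y(1)[of n] by (simp add: field_simps)
  qed
  ultimately have "(\<lambda>n. (stieltjes s (Y n) - stieltjes s \<zeta>) / (Y n - \<zeta>)) \<longlonglongrightarrow> - integral {0<..} (\<lambda>t. cauchyk \<zeta> t * ?g t)"
    by (simp add: tendsto_minus)
  thus "((\<lambda>y. (stieltjes s y - stieltjes s \<zeta>) / (y - \<zeta>)) \<circ> X) \<longlonglongrightarrow> - integral {0<..} (\<lambda>t. cauchyk \<zeta> t * ?g t)"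
    unfolding Y_def o_def by (rule LIMSEQ_offset)
qed

text \<open>At \<zeta> = 1 the kernel is a Laplace integral: 1 / (1 + t) is the integral of exp (-
  (1 + t) x) over x > 0. \<open>Gamma_Fubini\<close> with e = b = 1 and a = s + 1 then evaluates the
  moment.\<close>

lemma stieltjes_1:
  assumes s: "-1 < Re s" "Re s < 0"
  shows "stieltjes s 1 = Gamma (s + 1) * Gamma (- s)"
proof -
  have k: "gker 1 1 y absolutely_integrable_on {0<..}" "integral {0<..} (gker 1 1 y) = 1 / (1 + of_real y)" if "y > 0" for y
  proof -
    have eq: "gker 1 1 y x = complex_of_real x powr (1 - 1) * of_real (exp (- ((1 + y) * x)))" if "x \<in> {0<..}" for x
      using that by (simp add: gker_def algebra_simps)
    show "gker 1 1 y absolutely_integrable_on {0<..}"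
      by (rule set_integrable_cong[THEN iffD1, OF refl refl eq[symmetric] scaled_Gamma_integral(1)]) (use that in auto)
    have "integral {0<..} (gker 1 1 y) = integral {0<..} (\<lambda>x. complex_of_real x powr (1 - 1) * of_real (exp (- ((1 + y) * x))))"
      by (rule integral_cong[OF eq])
    also have "\<dots> = Gamma 1 * of_real (1 + y) powr (- 1)"
      by (rule scaled_Gamma_integral(2)) (use that in auto)
    finally show "integral {0<..} (gker 1 1 y) = 1 / (1 + of_real y)"
      by (simp add: powr_minus divide_inverse)
  qed
  have "stieltjes s 1 = integral {0<..} (\<lambda>y. of_real y powr (s + 1 - 1) * integral {0<..} (gker 1 1 y))"
    unfolding stieltjes_def
  proof (rule integral_cong)
    fix t :: real assume t: "t \<in> {0<..}"
    show "cauchyk 1 t * of_real t powr (s - 1) = of_real t powr (s + 1 - 1) * integral {0<..} (gker 1 1 t)"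
      using t powr_add[of "complex_of_real t" 1 "s - 1"] by (simp add: k cauchyk_def)
  qed
  also have "\<dots> = Gamma (s + 1) * Gamma (1 - of_real 1 * (s + 1))"
    by (rule Gamma_Fubini(2)) (use s k in auto)
  finally show ?thesis by simp
qed

text \<open>By \<open>stieltjes_by_parts\<close> and \<open>stieltjes_deriv\<close>, \<zeta>^(s + 1)
  times the moment has derivative 0 on the slit plane, which is connected; the constant is read off
  at \<zeta> = 1.\<close>

lemma stieltjes_eq:
  assumes \<zeta>: "\<zeta> \<notin> \<real>\<^sub>\<le>\<^sub>0" and s: "-1 < Re s" "Re s < 0"
  shows "stieltjes s \<zeta> = Gamma (s + 1) * Gamma (- s) * \<zeta> powr (- s - 1)"
proof -
  let ?S = "- \<real>\<^sub>\<le>\<^sub>0 :: complex set"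
  have "(\<lambda>\<zeta>. \<zeta> powr (s + 1) * stieltjes s \<zeta>) constant_on ?S"
  proof (rule has_field_derivative_0_imp_constant_on)
    have "- (\<real>\<^sub>\<le>\<^sub>0) = - (complex_of_real ` {..0})"
      by (auto simp: complex_nonpos_Reals_iff image_iff complex_eq_iff)
    thus "connected ?S"
      using starlike_slotted_complex_plane_left[of 0] by (simp add: starlike_imp_connected)
    show "open ?S" using closed_nonpos_Reals_complex by (simp add: open_Compl)
    fix z assume "z \<in> ?S"
    hence z: "z \<notin> \<real>\<^sub>\<le>\<^sub>0" "z \<noteq> 0" by auto
    define D where "D = integral {0<..} (\<lambda>t. cauchyk z t * (cauchyk z t * of_real t powr (s - 1)))"
    have "((\<lambda>\<zeta>. \<zeta> powr (s + 1) * stieltjes s \<zeta>) has_field_derivative (z powr (s + 1) * (- D) + (s + 1) * z powr s * stieltjes s z)) (at z)"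
      using DERIV_mult[OF has_field_derivative_powr[OF z(1), of "s + 1"] stieltjes_deriv[OF z(1) s]]
      by (simp add: D_def algebra_simps)
    moreover have "z powr (s + 1) * (- D) + (s + 1) * z powr s * stieltjes s z = z powr s * ((s + 1) * stieltjes s z - z * D)"
      using z by (simp add: powr_add algebra_simps)
    ultimately show "((\<lambda>\<zeta>. \<zeta> powr (s + 1) * stieltjes s \<zeta>) has_field_derivative 0) (at z)"
      using stieltjes_by_parts[OF z(1) s] by (simp add: D_def)
  qed
  moreover have "1 \<in> ?S" "\<zeta> \<in> ?S" using \<zeta> by auto
  ultimately have "\<zeta> powr (s + 1) * stieltjes s \<zeta> = 1 powr (s + 1) * stieltjes s 1"
    unfolding constant_on_def by metis
  moreover have "\<zeta> powr (- s - 1) * \<zeta> powr (s + 1) = 1"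
    using \<zeta> by (subst powr_add[symmetric]) auto
  ultimately show ?thesis
    using stieltjes_1[OF s] by (metis mult.assoc mult.commute mult.left_neutral powr_one_eq_one)
qed

lemma expands_cauchyk:
  assumes T: "T > 0" and \<zeta>: "norm \<zeta> * T < 1"
  shows "expands (cauchyk \<zeta>) (\<lambda>j. (- \<zeta>) ^ j) (\<lambda>j. of_nat j + 1) T"
proof -
  have h: "((\<lambda>j. (- \<zeta>) ^ j * of_real t powr (of_nat j + 1)) has_sum cauchyk \<zeta> t) UNIV"
    "(\<lambda>j. norm (\<zeta>) ^ j * t powr (real j + 1)) summable_on UNIV" if t: "t \<in> {0<..T}" for t
  proof -
    have "norm \<zeta> * t \<le> norm \<zeta> * T" using t by (intro mult_left_mono) auto
    hence lt: "norm (- \<zeta> * of_real t) < 1" using \<zeta> t by (simp add: norm_mult)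
    have eq: "(- \<zeta>) ^ j * of_real t powr (of_nat j + 1) = of_real t * (- \<zeta> * of_real t) ^ j" for j
    proof -
      have "(- \<zeta> * of_real t) ^ j = (- \<zeta>) ^ j * of_real t ^ j" by (rule power_mult_distrib)
      thus ?thesis using t by (simp add: powr_add powr_nat)
    qed
    have eqn: "norm \<zeta> ^ j * t powr (real j + 1) = norm (of_real t * (- \<zeta> * of_real t) ^ j)" for j
      using t by (simp add: powr_add powr_realpow power_mult_distrib norm_mult norm_power)
    have s: "summable (\<lambda>j. norm (of_real t * (- \<zeta> * of_real t) ^ j))"
      unfolding norm_mult[of "of_real t"] norm_power using lt by (intro summable_mult summable_geometric) simp
    thus "(\<lambda>j. norm (\<zeta>) ^ j * t powr (real j + 1)) summable_on UNIV"
      unfolding eqn by (intro summable_nonneg_imp_summable_on) auto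
    have "(\<lambda>j. of_real t * (- \<zeta> * of_real t) ^ j) sums (of_real t * (1 / (1 - (- \<zeta> * of_real t))))"
      by (intro sums_mult geometric_sums lt)
    hence "(\<lambda>j. of_real t * (- \<zeta> * of_real t) ^ j) sums cauchyk \<zeta> t" by (simp add: cauchyk_def)
    thus "((\<lambda>j. (- \<zeta>) ^ j * of_real t powr (of_nat j + 1)) has_sum cauchyk \<zeta> t) UNIV"
      unfolding eq by (rule norm_summable_imp_has_sum[OF s])
  qed
  show ?thesis unfolding expands_def using T h(1) h(2)[of T] by (simp add: norm_power)
qed

text \<open>From cauchyk + \<zeta> t cauchyk = t. The finite part of a pure power is 0: the tail
  integral of t^s over (T, \<infinity>) is cancelled by the term j = 0 of the series.\<close>

lemma fpm_cauchyk_rec: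
  assumes T: "T > 0" and \<zeta>: "norm \<zeta> * T < 1" "\<zeta> \<notin> \<real>\<^sub>\<le>\<^sub>0" and s: "Re s < -1" "s \<notin> \<int>"
  defines "M \<equiv> fpm (cauchyk \<zeta>) (\<lambda>j. (- \<zeta>) ^ j) (\<lambda>j. of_nat j + 1) T"
  shows "M s = - \<zeta> * M (s + 1)"
proof -
  obtain d where d: "d > 0" "\<And>m. m \<in> \<int> \<Longrightarrow> d \<le> norm (s - m)" using nonint_dist[OF s(2)] by metis
  have dk: "d \<le> norm (of_nat k + 1 + (s + of_nat n))" for k n
  proof -
    have "s - (- of_nat (k + 1 + n)) = of_nat k + 1 + (s + of_nat n)" by simp
    thus ?thesis using d(2)[of "- of_nat (k + 1 + n)"] by (metis Ints_minus Ints_of_nat)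
  qed
  define h0 where "h0 j = (- \<zeta>) ^ j * of_real T powr (of_nat j + 1 + s) / (of_nat j + 1 + s)" for j
  define h1 where "h1 j = (- \<zeta>) ^ j * of_real T powr (of_nat j + 1 + (s + 1)) / (of_nat j + 1 + (s + 1))" for j
  have S0: "(h0 has_sum infsum h0 UNIV) UNIV" and S1: "(h1 has_sum infsum h1 UNIV) UNIV"
    using expands_summable[OF expands_cauchyk[OF T \<zeta>(1)] d(1) dk[of _ 0]] expands_summable[OF expands_cauchyk[OF T \<zeta>(1)] d(1) dk[of _ 1]]
    by (simp_all add: h0_def[abs_def] h1_def[abs_def])
  have h1: "- \<zeta> * h1 j = h0 (Suc j)" for j
    by (simp add: h0_def h1_def add_ac)
  have "((\<lambda>j. h0 (Suc j)) has_sum (- \<zeta> * infsum h1 UNIV)) UNIV"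
    using has_sum_cmult_right[OF S1, of "- \<zeta>"] unfolding h1 .
  hence "(\<lambda>j. h0 (Suc j)) sums (- \<zeta> * infsum h1 UNIV)" by (rule has_sum_imp_sums)
  hence "h0 sums (- \<zeta> * infsum h1 UNIV + h0 0)" by (simp add: sums_Suc_iff)
  moreover have "h0 sums infsum h0 UNIV" by (rule has_sum_imp_sums[OF S0])
  ultimately have S: "infsum h0 UNIV = - \<zeta> * infsum h1 UNIV + of_real T powr (s + 1) / (s + 1)"
    using sums_unique2 by (fastforce simp: h0_def add.commute)
  define I where "I s = integral {T<..} (\<lambda>t. cauchyk \<zeta> t * of_real t powr (s - 1))" for s
  have i: "(\<lambda>t. cauchyk \<zeta> t * of_real t powr (v - 1)) integrable_on {T<..}" if "Re v < 0" for v
    using cauchyk_tail_integrable[OF \<zeta>(2) T that] by (simp add: absolutely_integrable_on_def)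
  have "I s + \<zeta> * I (s + 1) = integral {T<..} (\<lambda>t. cauchyk \<zeta> t * of_real t powr (s - 1) + \<zeta> * (cauchyk \<zeta> t * of_real t powr (s + 1 - 1)))"
    unfolding I_def using i[of s] i[of "s + 1"] s by (subst integral_add) (auto intro!: integrable_on_mult_right)
  also have "\<dots> = integral {T<..} (\<lambda>t. of_real t powr (s + 1 - 1))"
  proof (rule integral_cong)
    fix t :: real assume "t \<in> {T<..}"
    hence t: "t > 0" using T by simp
    show "cauchyk \<zeta> t * of_real t powr (s - 1) + \<zeta> * (cauchyk \<zeta> t * of_real t powr (s + 1 - 1)) = of_real t powr (s + 1 - 1)"
      using t slit_plane_nz[OF \<zeta>(2), of t] powr_add[of "complex_of_real t" 1 "s - 1"]
      by (simp add: cauchyk_def divide_simps) (simp add: algebra_simps)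
  qed
  also have "\<dots> = - (of_real T powr (s + 1) / (s + 1))"
    by (rule power_tail_integral(2)[OF T]) (use s in simp)
  finally have "I s + \<zeta> * I (s + 1) = - (of_real T powr (s + 1) / (s + 1))" .
  hence "I s + infsum h0 UNIV = - \<zeta> * (I (s + 1) + infsum h1 UNIV)"
  proof -
    have "a + h = - z * (b + g)" if "a + z * b = - q" "h = - z * g + q" for a b g h q z :: complex
      using that by algebra
    from this[OF \<open>I s + \<zeta> * I (s + 1) = - (of_real T powr (s + 1) / (s + 1))\<close> S] show ?thesis .
  qed
  moreover have "M s = I s + infsum h0 UNIV" "M (s + 1) = I (s + 1) + infsum h1 UNIV"
    by (simp_all add: M_def fpm_def I_def h0_def[abs_def] h1_def[abs_def])
  ultimately show ?thesis by simp
qed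

text \<open>The recurrence runs to the left out of the strip -1 < Re s < 0, where the moment
  converges. The lines on which Re s is an integer lie in none of the strips reached, hence the
  condition on Re s.\<close>

lemma fpm_cauchyk:
  assumes T: "T > 0" and \<zeta>: "norm \<zeta> * T < 1" "\<zeta> \<notin> \<real>\<^sub>\<le>\<^sub>0" and s: "Re s < 0" "Re s \<notin> \<int>"
  shows "fpm (cauchyk \<zeta>) (\<lambda>j. (- \<zeta>) ^ j) (\<lambda>j. of_nat j + 1) T s = Gamma (s + 1) * Gamma (- s) * \<zeta> powr (- s - 1)"
proof -
  let ?M = "fpm (cauchyk \<zeta>) (\<lambda>j. (- \<zeta>) ^ j) (\<lambda>j. of_nat j + 1) T"
  have nonint: "v \<notin> \<int>" if "Re v \<notin> \<int>" for v :: complex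
    using that by (auto elim!: Ints_cases)
  have "?M s = Gamma (s + 1) * Gamma (- s) * \<zeta> powr (- s - 1)" if "Re s + real n > -1" "Re s < 0" "Re s \<notin> \<int>" for n
    using that
  proof (induction n arbitrary: s)
    case 0
    have "?M s = integral {0<..} (\<lambda>t. cauchyk \<zeta> t * of_real t powr (s - 1))"
      using 0 by (intro fpm_eq_integral(2)[OF expands_cauchyk[OF T \<zeta>(1)], of "Re s + 1"] cauchyk_tail_integrable \<zeta> T) auto
    thus ?case using stieltjes_eq[OF \<zeta>(2), of s] 0 by (simp add: stieltjes_def)
  next
    case (Suc n)
    show ?case
    proof (cases "Re s > -1")
      case True
      thus ?thesis using Suc.IH[of s] Suc.prems by simp
    next
      case False
      hence s1: "Re s < -1" using Suc.prems(3) by (metis Ints_1 Ints_minus linorder_neqE_linordered_idom)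
      have "Re (s + 1) \<notin> \<int>"
        using Suc.prems(3) by (metis Ints_1 Ints_diff add_diff_cancel_right' one_complex.sel(1) plus_complex.sel(1))
      hence "?M (s + 1) = Gamma (s + 1 + 1) * Gamma (- (s + 1)) * \<zeta> powr (- (s + 1) - 1)"
        using Suc.prems s1 by (intro Suc.IH) auto
      moreover have "Gamma (s + 1 + 1) = (s + 1) * Gamma (s + 1)"
        using nonint[OF \<open>Re (s + 1) \<notin> \<int>\<close>] by (intro Gamma_plus1) (use nonpos_Ints_Int in blast)
      moreover have "Gamma (- (s + 1) + 1) = - (s + 1) * Gamma (- (s + 1))"
        using nonint[OF \<open>Re (s + 1) \<notin> \<int>\<close>] by (intro Gamma_plus1) (metis nonpos_Ints_Int minus_in_Ints_iff)
      moreover have "\<zeta> powr (- s - 1) = \<zeta> * \<zeta> powr (- (s + 1) - 1)"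
      proof -
        have arg: "1 + (- (s + 1) - 1) = - s - 1" by simp
        have "\<zeta> powr (1 + (- (s + 1) - 1)) = \<zeta> powr 1 * \<zeta> powr (- (s + 1) - 1)" by (rule powr_add)
        moreover have "\<zeta> powr 1 = \<zeta>" using \<zeta> by auto
        ultimately show ?thesis unfolding arg by simp
      qed
      moreover have "- (s + 1) + 1 = - s" by simp
      ultimately have "- \<zeta> * ?M (s + 1) = Gamma (s + 1) * Gamma (- s) * \<zeta> powr (- s - 1)"
        by (simp only:) (simp add: algebra_simps)
      thus ?thesis using fpm_cauchyk_rec[OF T \<zeta> s1 nonint[OF Suc.prems(3)]] by simp
    qed
  qed
  moreover obtain n where "- 1 - Re s < real n" using reals_Archimedean2 by blast
  hence "Re s + real n > -1" by linarith
  ultimately show ?thesis using s by blast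
qed

section \<open>Continuity in the parameters\<close>

lemma bsum_tendsto:
  assumes X: "(X \<longlongrightarrow> \<nu>) F"
  shows "((\<lambda>n. bsum (X n) x) \<longlongrightarrow> bsum \<nu> x) F"
proof -
  \<comment> \<open>Near the limit the order has norm at most norm \<nu> + 1, so norm (X n + k + 1)
    \<ge> 1 and the reciprocal Gamma factor does not grow; 2 norm x \<le> K then yields the ratio
    1/2.\<close>
  obtain K :: nat where K: "real K \<ge> norm \<nu> + 1" "real K \<ge> 2 * norm x"
    by (metis max.bounded_iff real_arch_simple)
  show ?thesis
  unfolding bsum_def
  proof (rule suminf_tendsto_ratio[where K = K])
  have "eventually (\<lambda>n. dist (X n) \<nu> < 1) F"
    using X tendstoD zero_less_one by blast
  thus "eventually (\<lambda>n. \<forall>k\<ge>K. norm (x ^ Suc k / of_nat (fact (Suc k)) * rGamma (X n + of_nat (Suc k) + 1))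
      \<le> norm (x ^ k / of_nat (fact k) * rGamma (X n + of_nat k + 1)) / 2) F"
  proof (eventually_elim, intro allI impI)
    fix n k assume d: "dist (X n) \<nu> < 1" and k: "K \<le> k"
    let ?v = "X n + of_nat k + 1"
    have "norm (X n) \<le> norm \<nu> + 1"
      using d norm_triangle_ineq2[of "X n" \<nu>] by (simp add: dist_norm)
    moreover have "norm (of_nat k + 1 + X n) \<ge> norm (of_nat k + 1 :: complex) - norm (X n)"
      by (rule norm_diff_ineq)
    moreover have "norm (of_nat k + 1 :: complex) = real k + 1"
      by (metis norm_of_nat of_nat_Suc add.commute)
    ultimately have v: "norm ?v \<ge> 1" using K(1) k by (simp add: add_ac)
    have "norm (rGamma (?v + 1)) \<le> norm ?v * norm (rGamma (?v + 1))"
      using v by (simp add: mult_le_cancel_right1)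
    also have "\<dots> = norm (rGamma ?v)" by (simp only: norm_mult[symmetric] rGamma_plus1)
    finally have g: "norm (rGamma (?v + 1)) \<le> norm (rGamma ?v)" .
    have x: "norm x / real (Suc k) \<le> 1 / 2" using K(2) k by (simp add: field_simps)
    have "norm (x ^ Suc k / of_nat (fact (Suc k)) * rGamma (X n + of_nat (Suc k) + 1)) =
       (norm x / real (Suc k)) * (norm x ^ k / fact k * norm (rGamma (?v + 1)))"
    proof -
      have f: "norm (of_nat (fact (Suc k)) :: complex) = real (Suc k) * fact k"
        by (simp only: norm_of_nat) (simp add: algebra_simps)
      show ?thesis by (simp only: norm_mult norm_divide norm_power f) (simp add: add_ac)
    qed
    also have "\<dots> \<le> 1 / 2 * (norm x ^ k / fact k * norm (rGamma ?v))"
      by (intro mult_mono mult_nonneg_nonneg x g) auto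
    finally show "norm (x ^ Suc k / of_nat (fact (Suc k)) * rGamma (X n + of_nat (Suc k) + 1))
      \<le> norm (x ^ k / of_nat (fact k) * rGamma (X n + of_nat k + 1)) / 2"
      by (simp add: norm_mult norm_divide norm_power)
  qed
  show "((\<lambda>n. x ^ k / of_nat (fact k) * rGamma (X n + of_nat k + 1)) \<longlongrightarrow> x ^ k / of_nat (fact k) * rGamma (\<nu> + of_nat k + 1)) F" for k
    by (intro tendsto_mult tendsto_const isCont_tendsto_compose[OF isCont_rGamma[OF continuous_ident]] tendsto_add X)
  qed
qed

lemma besselJ_tendsto:
  assumes X: "(X \<longlongrightarrow> \<nu>) F" and z: "z \<noteq> 0"
  shows "((\<lambda>n. besselJ (X n) z) \<longlongrightarrow> besselJ \<nu> z) F"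
proof -
  have "((\<lambda>n. exp (X n * Ln (z / 2))) \<longlongrightarrow> exp (\<nu> * Ln (z / 2))) F"
    by (intro tendsto_intros X)
  thus ?thesis
    using z unfolding besselJ_bsum powr_def by (intro tendsto_mult bsum_tendsto X) simp_all
qed

section \<open>The hypergeometric series with first parameter 1\<close>

definition hyp_term :: "complex \<Rightarrow> complex \<Rightarrow> complex \<Rightarrow> nat \<Rightarrow> complex" where
  "hyp_term b1 b2 x k = x ^ k / (pochhammer b1 k * pochhammer b2 k)"

lemma hyp1F2_1: "hyp1F2 1 b1 b2 x = (\<Sum>k. hyp_term b1 b2 x k)"
  unfolding hyp1F2_def hyp_term_def
  by (intro suminf_cong) (simp add: pochhammer_fact[symmetric])

lemma hyp_term_ratio:
  assumes "norm b1 \<le> B" "norm b2 \<le> B" "real k \<ge> B + 1 + 2 * norm x" "B \<ge> 0"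
  shows "norm (hyp_term b1 b2 x (Suc k)) \<le> norm (hyp_term b1 b2 x k) / 2"
proof -
  have *: "norm (b + of_nat k) \<ge> 1 + 2 * norm x" if "norm b \<le> B" for b :: complex
    using norm_diff_ineq[of "of_nat k" b] assms(3) that by (simp add: add.commute)
  have b2: "norm (b2 + of_nat k) \<ge> 1" using *[OF assms(2)] norm_ge_zero[of x] by linarith
  have pos: "1 + 2 * norm x > 0" "norm (b1 + of_nat k) > 0" "norm (b2 + of_nat k) > 0"
    using *[OF assms(1)] b2 norm_ge_zero[of x] by linarith+
  have "norm x / (norm (b1 + of_nat k) * norm (b2 + of_nat k)) \<le> norm x / ((1 + 2 * norm x) * 1)"
    by (intro divide_left_mono mult_mono mult_pos_pos *[OF assms(1)] b2 pos) auto
  also have "\<dots> \<le> 1 / 2" using pos(1) by (simp add: field_simps)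
  finally have r: "norm x / (norm (b1 + of_nat k) * norm (b2 + of_nat k)) \<le> 1 / 2" .
  have "norm (hyp_term b1 b2 x (Suc k)) = norm x / (norm (b1 + of_nat k) * norm (b2 + of_nat k)) * norm (hyp_term b1 b2 x k)"
    by (simp add: hyp_term_def norm_mult norm_divide norm_power pochhammer_rec')
  also have "\<dots> \<le> 1 / 2 * norm (hyp_term b1 b2 x k)"
    by (rule mult_right_mono[OF r]) simp
  finally show ?thesis by simp
qed

lemma hyp_term_summable: "summable (hyp_term b1 b2 x)"
proof -
  define B where "B = norm b1 + norm b2"
  obtain K :: nat where K: "real K \<ge> B + 1 + 2 * norm x" using real_arch_simple by blast
  show ?thesis
  proof (rule summable_ratio_test[of "1/2" K])
    fix k assume "k \<ge> K"
    thus "norm (hyp_term b1 b2 x (Suc k)) \<le> 1 / 2 * norm (hyp_term b1 b2 x k)"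
      using hyp_term_ratio[of b1 B b2 x k] K by (simp add: B_def)
  qed simp
qed

lemma hyp1F2_tendsto:
  assumes "(X \<longlongrightarrow> b1) F" "(Y \<longlongrightarrow> b2) F" "b1 \<notin> \<int>\<^sub>\<le>\<^sub>0" "b2 \<notin> \<int>\<^sub>\<le>\<^sub>0"
  shows "((\<lambda>n. hyp1F2 1 (X n) (Y n) x) \<longlongrightarrow> hyp1F2 1 b1 b2 x) F"
proof -
  define B where "B = norm b1 + norm b2 + 1"
  obtain K :: nat where K: "real K \<ge> B + 1 + 2 * norm x" using real_arch_simple by blast
  show ?thesis
  unfolding hyp1F2_1
  proof (rule suminf_tendsto_ratio[where K = K])
  have e: "eventually (\<lambda>n. dist (X n) b1 < 1) F" "eventually (\<lambda>n. dist (Y n) b2 < 1) F"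
    using assms tendstoD zero_less_one by blast+
  thus "eventually (\<lambda>n. \<forall>k\<ge>K. norm (hyp_term (X n) (Y n) x (Suc k)) \<le> norm (hyp_term (X n) (Y n) x k) / 2) F"
  proof (eventually_elim, intro allI impI)
    fix n k assume d: "dist (X n) b1 < 1" "dist (Y n) b2 < 1" and k: "K \<le> k"
    show "norm (hyp_term (X n) (Y n) x (Suc k)) \<le> norm (hyp_term (X n) (Y n) x k) / 2"
    proof (rule hyp_term_ratio)
      show "norm (X n) \<le> B" "norm (Y n) \<le> B"
        using d norm_triangle_ineq2[of "X n" b1] norm_triangle_ineq2[of "Y n" b2] norm_ge_zero[of b1] norm_ge_zero[of b2]
        unfolding B_def dist_norm by linarith+
      show "real k \<ge> B + 1 + 2 * norm x" using K k by simp
      show "B \<ge> 0" by (simp add: B_def)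
    qed
  qed
  have p: "pochhammer b k \<noteq> 0" if "b \<notin> \<int>\<^sub>\<le>\<^sub>0" for b :: complex and k
    using that pochhammer_eq_0_iff[of b k] by auto
  show "((\<lambda>n. hyp_term (X n) (Y n) x k) \<longlongrightarrow> hyp_term b1 b2 x k) F" for k
    unfolding hyp_term_def pochhammer_prod
    by (intro tendsto_divide tendsto_const tendsto_mult tendsto_prod tendsto_add assms)
       (use p assms in \<open>auto simp: pochhammer_prod\<close>)
  qed
qed

lemma hyp1F2_contiguous:
  assumes "b1 \<noteq> 0" "b2 \<noteq> 0"
  shows "hyp1F2 1 b1 b2 x = 1 + x / (b1 * b2) * hyp1F2 1 (b1 + 1) (b2 + 1) x"
proof -
  have "(\<Sum>k. hyp_term b1 b2 x k) = (\<Sum>k. hyp_term b1 b2 x (Suc k)) + hyp_term b1 b2 x 0"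
    using suminf_split_head[OF hyp_term_summable] by simp
  also have "(\<lambda>k. hyp_term b1 b2 x (Suc k)) = (\<lambda>k. x / (b1 * b2) * hyp_term (b1 + 1) (b2 + 1) x k)"
    by (simp add: hyp_term_def pochhammer_rec fun_eq_iff)
  also have "(\<Sum>k. x / (b1 * b2) * hyp_term (b1 + 1) (b2 + 1) x k) = x / (b1 * b2) * (\<Sum>k. hyp_term (b1 + 1) (b2 + 1) x k)"
    by (rule suminf_mult[OF hyp_term_summable])
  finally show ?thesis by (simp add: hyp1F2_1 hyp_term_def)
qed

text \<open>The hypothesis on arg z enters here and in the next lemma. In the open right half plane,
  doubling \<open>Ln w\<close> keeps the imaginary part strictly between -pi and pi, so the
  principal logarithm of w^2 is twice that of w.\<close>

lemma powr_square_right_half: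
  assumes "Re w > 0"
  shows "(w\<^sup>2) powr c = w powr (2 * c)"
proof -
  have w: "w \<noteq> 0" using assms by auto
  have "\<bar>Im (Ln w)\<bar> < pi / 2" using Re_Ln_pos_lt[OF w] assms by simp
  hence "Ln (w\<^sup>2) = 2 * Ln w"
    using w by (intro Ln_unique) (auto simp: exp_double)
  thus ?thesis using w by (simp add: powr_def mult_ac)
qed

lemma square_not_nonpos_Reals:
  assumes "Re w > 0"
  shows "w\<^sup>2 \<notin> \<real>\<^sub>\<le>\<^sub>0"
proof
  assume "w\<^sup>2 \<in> \<real>\<^sub>\<le>\<^sub>0"
  hence "Re (w\<^sup>2) \<le> 0" "Im (w\<^sup>2) = 0" by (auto simp: complex_nonpos_Reals_iff)
  hence "(Re w)\<^sup>2 \<le> (Im w)\<^sup>2" "Re w * Im w = 0" by (auto simp: power2_eq_square)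
  thus False using assms by auto
qed

lemma Gamma_pochhammer_down:
  fixes c :: complex
  assumes "c \<notin> \<int>"
  shows "Gamma (c - of_nat j) = (- 1) ^ j * Gamma c / pochhammer (1 - c) j"
proof (induction j)
  case (Suc j)
  have ni: "c - of_nat (Suc j) \<notin> \<int>"
    using assms Int_shift_iff[of "c - of_nat (Suc j)" "Suc j"] by simp
  have "Gamma (c - of_nat (Suc j) + 1) = (c - of_nat (Suc j)) * Gamma (c - of_nat (Suc j))"
    using ni by (intro Gamma_plus1) (use nonpos_Ints_Int in blast)
  moreover have "c - of_nat (Suc j) + 1 = c - of_nat j" by simp
  ultimately have "(c - of_nat (Suc j)) * Gamma (c - of_nat (Suc j)) = Gamma (c - of_nat j)" by (simp only:)
  moreover have "c - of_nat (Suc j) \<noteq> 0" using ni by auto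
  ultimately have g: "Gamma (c - of_nat (Suc j)) = Gamma (c - of_nat j) / (c - of_nat (Suc j))"
    by (simp add: nonzero_eq_divide_eq mult.commute)
  define E where "E = 1 - c + of_nat j"
  have e: "c - of_nat (Suc j) = - E" by (simp add: E_def)
  show ?case unfolding g unfolding Suc.IH pochhammer_rec' unfolding e E_def[symmetric] by (simp add: mult.commute)
qed simp

text \<open>In \<open>Mellin_Parseval\<close>, S1 pairs the coefficients of the Macdonald function
  with moments of the Cauchy kernel, and S2 does the reverse. The conditions on the real parts of b
  \<plusminus> \<nu> / 2 serve \<open>fpm_cauchyk\<close> and keep the two sets of exponents
  apart.\<close>

lemma stieltjes_kk:
  assumes \<nu>: "\<nu> \<notin> \<int>" and \<zeta>: "\<zeta> \<notin> \<real>\<^sub>\<le>\<^sub>0"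
    and b: "Re b > \<bar>Re \<nu>\<bar> / 2" "Re (b + \<nu> / 2) \<notin> \<int>" "Re (b - \<nu> / 2) \<notin> \<int>"
  defines "S1 \<equiv> \<lambda>i. kc \<nu> i * (Gamma (1 - (kp \<nu> i + b)) * Gamma (kp \<nu> i + b) * \<zeta> powr (kp \<nu> i + b - 1))"
    and "S2 \<equiv> \<lambda>j. (- \<zeta>) ^ j * (Gamma (b - 1 - of_nat j + \<nu> / 2) * Gamma (b - 1 - of_nat j - \<nu> / 2) / 2)"
  shows "integral {0<..} (\<lambda>y. of_real y powr (b - 1) * kk \<nu> y / (of_real y + \<zeta>)) = infsum S1 UNIV + infsum S2 UNIV"
    and "S2 summable_on UNIV"
proof -
  have nonint: "v \<notin> \<int>" if "Re v \<notin> \<int>" for v :: complex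
    using that by (auto elim!: Ints_cases)
  have b': "b + \<nu> / 2 \<notin> \<int>" "b - \<nu> / 2 \<notin> \<int>" using b nonint by blast+
  \<comment> \<open>The geometric series of the kernel must converge at 1 / T, that is, norm \<zeta>
    < T; the expansion of \<open>kk\<close> allows every T > 0.\<close>
  define T where "T = norm \<zeta> + 1"
  have T: "T > 0" by (simp add: T_def add_nonneg_pos)
  have T': "norm \<zeta> * (1 / T) < 1" using T by (simp add: T_def)
  \<comment> \<open>The lowest real part among the exponents of ?\<phi>. It is positive, which makes
    the weighted tail of the Cauchy kernel integrable.\<close>
  define P where "P = Re b - \<bar>Re \<nu>\<bar> / 2"
  let ?\<phi> = "\<lambda>t. of_real t powr b * kk \<nu> t"
  have e1: "expands ?\<phi> (kc \<nu>) (\<lambda>i. kp \<nu> i + b) T"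
    by (rule expands_powr_times[OF expands_kk[OF T \<nu>]])
  have e2: "expands (cauchyk \<zeta>) (\<lambda>j. (- \<zeta>) ^ j) (\<lambda>j. of_nat j + 1) (1 / T)"
    using T T' by (intro expands_cauchyk) auto
  have P: "P \<le> Re (kp \<nu> i + b)" for i
    by (cases i) (auto simp: kp_def signed_order_def abs_if P_def)
  have Ppos: "P > 0" using b by (simp add: P_def)
  have I1: "(\<lambda>t. ?\<phi> t * of_real t powr (- of_real 1 - 1)) absolutely_integrable_on {T<..}"
  proof -
    have eq: "?\<phi> t * of_real t powr (- of_real 1 - 1) = kk \<nu> t * of_real t powr ((b - 1) - 1)" for t
      using powr_add[of "complex_of_real t" b "- of_real 1 - 1"] by (simp add: mult_ac)
    show ?thesis unfolding eq by (rule kk_tail_integrable[OF T])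
  qed
  have I2: "(\<lambda>t. cauchyk \<zeta> t * of_real t powr (- of_real P - 1)) absolutely_integrable_on {1/T<..}"
    using Ppos T by (intro cauchyk_tail_integrable \<zeta>) auto
  obtain d where d: "d > 0" "\<And>i m. m \<in> \<int> \<Longrightarrow> d \<le> norm (kp \<nu> i + b - m)"
    using kp_dist[OF b'] by metis
  have d': "d \<le> norm (kp \<nu> i + b - (of_nat j + 1))" for i and j :: nat
    by (rule d(2)) simp
  note MP = Mellin_Parseval[OF e1 e2 P _ I1 I2 d(1) d']
  have m1: "kc \<nu> i * fpm (cauchyk \<zeta>) (\<lambda>j. (- \<zeta>) ^ j) (\<lambda>j. of_nat j + 1) (1 / T) (- (kp \<nu> i + b)) = S1 i" for i
  proof -
    have "Re (kp \<nu> i + b) \<notin> \<int>"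
    proof -
      obtain c k where i: "i = (c, k)" by force
      have "Re (kp \<nu> i + b) = Re (b + signed_order c \<nu> / 2) + of_nat k" by (simp add: i kp_def)
      moreover have "Re (b + signed_order c \<nu> / 2) \<notin> \<int>" using b by (auto simp: signed_order_def)
      ultimately show ?thesis by (metis Ints_diff Ints_of_nat add_diff_cancel_right')
    qed
    hence "Re (- (kp \<nu> i + b)) \<notin> \<int>" by (metis minus_in_Ints_iff uminus_complex.sel(1))
    moreover have "Re (- (kp \<nu> i + b)) < 0" using P[of i] Ppos by simp
    ultimately have "fpm (cauchyk \<zeta>) (\<lambda>j. (- \<zeta>) ^ j) (\<lambda>j. of_nat j + 1) (1 / T) (- (kp \<nu> i + b)) =
       Gamma (- (kp \<nu> i + b) + 1) * Gamma (- (- (kp \<nu> i + b))) * \<zeta> powr (- (- (kp \<nu> i + b)) - 1)"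
      using T T' \<zeta> by (intro fpm_cauchyk) auto
    moreover have "- (kp \<nu> i + b) + 1 = 1 - (kp \<nu> i + b)" by simp
    ultimately show ?thesis unfolding S1_def by (simp only: minus_minus)
  qed
  have m2: "(- \<zeta>) ^ j * fpm ?\<phi> (kc \<nu>) (\<lambda>i. kp \<nu> i + b) T (- (of_nat j + 1)) = S2 j" for j
  proof -
    have "fpm ?\<phi> (kc \<nu>) (\<lambda>i. kp \<nu> i + b) T (- (of_nat j + 1)) = fpm (kk \<nu>) (kc \<nu>) (kp \<nu>) T (- (of_nat j + 1) + b)"
      by (rule fpm_powr_times[OF T])
    also have "- (of_nat j + 1) + b = b - 1 - of_nat j" by simp
    also have "fpm (kk \<nu>) (kc \<nu>) (kp \<nu>) T (b - 1 - of_nat j) = Gamma (b - 1 - of_nat j + \<nu> / 2) * Gamma (b - 1 - of_nat j - \<nu> / 2) / 2"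
    proof (rule fpm_kk[OF \<nu> T])
      show "b - 1 - of_nat j + \<nu> / 2 \<notin> \<int>"
        using b'(1) Int_shift_iff[of "b - 1 - of_nat j + \<nu> / 2" "Suc j"] by (simp add: algebra_simps)
      show "b - 1 - of_nat j - \<nu> / 2 \<notin> \<int>"
        using b'(2) Int_shift_iff[of "b - 1 - of_nat j - \<nu> / 2" "Suc j"] by (simp add: algebra_simps)
    qed
    finally show ?thesis by (simp add: S2_def)
  qed
  have "integral {0<..} (\<lambda>t. ?\<phi> t * cauchyk \<zeta> (1 / t) / of_real t) = infsum S1 UNIV + infsum S2 UNIV"
    by (subst MP(2)) (simp_all only: m1 m2, simp_all)
  moreover have "integral {0<..} (\<lambda>t. ?\<phi> t * cauchyk \<zeta> (1 / t) / of_real t) = integral {0<..} (\<lambda>y. of_real y powr (b - 1) * kk \<nu> y / (of_real y + \<zeta>))"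
  proof (rule integral_cong)
    fix t :: real assume t: "t \<in> {0<..}"
    have "1 + \<zeta> * complex_of_real (1 / t) \<noteq> 0" using t slit_plane_nz[OF \<zeta>, of "1 / t"] by simp
    moreover have "1 + \<zeta> * complex_of_real (1 / t) = (of_real t + \<zeta>) / of_real t" using t by (simp add: field_simps)
    ultimately have nz: "of_real t + \<zeta> \<noteq> 0" by auto
    have c: "cauchyk \<zeta> (1 / t) = 1 / (of_real t + \<zeta>)"
      using t nz by (simp add: cauchyk_def field_simps)
    have "complex_of_real t powr (b - 1) = of_real t powr b / of_real t" using t by (simp add: powr_diff)
    thus "?\<phi> t * cauchyk \<zeta> (1 / t) / of_real t = of_real t powr (b - 1) * kk \<nu> t / (of_real t + \<zeta>)"
      unfolding c by simp
  qed
  ultimately show "integral {0<..} (\<lambda>y. of_real y powr (b - 1) * kk \<nu> y / (of_real y + \<zeta>)) = infsum S1 UNIV + infsum S2 UNIV"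
    by simp
  show "S2 summable_on UNIV"
    using MP(3) unfolding m2 by simp
qed

section \<open>The Stieltjes transform of the Macdonald function\<close>

text \<open>The integral of the theorem in terms of \<open>kk\<close>, whose bounds and continuity
  in the order are at hand; a stands for 2 N - \<mu>.\<close>

definition kint :: "complex \<Rightarrow> complex \<Rightarrow> complex \<Rightarrow> complex" where
  "kint z a \<nu> = integral {0<..} (\<lambda>t. of_real t powr a * kk \<nu> (t\<^sup>2 / 4) / (1 + (of_real t / z)\<^sup>2))"

lemma quarter_square_substitution:
  fixes f :: "real \<Rightarrow> complex"
  shows "(\<lambda>t. of_real (t / 2) * f (t\<^sup>2 / 4)) absolutely_integrable_on {0<..} \<longleftrightarrow> f absolutely_integrable_on {0<..}" (is ?A)
    and "f absolutely_integrable_on {0<..} \<Longrightarrow> integral {0<..} (\<lambda>t. of_real (t / 2) * f (t\<^sup>2 / 4)) = integral {0<..} f"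
proof -
  have img: "(\<lambda>t. t\<^sup>2 / 4) ` {0<..} = {(0::real)<..}"
  proof (intro equalityI subsetI)
    fix y :: real assume "y \<in> {0<..}"
    thus "y \<in> (\<lambda>t. t\<^sup>2 / 4) ` {0<..}"
      by (intro image_eqI[of _ _ "2 * sqrt y"]) (auto simp: power_mult_distrib)
  qed auto
  have cv: "(\<lambda>t. \<bar>t / 2\<bar> *\<^sub>R f (t\<^sup>2 / 4)) absolutely_integrable_on {0<..} \<and> integral {0<..} (\<lambda>t. \<bar>t / 2\<bar> *\<^sub>R f (t\<^sup>2 / 4)) = b
     \<longleftrightarrow> f absolutely_integrable_on {0<..} \<and> integral {0<..} f = b" for b
  proof -
    have d: "((\<lambda>t. t\<^sup>2 / 4) has_field_derivative t / 2) (at t within {0<..})" if "t \<in> {0<..}" for t :: real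
      by (auto intro!: derivative_eq_intros)
    have i: "inj_on (\<lambda>t::real. t\<^sup>2 / 4) {0<..}"
      by (auto simp: inj_on_def power2_eq_iff)
    show ?thesis
      using has_absolute_integral_change_of_variables_real[OF _ d i, of f b] by (simp only: img) simp
  qed
  have eq: "\<bar>t / 2\<bar> *\<^sub>R f (t\<^sup>2 / 4) = of_real (t / 2) * f (t\<^sup>2 / 4)" if "t \<in> {0<..}" for t
    using that by (simp add: scaleR_conv_of_real)
  have i: "(\<lambda>t. \<bar>t / 2\<bar> *\<^sub>R f (t\<^sup>2 / 4)) absolutely_integrable_on {0<..} \<longleftrightarrow> (\<lambda>t. of_real (t / 2) * f (t\<^sup>2 / 4)) absolutely_integrable_on {0<..}"
    by (rule set_integrable_cong[OF refl refl eq])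
  have v: "integral {0<..} (\<lambda>t. \<bar>t / 2\<bar> *\<^sub>R f (t\<^sup>2 / 4)) = integral {0<..} (\<lambda>t. of_real (t / 2) * f (t\<^sup>2 / 4))"
    by (rule integral_cong[OF eq])
  show ?A using cv i by blast
  show "f absolutely_integrable_on {0<..} \<Longrightarrow> integral {0<..} (\<lambda>t. of_real (t / 2) * f (t\<^sup>2 / 4)) = integral {0<..} f"
    using cv v by metis
qed

lemma of_real_quarter_square_powr:
  assumes "t > 0"
  shows "complex_of_real (t\<^sup>2 / 4) powr c = (of_real t / 2) powr (2 * c)"
proof -
  have "ln (t\<^sup>2 / 4) = 2 * ln (t / 2)"
    using assms by (simp add: ln_div ln_realpow ln_powr[of 2 2, symmetric])
  thus ?thesis
    using assms powr_of_real_exp[of "t\<^sup>2 / 4" c] powr_of_real_exp[of "t / 2" "2 * c"] by (simp add: mult_ac)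
qed

lemma of_real_half_powr:
  assumes "t > 0"
  shows "(complex_of_real t / 2) powr c = of_real t powr c * 2 powr (- c)"
proof -
  have "complex_of_real (t / 2) powr c = exp (c * of_real (ln t) + (- c) * of_real (ln 2))"
    using powr_of_real_exp[of "t / 2" c] assms by (simp add: ln_div algebra_simps del: of_real_divide)
  also have "\<dots> = exp (c * of_real (ln t)) * exp ((- c) * of_real (ln 2))" by (rule exp_add)
  also have "\<dots> = of_real t powr c * of_real 2 powr (- c)"
    using assms by (simp only: powr_of_real_exp[of t c] powr_of_real_exp[of 2 "- c"] zero_less_numeral)
  finally show ?thesis by simp
qed

lemma kk_t_integrable:
  assumes a: "Re a + 1 > \<bar>Re \<nu>\<bar>"
  shows "(\<lambda>t. of_real t powr a * kk \<nu> (t\<^sup>2 / 4)) absolutely_integrable_on {0<..}"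
proof -
  define w where "w = (a + 1) / 2"
  have "(\<lambda>y. of_real y powr (w - 1) * kk \<nu> y) absolutely_integrable_on {0<..}"
    by (rule kk_Mellin(1)) (use a in \<open>simp add: w_def\<close>)
  hence "(\<lambda>t. of_real (t / 2) * (of_real (t\<^sup>2 / 4) powr (w - 1) * kk \<nu> (t\<^sup>2 / 4))) absolutely_integrable_on {0<..}"
    by (subst quarter_square_substitution(1))
  hence "(\<lambda>t. 2 powr a * (of_real (t / 2) * (of_real (t\<^sup>2 / 4) powr (w - 1) * kk \<nu> (t\<^sup>2 / 4)))) absolutely_integrable_on {0<..}"
    by (rule set_integrable_mult_right)
  moreover have "2 powr a * (of_real (t / 2) * (of_real (t\<^sup>2 / 4) powr (w - 1) * kk \<nu> (t\<^sup>2 / 4))) = of_real t powr a * kk \<nu> (t\<^sup>2 / 4)"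
    if "t \<in> {0<..}" for t
  proof -
    have t: "t > 0" using that by simp
    have "of_real (t / 2) * complex_of_real (t\<^sup>2 / 4) powr (w - 1) = (of_real t / 2) powr 1 * (of_real t / 2) powr (2 * (w - 1))"
      unfolding of_real_quarter_square_powr[OF t] using t by simp
    also have "\<dots> = (of_real t / 2) powr a"
    proof -
      have "1 + 2 * (w - 1) = a" by (simp add: w_def field_simps)
      thus ?thesis by (simp only: powr_add[symmetric])
    qed
    also have "\<dots> = of_real t powr a * 2 powr (- a)" by (rule of_real_half_powr[OF t])
    finally have "2 powr a * (of_real (t / 2) * complex_of_real (t\<^sup>2 / 4) powr (w - 1)) = of_real t powr a * (2 powr a * 2 powr (- a))"
      by simp
    also have "2 powr a * 2 powr (- a) = (1 :: complex)" by (simp add: powr_add[symmetric] del: powr_add)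
    finally show ?thesis by (simp add: mult.assoc[symmetric])
  qed
  ultimately show ?thesis
    by (rule set_integrable_cong[THEN iffD1, OF refl refl, rotated])
qed

text \<open>z^2 + t^2 = (z + \<i> t) (z - \<i> t), and both factors have real part Re z. The bound
  is free of t and serves integrability and dominated convergence alike.\<close>

lemma one_plus_square_bound:
  assumes z: "Re z > 0"
  shows "norm (1 / (1 + (complex_of_real t / z)\<^sup>2)) \<le> (norm z)\<^sup>2 / (Re z)\<^sup>2" and "1 + (complex_of_real t / z)\<^sup>2 \<noteq> 0"
proof -
  have z0: "z \<noteq> 0" using z by auto
  have "norm (z + \<i> * of_real t) \<ge> Re z" "norm (z - \<i> * of_real t) \<ge> Re z"
    using complex_Re_le_cmod[of "z + \<i> * of_real t"] complex_Re_le_cmod[of "z - \<i> * of_real t"] by simp_all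
  hence "Re z * Re z \<le> norm (z + \<i> * of_real t) * norm (z - \<i> * of_real t)"
    using z by (intro mult_mono) auto
  also have "\<dots> = norm (z\<^sup>2 + (of_real t)\<^sup>2)"
    by (simp add: norm_mult[symmetric] power2_eq_square algebra_simps)
  finally have b: "(Re z)\<^sup>2 \<le> norm (z\<^sup>2 + (of_real t)\<^sup>2)" by (simp add: power2_eq_square)
  have pos: "(Re z)\<^sup>2 > 0" using z by simp
  hence nz: "z\<^sup>2 + (of_real t)\<^sup>2 \<noteq> 0" using b by auto
  have eq: "1 + (complex_of_real t / z)\<^sup>2 = (z\<^sup>2 + (of_real t)\<^sup>2) / z\<^sup>2"
    using z0 by (simp add: power_divide add_divide_distrib)
  show "1 + (complex_of_real t / z)\<^sup>2 \<noteq> 0" unfolding eq using nz z0 by simp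
  have "norm (1 / (1 + (complex_of_real t / z)\<^sup>2)) = (norm z)\<^sup>2 / norm (z\<^sup>2 + (of_real t)\<^sup>2)"
    unfolding eq by (simp add: norm_divide norm_power)
  also have "\<dots> \<le> (norm z)\<^sup>2 / (Re z)\<^sup>2"
    using b pos nz by (intro divide_left_mono mult_pos_pos) auto
  finally show "norm (1 / (1 + (complex_of_real t / z)\<^sup>2)) \<le> (norm z)\<^sup>2 / (Re z)\<^sup>2" .
qed

lemma kint_integrable:
  assumes z: "Re z > 0" and a: "Re a + 1 > \<bar>Re \<nu>\<bar>"
  shows "(\<lambda>t. of_real t powr a * kk \<nu> (t\<^sup>2 / 4) / (1 + (of_real t / z)\<^sup>2)) absolutely_integrable_on {0<..}"
proof -
  have "(\<lambda>t. (1 / (1 + (of_real t / z)\<^sup>2)) * (of_real t powr a * kk \<nu> (t\<^sup>2 / 4))) absolutely_integrable_on {0<..}"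
  proof (rule absolutely_integrable_mult_bounded[OF kk_t_integrable[OF a]])
    show "continuous_on {0<..} (\<lambda>t. 1 / (1 + (complex_of_real t / z)\<^sup>2))"
      using one_plus_square_bound(2)[OF z] z by (intro continuous_intros) auto
  qed (use one_plus_square_bound(1)[OF z] in auto)
  thus ?thesis by simp
qed

text \<open>The substitution y = t^2 / 4: the power t^a contributes 2^a, and z^2 / (z^2 + t^2)
  contributes z^2 / 4, whence the factor z^2 2^(a - 2).\<close>

lemma kint_stieltjes:
  assumes z: "Re z > 0" and a: "Re a + 1 > \<bar>Re \<nu>\<bar>"
  shows "kint z a \<nu> = z\<^sup>2 * 2 powr (a - 2) * integral {0<..} (\<lambda>y. of_real y powr ((a + 1) / 2 - 1) * kk \<nu> y / (of_real y + (z / 2)\<^sup>2))"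
proof -
  define f where "f y = of_real y powr ((a + 1) / 2 - 1) * kk \<nu> y / (of_real y + (z / 2)\<^sup>2)" for y
  have z0: "z \<noteq> 0" using z by auto
  have eq: "of_real t powr a * kk \<nu> (t\<^sup>2 / 4) / (1 + (of_real t / z)\<^sup>2) = (z\<^sup>2 * 2 powr (a - 2)) * (of_real (t / 2) * f (t\<^sup>2 / 4))"
    if "t \<in> {0<..}" for t
  proof -
    have t: "t > 0" using that by simp
    have "of_real (t / 2) * complex_of_real (t\<^sup>2 / 4) powr ((a + 1) / 2 - 1) = (of_real t / 2) powr 1 * (of_real t / 2) powr (2 * ((a + 1) / 2 - 1))"
      unfolding of_real_quarter_square_powr[OF t] using t by simp
    also have "\<dots> = (of_real t / 2) powr a"
    proof -
      have "1 + 2 * ((a + 1) / 2 - 1) = a" by (simp add: field_simps)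
      thus ?thesis by (simp only: powr_add[symmetric])
    qed
    also have "\<dots> = of_real t powr a * 2 powr (- a)" by (rule of_real_half_powr[OF t])
    finally have 1: "of_real (t / 2) * complex_of_real (t\<^sup>2 / 4) powr ((a + 1) / 2 - 1) = of_real t powr a * 2 powr (- a)" .
    have 2: "2 powr (a - 2) * 2 powr (- a) = (1 / 4 :: complex)"
    proof -
      have "2 powr (a - 2) * 2 powr (- a) = (2::complex) powr (- 2)" by (subst powr_add[symmetric]) simp
      also have "\<dots> = inverse (2 powr 2)" by (rule powr_minus)
      also have "(2::complex) powr 2 = 4" using powr_nat[of "2::complex" 2] by simp
      finally show ?thesis by simp
    qed
    have nz: "1 + (complex_of_real t / z)\<^sup>2 \<noteq> 0" by (rule one_plus_square_bound(2)[OF z])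
    have 3: "complex_of_real (t\<^sup>2 / 4) + (z / 2)\<^sup>2 = (z\<^sup>2 / 4) * (1 + (of_real t / z)\<^sup>2)"
      using z0 by (simp add: power_divide field_simps)
    have "(z\<^sup>2 * 2 powr (a - 2)) * (of_real (t / 2) * f (t\<^sup>2 / 4)) = 
       z\<^sup>2 * (2 powr (a - 2) * (of_real (t / 2) * complex_of_real (t\<^sup>2 / 4) powr ((a + 1) / 2 - 1))) * kk \<nu> (t\<^sup>2 / 4) / (complex_of_real (t\<^sup>2 / 4) + (z / 2)\<^sup>2)"
      by (simp add: f_def)
    also have "2 powr (a - 2) * (of_real (t / 2) * complex_of_real (t\<^sup>2 / 4) powr ((a + 1) / 2 - 1)) = of_real t powr a * (2 powr (a - 2) * 2 powr (- a))"
      unfolding 1 by simp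
    finally have F: "(z\<^sup>2 * 2 powr (a - 2)) * (of_real (t / 2) * f (t\<^sup>2 / 4)) = 
       z\<^sup>2 * (of_real t powr a * (2 powr (a - 2) * 2 powr (- a))) * kk \<nu> (t\<^sup>2 / 4) / (complex_of_real (t\<^sup>2 / 4) + (z / 2)\<^sup>2)" .
    have gen: "q * (A * (1 / 4)) * K / (q / 4 * X) = A * K / X" if "q \<noteq> 0" for q A K X :: complex
      using that by simp
    show ?thesis using F unfolding 2 3 gen[OF power_not_zero[OF z0]] by (rule sym)
  qed
  have "(\<lambda>t. (1 / (z\<^sup>2 * 2 powr (a - 2))) * (of_real t powr a * kk \<nu> (t\<^sup>2 / 4) / (1 + (of_real t / z)\<^sup>2))) absolutely_integrable_on {0<..}"
    by (rule set_integrable_mult_right[OF kint_integrable[OF z a]])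
  moreover have "(1 / (z\<^sup>2 * 2 powr (a - 2))) * (of_real t powr a * kk \<nu> (t\<^sup>2 / 4) / (1 + (of_real t / z)\<^sup>2)) = of_real (t / 2) * f (t\<^sup>2 / 4)"
    if "t \<in> {0<..}" for t
    unfolding eq[OF that] using z0 by simp
  ultimately have "(\<lambda>t. of_real (t / 2) * f (t\<^sup>2 / 4)) absolutely_integrable_on {0<..}"
    by (rule set_integrable_cong[THEN iffD1, OF refl refl, rotated])
  hence f: "f absolutely_integrable_on {0<..}" by (simp only: quarter_square_substitution(1))
  have "kint z a \<nu> = integral {0<..} (\<lambda>t. (z\<^sup>2 * 2 powr (a - 2)) * (of_real (t / 2) * f (t\<^sup>2 / 4)))"
    unfolding kint_def by (rule integral_cong[OF eq])
  also have "\<dots> = (z\<^sup>2 * 2 powr (a - 2)) * integral {0<..} f"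
    by (subst integral_mult_right) (simp only: quarter_square_substitution(2)[OF f])
  finally show ?thesis by (simp add: f_def[abs_def])
qed

lemma double_powr: "z \<noteq> 0 \<Longrightarrow> z powr c = 2 powr c * (z / 2) powr c" for z c :: complex
proof -
  assume z: "z \<noteq> 0"
  have "Ln (of_real 2 * (z / 2)) = of_real (ln 2) + Ln (z / 2)"
    using z Ln_times_of_real[of 2 "z / 2"] by (simp add: Ln_of_real[of 2, simplified])
  hence "Ln z = of_real (ln 2) + Ln (z / 2)" by simp
  moreover have "(2::complex) powr c = exp (c * of_real (ln 2))" using powr_of_real_exp[of 2 c] by simp
  ultimately show ?thesis using z by (simp add: powr_def distrib_left exp_add)
qed

lemma rGamma_reflect: "of_real pi * rGamma x = Gamma (1 - x) * sin (of_real pi * x)" if "x \<notin> \<int>" for x :: complex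
proof -
  have "sin (x * of_real pi) \<noteq> 0" by (rule sin_pi_nonint[OF that])
  moreover have "Gamma x \<noteq> 0" using that by (metis Gamma_eq_zero_iff nonpos_Ints_Int)
  moreover have "Gamma x * Gamma (1 - x) = of_real pi / sin (of_real pi * x)" by (rule Gamma_reflection_complex)
  ultimately show ?thesis by (simp add: rGamma_inverse_Gamma field_simps)
qed

lemma sin_shift_nat: "sin (of_real pi * (x + of_nat k)) = (- 1) ^ k * sin (of_real pi * x)" for x :: complex
proof (induction k)
  case (Suc k)
  have "sin (of_real pi * (x + of_nat (Suc k))) = sin (of_real pi * (x + of_nat k) + of_real pi)"
    by (simp add: algebra_simps)
  also have "\<dots> = - sin (of_real pi * (x + of_nat k))" by (simp add: sin_add)
  finally show ?case using Suc by simp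
qed simp

text \<open>The reflection formula in S1 contributes (-1)^k, which turns the series of the modified
  Bessel functions inside \<open>kk\<close> into the alternating series of \<open>besselJ\<close>.
  In S2 the signs of the two descending Gamma factors cancel, and the powers of -\<zeta>
  remain.\<close>

lemma stieltjes_kk_closed:
  assumes \<nu>: "\<nu> \<notin> \<int>" and z: "Re z > 0"
    and b: "Re b > \<bar>Re \<nu>\<bar> / 2" "Re (b + \<nu> / 2) \<notin> \<int>" "Re (b - \<nu> / 2) \<notin> \<int>"
  shows "integral {0<..} (\<lambda>y. of_real y powr (b - 1) * kk \<nu> y / (of_real y + (z / 2)\<^sup>2)) =
     of_real pi ^ 2 / (2 * sin (\<nu> * of_real pi)) * (z / 2) powr (2 * b - 2) *
       (besselJ (- \<nu>) z / sin (of_real pi * (b - \<nu> / 2)) - besselJ \<nu> z / sin (of_real pi * (b + \<nu> / 2)))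
     + Gamma (b - 1 + \<nu> / 2) * Gamma (b - 1 - \<nu> / 2) / 2 * hyp1F2 1 (2 - b - \<nu> / 2) (2 - b + \<nu> / 2) (- ((z / 2)\<^sup>2))"
proof -
  let ?\<zeta> = "(z / 2)\<^sup>2"
  have w: "Re (z / 2) > 0" "z / 2 \<noteq> 0" using z by auto
  have nonint: "v \<notin> \<int>" if "Re v \<notin> \<int>" for v :: complex
    using that by (auto elim!: Ints_cases)
  have b': "b + \<nu> / 2 \<notin> \<int>" "b - \<nu> / 2 \<notin> \<int>" using b nonint by blast+
  have bs: "b + signed_order c \<nu> / 2 \<notin> \<int>" for c using b' by (auto simp: signed_order_def)
  define S1 where "S1 i = kc \<nu> i * (Gamma (1 - (kp \<nu> i + b)) * Gamma (kp \<nu> i + b) * ?\<zeta> powr (kp \<nu> i + b - 1))" for i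
  define S2 where "S2 j = (- ?\<zeta>) ^ j * (Gamma (b - 1 - of_nat j + \<nu> / 2) * Gamma (b - 1 - of_nat j - \<nu> / 2) / 2)" for j
  note SK = stieltjes_kk[OF \<nu> square_not_nonpos_Reals[OF w(1)] b, folded S1_def[abs_def] S2_def[abs_def]]
  let ?s = "\<lambda>c. (if c then - 1 else 1) * (of_real pi / (2 * sin (\<nu> * of_real pi)))"
  have half: "((\<lambda>k. S1 (c, k)) has_sum (?s c * (of_real pi / sin (of_real pi * (b + signed_order c \<nu> / 2))) * (z / 2) powr (2 * b - 2) * besselJ (signed_order c \<nu>) z)) UNIV" for c
  proof -
    have "((\<lambda>k. (?s c * (of_real pi / sin (of_real pi * (b + signed_order c \<nu> / 2))) * (z / 2) powr (2 * b - 2) * (z / 2) powr signed_order c \<nu>) *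
         ((- ?\<zeta>) ^ k / of_nat (fact k) * rGamma (signed_order c \<nu> + of_nat k + 1))) has_sum
         ((?s c * (of_real pi / sin (of_real pi * (b + signed_order c \<nu> / 2))) * (z / 2) powr (2 * b - 2) * (z / 2) powr signed_order c \<nu>) * bsum (signed_order c \<nu>) (- ?\<zeta>))) UNIV"
      by (intro has_sum_cmult_right bsum_has_sum signed_order_nonint \<nu>)
    moreover have "(?s c * (of_real pi / sin (of_real pi * (b + signed_order c \<nu> / 2))) * (z / 2) powr (2 * b - 2) * (z / 2) powr signed_order c \<nu>) *
         ((- ?\<zeta>) ^ k / of_nat (fact k) * rGamma (signed_order c \<nu> + of_nat k + 1)) = S1 (c, k)" for k
    proof -
      let ?x = "b + signed_order c \<nu> / 2"
      have p: "kp \<nu> (c, k) + b = ?x + of_nat k" by (simp add: kp_def)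
      have G: "Gamma (1 - (?x + of_nat k)) * Gamma (?x + of_nat k) = of_real pi / ((- 1) ^ k * sin (of_real pi * ?x))"
        using Gamma_reflection_complex[of "?x + of_nat k"] by (simp add: sin_shift_nat mult.commute)
      have P: "?\<zeta> powr (?x + of_nat k - 1) = (z / 2) powr (2 * b - 2) * (z / 2) powr signed_order c \<nu> * ?\<zeta> ^ k"
      proof -
        have "?\<zeta> powr (?x + of_nat k - 1) = (z / 2) powr ((2 * b - 2) + signed_order c \<nu> + of_nat (2 * k))"
          unfolding powr_square_right_half[OF w(1)] by (simp add: algebra_simps)
        also have "\<dots> = (z / 2) powr (2 * b - 2) * (z / 2) powr signed_order c \<nu> * (z / 2) powr of_nat (2 * k)"
          by (simp only: powr_add)
        also have "(z / 2) powr of_nat (2 * k) = ?\<zeta> ^ k"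
          using w(2) by (simp only: powr_nat power_mult) auto
        finally show ?thesis .
      qed
      have sg: "(- ?\<zeta>) ^ k = ?\<zeta> ^ k / (- 1) ^ k" by (cases "even k") simp_all
      show ?thesis
        unfolding S1_def p G P kc_bessel[OF \<nu>] sg by (cases c) (simp_all add: mult_ac)
    qed
    ultimately show ?thesis by (simp add: besselJ_bsum mult.assoc)
  qed
  have 1: "infsum S1 UNIV = ?s True * (of_real pi / sin (of_real pi * (b + \<nu> / 2))) * (z / 2) powr (2 * b - 2) * besselJ \<nu> z +
      ?s False * (of_real pi / sin (of_real pi * (b - \<nu> / 2))) * (z / 2) powr (2 * b - 2) * besselJ (- \<nu>) z"
    using infsumI[OF has_sum_bool_times[OF half half]] by (simp add: signed_order_def)
  have S2: "S2 j = Gamma (b - 1 + \<nu> / 2) * Gamma (b - 1 - \<nu> / 2) / 2 * hyp_term (2 - b - \<nu> / 2) (2 - b + \<nu> / 2) (- ?\<zeta>) j" for j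
  proof -
    have c: "b - 1 + \<nu> / 2 \<notin> \<int>" "b - 1 - \<nu> / 2 \<notin> \<int>"
      using b' Int_shift_iff[of "b - 1 + \<nu> / 2" 1] Int_shift_iff[of "b - 1 - \<nu> / 2" 1] by (simp_all add: algebra_simps)
    have e: "b - 1 - of_nat j + \<nu> / 2 = (b - 1 + \<nu> / 2) - of_nat j" "b - 1 - of_nat j - \<nu> / 2 = (b - 1 - \<nu> / 2) - of_nat j"
      "1 - (b - 1 + \<nu> / 2) = 2 - b - \<nu> / 2" "1 - (b - 1 - \<nu> / 2) = 2 - b + \<nu> / 2" by simp_all
    show ?thesis
      unfolding S2_def hyp_term_def e(1,2) Gamma_pochhammer_down[OF c(1)] Gamma_pochhammer_down[OF c(2)] e(3,4)
      by (cases "even j") (simp_all add: mult_ac)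
  qed
  have "(S2 has_sum infsum S2 UNIV) UNIV" using SK(2) by simp
  hence "S2 sums infsum S2 UNIV" by (rule has_sum_imp_sums)
  hence "infsum S2 UNIV = (\<Sum>j. S2 j)" by (simp add: sums_iff)
  also have "\<dots> = Gamma (b - 1 + \<nu> / 2) * Gamma (b - 1 - \<nu> / 2) / 2 * (\<Sum>j. hyp_term (2 - b - \<nu> / 2) (2 - b + \<nu> / 2) (- ?\<zeta>) j)"
    unfolding S2 by (rule suminf_mult[OF hyp_term_summable])
  finally have 2: "infsum S2 UNIV = Gamma (b - 1 + \<nu> / 2) * Gamma (b - 1 - \<nu> / 2) / 2 * hyp1F2 1 (2 - b - \<nu> / 2) (2 - b + \<nu> / 2) (- ?\<zeta>)"
    by (simp add: hyp1F2_1)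
  show ?thesis
    unfolding SK(1) 1 2 by (simp add: algebra_simps power2_eq_square)
qed

section \<open>The expansion for generic parameters\<close>

text \<open>\<open>rGamma\<close> in place of 1 / Gamma makes the right-hand side continuous in both
  parameters, also where a Gamma function in the denominator has a pole.\<close>

definition lommel_expansion :: "nat \<Rightarrow> complex \<Rightarrow> complex \<Rightarrow> complex \<Rightarrow> complex" where
  "lommel_expansion N z \<mu> \<nu> = z powr (\<mu> - 1) * (\<Sum>n<N. (-1) ^ n * lommel_a n (-\<mu>) \<nu> / z ^ (2 * n)) +
     (-1) ^ N * 2 powr (\<mu> + 1) * z powr (\<mu> - 2 * of_nat N - 1) *
       (rGamma ((\<nu> - \<mu> + 1) / 2) * rGamma ((1 - \<mu> - \<nu>) / 2)) * kint z (2 * of_nat N - \<mu>) \<nu>"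

lemma lommel_expansion_0:
  assumes \<nu>: "\<nu> \<notin> \<int>" and z: "Re z > 0" and \<mu>: "Re \<mu> + \<bar>Re \<nu>\<bar> < 1"
    and gen: "Re ((\<nu> - \<mu> + 1) / 2) \<notin> \<int>" "Re ((1 - \<mu> - \<nu>) / 2) \<notin> \<int>"
  shows "lommel_S_formula \<mu> \<nu> z = lommel_expansion 0 z \<mu> \<nu>"
proof -
  have z0: "z \<noteq> 0" using z by auto
  define b where "b = (1 - \<mu>) / 2"
  define x1 where "x1 = b + \<nu> / 2"
  define x2 where "x2 = b - \<nu> / 2"
  have x1': "(\<nu> - \<mu> + 1) / 2 = x1" and x2': "(1 - \<mu> - \<nu>) / 2 = x2" by (simp_all add: x1_def x2_def b_def field_simps)
  have nonint: "v \<notin> \<int>" if "Re v \<notin> \<int>" for v :: complex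
    using that by (auto elim!: Ints_cases)
  have ni: "x1 \<notin> \<int>" "x2 \<notin> \<int>" using gen nonint unfolding x1' x2' by blast+
  have ni1: "x1 - 1 \<notin> \<int>" "x2 - 1 \<notin> \<int>"
    using ni Int_shift_iff[of "x1 - 1" 1] Int_shift_iff[of "x2 - 1" 1] by simp_all
  have Gne: "Gamma x \<noteq> 0" if "x \<notin> \<int>" for x :: complex using that by (metis Gamma_eq_zero_iff nonpos_Ints_Int)
  \<comment> \<open>Applied to x1 and x2 this leaves 1 / ((x1 - 1) (x2 - 1)), which is 4 / ((\<mu> +
    1)^2 - \<nu>^2): the source of the leading coefficient of \<open>lommel_s\<close>.\<close>
  have rG: "rGamma x * Gamma (x - 1) = 1 / (x - 1)" if "x \<notin> \<int>" "x - 1 \<notin> \<int>" for x :: complex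
  proof -
    have "Gamma (x - 1 + 1) = (x - 1) * Gamma (x - 1)"
      using that by (intro Gamma_plus1) (use nonpos_Ints_Int in blast)
    hence G: "Gamma x = (x - 1) * Gamma (x - 1)" by simp
    show ?thesis unfolding rGamma_inverse_Gamma G using Gne[OF that(2)] by (simp add: divide_inverse)
  qed
  let ?F = "hyp1F2 1 ((\<mu> - \<nu> + 3) / 2) ((\<mu> + \<nu> + 3) / 2) (- (z\<^sup>2) / 4)"
  have hyp: "hyp1F2 1 (2 - b - \<nu> / 2) (2 - b + \<nu> / 2) (- ((z / 2)\<^sup>2)) = ?F"
  proof -
    have "2 - b - \<nu> / 2 = (\<mu> - \<nu> + 3) / 2" "2 - b + \<nu> / 2 = (\<mu> + \<nu> + 3) / 2" "- ((z / 2)\<^sup>2) = - (z\<^sup>2) / 4"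
      by (simp_all add: b_def power_divide field_simps)
    thus ?thesis by (simp only:)
  qed
  define sn where "sn = sin (\<nu> * of_real pi)"
  have sn: "sn \<noteq> 0" unfolding sn_def by (rule sin_pi_nonint[OF \<nu>])
  define s1 where "s1 = sin (of_real pi * x1)"
  define s2 where "s2 = sin (of_real pi * x2)"
  have s12: "s1 \<noteq> 0" "s2 \<noteq> 0"
    using sin_pi_nonint[OF ni(1)] sin_pi_nonint[OF ni(2)] by (simp_all add: s1_def s2_def mult.commute)
  define \<theta> where "\<theta> = (\<mu> - \<nu>) * of_real pi / 2"
  \<comment> \<open>The sines of the reflection formula in terms of \<theta> and \<nu>; with them Jm
    s1 - Jp s2, divided by sn, becomes the combination of J and Y in the formula for S.\<close>
  have c1: "s1 = cos \<theta>" and c2: "s2 = cos \<theta> * cos (\<nu> * of_real pi) - sin \<theta> * sn"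
  proof -
    have "of_real pi * x1 = of_real pi / 2 - \<theta>" by (simp add: x1_def b_def \<theta>_def field_simps)
    thus "s1 = cos \<theta>" by (simp add: s1_def sin_diff flip: of_real_divide sin_of_real cos_of_real)
    have "of_real pi * x2 = of_real pi / 2 - (\<theta> + \<nu> * of_real pi)" by (simp add: x2_def b_def \<theta>_def field_simps)
    hence "s2 = cos (\<theta> + \<nu> * of_real pi)" by (simp add: s2_def sin_diff flip: of_real_divide sin_of_real cos_of_real)
    thus "s2 = cos \<theta> * cos (\<nu> * of_real pi) - sin \<theta> * sn" by (simp add: cos_add sn_def)
  qed
  have g1: "1 - x1 = (\<mu> - \<nu> + 1) / 2" and g2: "1 - x2 = (\<mu> + \<nu> + 1) / 2"
    by (simp_all add: x1_def x2_def b_def field_simps)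
  define G1 where "G1 = Gamma ((\<mu> - \<nu> + 1) / 2)"
  define G2 where "G2 = Gamma ((\<mu> + \<nu> + 1) / 2)"
  \<comment> \<open>The factor pi^2 of A1 is spent on these two reflections, which turn the
    reciprocal Gamma factors into the Gamma factors of the formula for S.\<close>
  have R: "of_real pi * rGamma x1 = G1 * s1" "of_real pi * rGamma x2 = G2 * s2"
    using rGamma_reflect[OF ni(1)] rGamma_reflect[OF ni(2)] by (simp_all add: g1 g2 G1_def G2_def s1_def s2_def)
  define Jp where "Jp = besselJ \<nu> z"
  define Jm where "Jm = besselJ (- \<nu>) z"
  define A1 where "A1 = of_real pi ^ 2 / (2 * sn) * (z / 2) powr (- \<mu> - 1) * (Jm / s2 - Jp / s1)"
  define A2 where "A2 = Gamma (x1 - 1) * Gamma (x2 - 1) / 2 * ?F"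
  have "kint z (- \<mu>) \<nu> = z\<^sup>2 * 2 powr (- \<mu> - 2) * integral {0<..} (\<lambda>y. of_real y powr ((- \<mu> + 1) / 2 - 1) * kk \<nu> y / (of_real y + (z / 2)\<^sup>2))"
    by (rule kint_stieltjes[OF z]) (use \<mu> in simp)
  also have "(- \<mu> + 1) / 2 = b" by (simp add: b_def)
  also have "integral {0<..} (\<lambda>y. of_real y powr (b - 1) * kk \<nu> y / (of_real y + (z / 2)\<^sup>2)) = A1 + A2"
  proof -
    have e: "2 * b - 2 = - \<mu> - 1" "b - 1 + \<nu> / 2 = x1 - 1" "b - 1 - \<nu> / 2 = x2 - 1" "b + \<nu> / 2 = x1" "b - \<nu> / 2 = x2"
      by (simp_all add: x1_def x2_def b_def field_simps)
    have c: "Re b > \<bar>Re \<nu>\<bar> / 2" using \<mu> by (simp add: b_def)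
    have "Re (b + \<nu> / 2) \<notin> \<int>" "Re (b - \<nu> / 2) \<notin> \<int>" using gen unfolding x1' x2' e by blast+
    from stieltjes_kk_closed[OF \<nu> z c this] show ?thesis
      unfolding e hyp A1_def A2_def sn_def s1_def s2_def Jp_def Jm_def .
  qed
  finally have K: "kint z (- \<mu>) \<nu> = z\<^sup>2 * 2 powr (- \<mu> - 2) * (A1 + A2)" .
  have p1: "z powr (\<mu> - 1) * z\<^sup>2 = z powr (\<mu> + 1)"
    using powr_add[of z "\<mu> - 1" 2] powr_nat[of z 2] z0 by (simp add: add.commute)
  have p2: "2 powr (\<mu> + 1) * 2 powr (- \<mu> - 2) = (1 / 2 :: complex)"
  proof -
    have "2 powr (\<mu> + 1) * 2 powr (- \<mu> - 2) = (2::complex) powr (- 1)" by (subst powr_add[symmetric]) simp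
    thus ?thesis by (simp add: powr_minus)
  qed
  have p3: "z powr (\<mu> + 1) * (z / 2) powr (- \<mu> - 1) = 2 powr (\<mu> + 1)"
  proof -
    have "(z / 2) powr (\<mu> + 1) * (z / 2) powr (- \<mu> - 1) = 1" using z0 by (subst powr_add[symmetric]) simp
    thus ?thesis unfolding double_powr[OF z0, of "\<mu> + 1"] by (simp add: mult.assoc)
  qed
  have p4: "(2::complex) powr (\<mu> + 1) = 4 * 2 powr (\<mu> - 1)"
    using powr_add[of "2::complex" 2 "\<mu> - 1"] powr_nat[of "2::complex" 2] by (simp add: add.commute)
  have "lommel_expansion 0 z \<mu> \<nu> = (2 powr (\<mu> + 1) * 2 powr (- \<mu> - 2)) * (z powr (\<mu> - 1) * z\<^sup>2) * (rGamma x1 * rGamma x2) * (A1 + A2)"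
    by (simp add: lommel_expansion_def x1' x2' K)
  also have "\<dots> = 1 / 2 * z powr (\<mu> + 1) * (rGamma x1 * rGamma x2) * (A1 + A2)"
    unfolding p1 p2 by simp
  also have "\<dots> = 1 / 2 * z powr (\<mu> + 1) * (rGamma x1 * rGamma x2) * A1 + 1 / 2 * z powr (\<mu> + 1) * (rGamma x1 * rGamma x2) * A2"
    by (rule distrib_left)
  also have "1 / 2 * z powr (\<mu> + 1) * (rGamma x1 * rGamma x2) * A2 = 1 / 4 * z powr (\<mu> + 1) * ((rGamma x1 * Gamma (x1 - 1)) * (rGamma x2 * Gamma (x2 - 1))) * ?F"
    by (simp add: A2_def)
  also have "\<dots> = z powr (\<mu> + 1) / (4 * ((x1 - 1) * (x2 - 1))) * ?F"
    unfolding rG[OF ni(1) ni1(1)] rG[OF ni(2) ni1(2)] by simp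
  also have "4 * ((x1 - 1) * (x2 - 1)) = (\<mu> + 1)\<^sup>2 - \<nu>\<^sup>2"
    by (simp add: x1_def x2_def b_def power2_eq_square field_simps)
  also have "z powr (\<mu> + 1) / ((\<mu> + 1)\<^sup>2 - \<nu>\<^sup>2) * ?F = lommel_s \<mu> \<nu> z"
    by (simp add: lommel_s_def)
  also have "1 / 2 * z powr (\<mu> + 1) * (rGamma x1 * rGamma x2) * A1 =
     1 / 4 * (z powr (\<mu> + 1) * (z / 2) powr (- \<mu> - 1)) * ((of_real pi * rGamma x1) * (of_real pi * rGamma x2)) / sn * (Jm / s2 - Jp / s1)"
    by (simp add: A1_def power2_eq_square)
  also have "\<dots> = 2 powr (\<mu> - 1) * G1 * G2 * ((s1 * s2) / sn * (Jm / s2 - Jp / s1))"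
    unfolding p3 R p4 by simp
  also have "(s1 * s2) / sn * (Jm / s2 - Jp / s1) = (Jm * s1 - Jp * s2) / sn"
    using s12 sn by (simp add: field_simps)
  also have "\<dots> = sin \<theta> * Jp - cos \<theta> * ((Jp * cos (\<nu> * of_real pi) - Jm) / sn)"
    unfolding c1 c2 using sn by (simp add: field_simps)
  also have "(Jp * cos (\<nu> * of_real pi) - Jm) / sn = besselY \<nu> z"
    using \<nu> by (simp add: besselY_def besselY_aux_def Jp_def Jm_def sn_def)
  finally show ?thesis
    by (simp add: lommel_S_formula_def G1_def G2_def Jp_def \<theta>_def add.commute)
qed

text \<open>For \<open>lommel_s\<close> this is the removal of the first term of the 1F2 series. In
  the Bessel part the Gamma factors give y1 y2, the power of 2 gives 4, and the shift of the angle
  by pi gives the sign; 4 y1 y2 equals (\<mu> + 1)^2 - \<nu>^2.\<close>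

lemma lommel_S_formula_step:
  assumes z: "z \<noteq> 0" and ni: "(\<mu> - \<nu> + 1) / 2 \<notin> \<int>" "(\<mu> + \<nu> + 1) / 2 \<notin> \<int>"
  shows "lommel_S_formula (\<mu> + 2) \<nu> z = z powr (\<mu> + 1) - ((\<mu> + 1)\<^sup>2 - \<nu>\<^sup>2) * lommel_S_formula \<mu> \<nu> z"
proof -
  define y1 where "y1 = (\<mu> - \<nu> + 1) / 2"
  define y2 where "y2 = (\<mu> + \<nu> + 1) / 2"
  have y: "y1 \<notin> \<int>" "y2 \<notin> \<int>" "y1 \<noteq> 0" "y2 \<noteq> 0" "y1 + 1 \<noteq> 0" "y2 + 1 \<noteq> 0"
  proof -
    show "y1 \<notin> \<int>" "y2 \<notin> \<int>" using ni by (simp_all add: y1_def y2_def)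
    hence "y1 + 1 \<notin> \<int>" "y2 + 1 \<notin> \<int>" using Int_shift_iff[of y1 1] Int_shift_iff[of y2 1] by simp_all
    with \<open>y1 \<notin> \<int>\<close> \<open>y2 \<notin> \<int>\<close> show "y1 \<noteq> 0" "y2 \<noteq> 0" "y1 + 1 \<noteq> 0" "y2 + 1 \<noteq> 0" by (metis Ints_0)+
  qed
  have e: "(\<mu> - \<nu> + 3) / 2 = y1 + 1" "(\<mu> + \<nu> + 3) / 2 = y2 + 1"
    "(\<mu> + 2 - \<nu> + 3) / 2 = y1 + 1 + 1" "(\<mu> + 2 + \<nu> + 3) / 2 = y2 + 1 + 1"
    "(\<mu> + 2 - \<nu> + 1) / 2 = y1 + 1" "(\<mu> + 2 + \<nu> + 1) / 2 = y2 + 1"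
    by (simp_all add: y1_def y2_def field_simps)
  have q: "(\<mu> + 1)\<^sup>2 - \<nu>\<^sup>2 = 4 * (y1 * y2)" "(\<mu> + 2 + 1)\<^sup>2 - \<nu>\<^sup>2 = 4 * ((y1 + 1) * (y2 + 1))"
    by (simp_all add: y1_def y2_def power2_eq_square field_simps)
  let ?x = "- (z\<^sup>2) / 4"
  have F: "hyp1F2 1 (y1 + 1) (y2 + 1) ?x = 1 + ?x / ((y1 + 1) * (y2 + 1)) * hyp1F2 1 (y1 + 1 + 1) (y2 + 1 + 1) ?x"
    by (rule hyp1F2_contiguous) (use y in auto)
  have p: "z powr (\<mu> + 2 + 1) = z powr (\<mu> + 1) * z\<^sup>2"
    using powr_add[of z "\<mu> + 1" 2] powr_nat[of z 2] z by (simp add: add_ac)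
  have s: "lommel_s (\<mu> + 2) \<nu> z = z powr (\<mu> + 1) - ((\<mu> + 1)\<^sup>2 - \<nu>\<^sup>2) * lommel_s \<mu> \<nu> z"
  proof -
    have gen: "P * r / (4 * (Y1 * Y2)) * H = P - (4 * (u * v)) * (P / (4 * (u * v)) * (1 + - r / 4 / (Y1 * Y2) * H))"
      if "u \<noteq> 0" "v \<noteq> 0" "Y1 \<noteq> 0" "Y2 \<noteq> 0" for P r Y1 Y2 H u v :: complex
      using that by (simp add: field_simps)
    show ?thesis unfolding lommel_s_def e q F p by (rule gen) (use y in auto)
  qed
  have G: "Gamma (y1 + 1) = y1 * Gamma y1" "Gamma (y2 + 1) = y2 * Gamma y2"
    using y by (auto intro!: Gamma_plus1 dest: nonpos_Ints_Int)
  have A: "(\<mu> + 2 - \<nu>) * of_real pi / 2 = (\<mu> - \<nu>) * of_real pi / 2 + of_real pi" by (simp add: field_simps)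
  have t: "sin ((\<mu> + 2 - \<nu>) * of_real pi / 2) = - sin ((\<mu> - \<nu>) * of_real pi / 2)"
     "cos ((\<mu> + 2 - \<nu>) * of_real pi / 2) = - cos ((\<mu> - \<nu>) * of_real pi / 2)"
    unfolding A by (simp_all add: sin_add cos_add)
  have p4: "(2::complex) powr (\<mu> + 2 - 1) = 4 * 2 powr (\<mu> - 1)"
    using powr_add[of "2::complex" 2 "\<mu> - 1"] powr_nat[of "2::complex" 2] by (simp add: algebra_simps)
  show ?thesis
    unfolding lommel_S_formula_def s e t p4 G q unfolding y1_def[symmetric] y2_def[symmetric]
    by (simp add: algebra_simps)
qed

lemma lommel_a_Suc: "lommel_a (Suc n) (- (\<mu> + 2)) \<nu> = ((\<mu> + 1)\<^sup>2 - \<nu>\<^sup>2) * lommel_a n (- \<mu>) \<nu>"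
proof -
  have "lommel_a (Suc n) (- (\<mu> + 2)) \<nu> = (\<Prod>k=0..n. (- (\<mu> + 2) + 2 * of_nat (Suc k) - 1)\<^sup>2 - \<nu>\<^sup>2)"
    unfolding lommel_a_def One_nat_def by (subst prod.shift_bounds_cl_Suc_ivl) simp
  also have "\<dots> = ((- (\<mu> + 2) + 2 * of_nat (Suc 0) - 1)\<^sup>2 - \<nu>\<^sup>2) * (\<Prod>k=Suc 0..n. (- (\<mu> + 2) + 2 * of_nat (Suc k) - 1)\<^sup>2 - \<nu>\<^sup>2)"
    by (rule prod.atLeast_Suc_atMost) simp
  also have "(- (\<mu> + 2) + 2 * of_nat (Suc 0) - 1)\<^sup>2 = (\<mu> + 1)\<^sup>2"
    by (simp add: power2_eq_square algebra_simps)
  also have "(\<Prod>k=Suc 0..n. (- (\<mu> + 2) + 2 * of_nat (Suc k) - 1)\<^sup>2 - \<nu>\<^sup>2) = lommel_a n (- \<mu>) \<nu>"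
    unfolding lommel_a_def by (intro prod.cong) (simp_all add: algebra_simps)
  finally show ?thesis .
qed

text \<open>The integral is the same on both sides, because 2 N - \<mu> does not change in the step;
  only its prefactor does, by the recurrence of \<open>rGamma\<close>. The new term n = 0 of the sum
  supplies the pure power of z.\<close>

lemma lommel_expansion_step:
  assumes z: "z \<noteq> 0"
  shows "lommel_expansion (Suc N) z (\<mu> + 2) \<nu> = z powr (\<mu> + 1) - ((\<mu> + 1)\<^sup>2 - \<nu>\<^sup>2) * lommel_expansion N z \<mu> \<nu>"
proof -
  define q where "q = (\<mu> + 1)\<^sup>2 - \<nu>\<^sup>2"
  let ?S = "\<Sum>n<N. (-1) ^ n * lommel_a n (-\<mu>) \<nu> / z ^ (2 * n)"
  have p: "z powr (\<mu> + 2 - 1) = z powr (\<mu> - 1) * z\<^sup>2"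
    using powr_add[of z "\<mu> - 1" 2] powr_nat[of z 2] z by (simp add: algebra_simps)
  have "(\<Sum>n<Suc N. (-1) ^ n * lommel_a n (- (\<mu> + 2)) \<nu> / z ^ (2 * n)) =
     (-1) ^ 0 * lommel_a 0 (- (\<mu> + 2)) \<nu> / z ^ (2 * 0) + (\<Sum>n<N. (-1) ^ Suc n * lommel_a (Suc n) (- (\<mu> + 2)) \<nu> / z ^ (2 * Suc n))"
    by (rule sum.lessThan_Suc_shift)
  also have "\<dots> = 1 + (\<Sum>n<N. (- q / z\<^sup>2) * ((-1) ^ n * lommel_a n (-\<mu>) \<nu> / z ^ (2 * n)))"
    unfolding lommel_a_Suc q_def[symmetric] by (simp add: lommel_a_def power2_eq_square mult_ac)
  also have "\<dots> = 1 + (- q / z\<^sup>2) * ?S" by (simp only: sum_distrib_left)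
  finally have s: "(\<Sum>n<Suc N. (-1) ^ n * lommel_a n (- (\<mu> + 2)) \<nu> / z ^ (2 * n)) = 1 + (- q / z\<^sup>2) * ?S" .
  define x1 where "x1 = (\<nu> - \<mu> + 1) / 2 - 1"
  define x2 where "x2 = (1 - \<mu> - \<nu>) / 2 - 1"
  have e: "(\<nu> - (\<mu> + 2) + 1) / 2 = x1" "(1 - (\<mu> + 2) - \<nu>) / 2 = x2" "(\<nu> - \<mu> + 1) / 2 = x1 + 1" "(1 - \<mu> - \<nu>) / 2 = x2 + 1"
    by (simp_all add: x1_def x2_def field_simps)
  have q: "q = 4 * (x1 * x2)" by (simp add: q_def x1_def x2_def power2_eq_square field_simps)
  have g: "rGamma x1 = x1 * rGamma (x1 + 1)" "rGamma x2 = x2 * rGamma (x2 + 1)" by (simp_all add: rGamma_plus1)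
  have a: "\<mu> + 2 - 2 * of_nat (Suc N) - 1 = \<mu> - 2 * of_nat N - 1" "2 * of_nat (Suc N) - (\<mu> + 2) = 2 * of_nat N - \<mu>" by simp_all
  have p4: "(2::complex) powr (\<mu> + 2 + 1) = 4 * 2 powr (\<mu> + 1)"
    using powr_add[of "2::complex" 2 "\<mu> + 1"] powr_nat[of "2::complex" 2] by (simp add: algebra_simps)
  have p': "z powr (\<mu> + 1) = z powr (\<mu> - 1) * z\<^sup>2"
    using powr_add[of z "\<mu> - 1" 2] powr_nat[of z 2] z by (simp add: algebra_simps)
  show ?thesis
    unfolding lommel_expansion_def s p a e p4 unfolding q_def[symmetric] p' g
    unfolding q using z by (simp add: field_simps)
qed

text \<open>The bound on Re \<mu> + \<bar>Re \<nu>\<bar> moves along with the step in N and \<mu>,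
  so N steps lead back to \<open>lommel_expansion_0\<close>.\<close>

lemma lommel_expansion_generic:
  assumes \<nu>: "\<nu> \<notin> \<int>" and z: "Re z > 0" and \<mu>: "Re \<mu> + \<bar>Re \<nu>\<bar> < 2 * real N + 1"
    and gen: "Re ((\<nu> - \<mu> + 1) / 2) \<notin> \<int>" "Re ((1 - \<mu> - \<nu>) / 2) \<notin> \<int>"
  shows "lommel_S_formula \<mu> \<nu> z = lommel_expansion N z \<mu> \<nu>"
  using \<mu> gen
proof (induction N arbitrary: \<mu>)
  case 0
  thus ?case by (intro lommel_expansion_0[OF \<nu> z]) auto
next
  case (Suc N)
  have z0: "z \<noteq> 0" using z by auto
  have nonint: "v \<notin> \<int>" if "Re v \<notin> \<int>" for v :: complex
    using that by (auto elim!: Ints_cases)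
  define m where "m = \<mu> - 2"
  have m: "\<mu> = m + 2" by (simp add: m_def)
  have e: "Re ((\<nu> - m + 1) / 2) = Re ((\<nu> - \<mu> + 1) / 2) + 1" "Re ((1 - m - \<nu>) / 2) = Re ((1 - \<mu> - \<nu>) / 2) + 1"
    by (simp_all add: m_def field_simps)
  have ni: "Re ((\<nu> - m + 1) / 2) \<notin> \<int>" "Re ((1 - m - \<nu>) / 2) \<notin> \<int>"
    unfolding e using Suc.prems(2,3) by (metis Ints_1 Ints_diff add_diff_cancel_right')+
  have "(m - \<nu> + 1) / 2 = 1 - (\<nu> - m + 1) / 2" "(m + \<nu> + 1) / 2 = 1 - (1 - m - \<nu>) / 2"
    by (simp_all add: field_simps)
  hence ni': "(m - \<nu> + 1) / 2 \<notin> \<int>" "(m + \<nu> + 1) / 2 \<notin> \<int>"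
    using nonint[OF ni(1)] nonint[OF ni(2)] by (metis Ints_1 Ints_diff diff_diff_eq2 add_diff_cancel_left')+
  have "lommel_S_formula m \<nu> z = lommel_expansion N z m \<nu>"
    using Suc.prems(1) by (intro Suc.IH ni) (simp add: m_def)
  thus ?case
    unfolding m lommel_S_formula_step[OF z0 ni'] lommel_expansion_step[OF z0] by simp
qed

section \<open>Passage to the limit in the parameters\<close>

lemma powr_le_powr_sum:
  assumes "t > (0::real)" "A1 \<le> r" "r \<le> A2"
  shows "t powr r \<le> t powr A1 + t powr A2"
proof (cases "t \<ge> 1")
  case True
  hence "t powr r \<le> t powr A2" using assms by (intro powr_mono) auto
  thus ?thesis by (smt (verit) powr_ge_zero)
next
  case False
  hence "t powr r \<le> t powr A1" using assms by (intro powr_mono') auto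
  thus ?thesis by (smt (verit) powr_ge_zero)
qed

lemma kint_tendsto_seq:
  assumes z: "Re z > 0" and a: "Re a + 1 > \<bar>Re \<nu>\<bar>" and X: "X \<longlonglongrightarrow> a" and Y: "Y \<longlonglongrightarrow> \<nu>"
  shows "(\<lambda>n. kint z (X n) (Y n)) \<longlonglongrightarrow> kint z a \<nu>"
proof -
  \<comment> \<open>B lies strictly between \<bar>Re \<nu>\<bar> and Re a + 1, which leaves room for
    A1 with B - 1 < A1 < Re a. From some index on, the orders have real part within B and the
    exponents have real part between A1 and A2, and the majorants with these extreme parameters are
    integrable.\<close>
  define B where "B = (\<bar>Re \<nu>\<bar> + Re a + 1) / 2"
  define A1 where "A1 = (B - 1 + Re a) / 2"
  define A2 where "A2 = Re a + 1"
  have B: "\<bar>Re \<nu>\<bar> < B" "B < Re a + 1" "B > 0" using a by (auto simp: B_def)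
  have A: "A1 < Re a" "Re a < A2" "B < A1 + 1" "B < A2 + 1" 
  proof -
    show "A1 < Re a" "B < A1 + 1" using B(2) by (simp_all add: A1_def field_simps)
    show "Re a < A2" "B < A2 + 1" using B(2) by (simp_all add: A2_def)
  qed
  have "(\<lambda>n. Re (X n)) \<longlonglongrightarrow> Re a" "(\<lambda>n. \<bar>Re (Y n)\<bar>) \<longlonglongrightarrow> \<bar>Re \<nu>\<bar>"
    using X Y by (auto intro!: tendsto_intros)
  hence "eventually (\<lambda>n. A1 < Re (X n)) sequentially" "eventually (\<lambda>n. Re (X n) < A2) sequentially"
    "eventually (\<lambda>n. \<bar>Re (Y n)\<bar> < B) sequentially"
    using A B order_tendstoD by blast+
  hence "eventually (\<lambda>n. A1 < Re (X n) \<and> Re (X n) < A2 \<and> \<bar>Re (Y n)\<bar> < B) sequentially"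
    by eventually_elim auto
  then obtain N where N: "\<And>n. n \<ge> N \<Longrightarrow> A1 < Re (X n) \<and> Re (X n) < A2 \<and> \<bar>Re (Y n)\<bar> < B"
    by (auto simp: eventually_sequentially)
  define X' where "X' n = X (n + N)" for n
  define Y' where "Y' n = Y (n + N)" for n
  have XY: "A1 < Re (X' n)" "Re (X' n) < A2" "\<bar>Re (Y' n)\<bar> < B" for n
    using N[of "n + N"] by (auto simp: X'_def Y'_def)
  have X': "X' \<longlonglongrightarrow> a" and Y': "Y' \<longlonglongrightarrow> \<nu>"
    unfolding X'_def Y'_def using X Y by (auto intro: LIMSEQ_ignore_initial_segment)
  let ?C = "(norm z)\<^sup>2 / (Re z)\<^sup>2"
  let ?K = "\<lambda>c A t. norm (of_real t powr of_real A * kk (of_real c) (t\<^sup>2 / 4))"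
  have Kint: "?K c A integrable_on {0<..}" if "\<bar>c\<bar> < A + 1" for c A
    using kk_t_integrable[of "of_real c" "of_real A"] that by (simp add: absolutely_integrable_on_def)
  have lim: "(\<lambda>n. kint z (X' n) (Y' n)) \<longlonglongrightarrow> kint z a \<nu>"
    unfolding kint_def
  proof (rule dominated_convergence)
    show "(\<lambda>t. of_real t powr X' n * kk (Y' n) (t\<^sup>2 / 4) / (1 + (of_real t / z)\<^sup>2)) integrable_on {0<..}" for n
      using kint_integrable[OF z, of "Y' n" "X' n"] XY[of n] A by (auto simp: absolutely_integrable_on_def)
    show "(\<lambda>t. ((?K B A1 t + ?K (- B) A1 t) + (?K B A2 t + ?K (- B) A2 t)) * ?C) integrable_on {0<..}"
      using A B by (intro integrable_on_mult_left integrable_add Kint) auto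
  next
    fix n and t :: real assume "t \<in> {0<..}"
    hence t: "t > 0" by simp
    hence y: "t\<^sup>2 / 4 > 0" by simp
    have "norm (of_real t powr X' n * kk (Y' n) (t\<^sup>2 / 4) / (1 + (of_real t / z)\<^sup>2)) =
       t powr Re (X' n) * norm (kk (Y' n) (t\<^sup>2 / 4)) * norm (1 / (1 + (complex_of_real t / z)\<^sup>2))"
      using t by (simp add: norm_mult norm_divide norm_of_real_powr)
    also have "\<dots> \<le> (t powr A1 + t powr A2) * (norm (kk (of_real B) (t\<^sup>2 / 4)) + norm (kk (of_real (- B)) (t\<^sup>2 / 4))) * ?C"
      using XY[of n] t y by (intro mult_mono powr_le_powr_sum kk_bound one_plus_square_bound(1)[OF z] mult_nonneg_nonneg add_nonneg_nonneg) auto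
    also have "\<dots> = ((?K B A1 t + ?K (- B) A1 t) + (?K B A2 t + ?K (- B) A2 t)) * ?C"
      using t by (simp add: norm_mult norm_of_real_powr algebra_simps add_divide_distrib)
    finally show "norm (of_real t powr X' n * kk (Y' n) (t\<^sup>2 / 4) / (1 + (of_real t / z)\<^sup>2)) \<le>
       ((?K B A1 t + ?K (- B) A1 t) + (?K B A2 t + ?K (- B) A2 t)) * ?C" .
  next
    fix t :: real assume "t \<in> {0<..}"
    hence t: "t > 0" by simp
    have "(\<lambda>n. exp (X' n * of_real (ln t))) \<longlonglongrightarrow> exp (a * of_real (ln t))"
      by (intro tendsto_intros X')
    moreover have "(\<lambda>n. kk (Y' n) (t\<^sup>2 / 4)) \<longlonglongrightarrow> kk \<nu> (t\<^sup>2 / 4)"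
      by (rule kk_tendsto[OF _ Y']) (use t in simp)
    ultimately show "(\<lambda>n. of_real t powr X' n * kk (Y' n) (t\<^sup>2 / 4) / (1 + (of_real t / z)\<^sup>2)) \<longlonglongrightarrow>
        of_real t powr a * kk \<nu> (t\<^sup>2 / 4) / (1 + (of_real t / z)\<^sup>2)"
      unfolding powr_of_real_exp[OF t] by (intro tendsto_divide tendsto_mult tendsto_const one_plus_square_bound(2)[OF z])
  qed
  show ?thesis
    by (rule LIMSEQ_offset[where k = N]) (use lim in \<open>simp add: X'_def Y'_def\<close>)
qed

lemma tendsto_powr_exponent:
  assumes "(X \<longlongrightarrow> a) F" "z \<noteq> 0"
  shows "((\<lambda>n. z powr (X n)) \<longlongrightarrow> z powr (a::complex)) F"
proof -
  have "((\<lambda>n. exp (X n * Ln z)) \<longlongrightarrow> exp (a * Ln z)) F" by (intro tendsto_intros assms)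
  thus ?thesis using assms(2) by (simp add: powr_def)
qed

lemma lommel_expansion_tendsto_seq:
  assumes z: "Re z > 0" and \<mu>: "Re \<mu> + \<bar>Re \<nu>\<bar> < 2 * real N + 1" and X: "X \<longlonglongrightarrow> \<mu>" and Y: "Y \<longlonglongrightarrow> \<nu>"
  shows "(\<lambda>n. lommel_expansion N z (X n) (Y n)) \<longlonglongrightarrow> lommel_expansion N z \<mu> \<nu>"
proof -
  have z0: "z \<noteq> 0" using z by auto
  have "(\<lambda>n. kint z (2 * of_nat N - X n) (Y n)) \<longlonglongrightarrow> kint z (2 * of_nat N - \<mu>) \<nu>"
    by (rule kint_tendsto_seq[OF z]) (use \<mu> X Y in \<open>auto intro!: tendsto_intros\<close>)
  thus ?thesis
    unfolding lommel_expansion_def lommel_a_def using z0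
    by (intro tendsto_intros tendsto_powr_exponent isCont_tendsto_compose[OF isCont_rGamma[OF continuous_ident]] X Y) auto
qed

lemma lommel_expansion_tendsto:
  assumes z: "Re z > 0" and \<mu>: "Re \<mu> + \<bar>Re \<nu>\<bar> < 2 * real N + 1"
  shows "((\<lambda>m. lommel_expansion N z m \<nu>) \<longlongrightarrow> lommel_expansion N z \<mu> \<nu>) (at \<mu>)"
    and "((\<lambda>v. lommel_expansion N z \<mu> v) \<longlongrightarrow> lommel_expansion N z \<mu> \<nu>) (at \<nu>)"
  unfolding tendsto_at_iff_sequentially o_def
  by (intro allI impI lommel_expansion_tendsto_seq assms tendsto_const, assumption)+

section \<open>Exceptional parameters and continuity of the formula for S\<close>

definition regular_params :: "complex \<Rightarrow> complex \<Rightarrow> bool" where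
  "regular_params \<mu> \<nu> \<longleftrightarrow> (\<mu> - \<nu> + 1) / 2 \<notin> \<int>\<^sub>\<le>\<^sub>0 \<and> (\<mu> + \<nu> + 1) / 2 \<notin> \<int>\<^sub>\<le>\<^sub>0"

lemma lommel_exceptional_iff: "lommel_exceptional \<mu> \<nu> \<longleftrightarrow> \<not> regular_params \<mu> \<nu>"
proof -
  have "(w + 1) / 2 \<in> \<int>\<^sub>\<le>\<^sub>0 \<longleftrightarrow> (\<exists>k::nat. w = - (2 * of_nat k + 1))" for w :: complex
  proof
    assume "(w + 1) / 2 \<in> \<int>\<^sub>\<le>\<^sub>0"
    then obtain k where "(w + 1) / 2 = - of_nat k" by (elim nonpos_Ints_cases')
    hence "w = - (2 * of_nat k + 1)" by (simp add: field_simps eq_neg_iff_add_eq_0)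
    thus "\<exists>k::nat. w = - (2 * of_nat k + 1)" by blast
  next
    assume "\<exists>k::nat. w = - (2 * of_nat k + 1)"
    then obtain k :: nat where "w = - (2 * of_nat k + 1)" by blast
    hence "(w + 1) / 2 = - of_nat k" by simp
    thus "(w + 1) / 2 \<in> \<int>\<^sub>\<le>\<^sub>0" by simp
  qed
  from this[of "\<mu> - \<nu>"] this[of "\<mu> + \<nu>"] show ?thesis
    unfolding lommel_exceptional_def regular_params_def by blast
qed

lemma lommel_s_tendsto:
  assumes reg: "regular_params \<mu> \<nu>" and z: "z \<noteq> 0" and X: "(X \<longlongrightarrow> \<mu>) F" and Y: "(Y \<longlongrightarrow> \<nu>) F"
  shows "((\<lambda>n. lommel_s (X n) (Y n) z) \<longlongrightarrow> lommel_s \<mu> \<nu> z) F"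
proof -
  have r: "(\<mu> - \<nu> + 1) / 2 \<notin> \<int>\<^sub>\<le>\<^sub>0" "(\<mu> + \<nu> + 1) / 2 \<notin> \<int>\<^sub>\<le>\<^sub>0" using reg by (auto simp: regular_params_def)
  have shift: "b + 1 \<notin> \<int>\<^sub>\<le>\<^sub>0" if "b \<notin> \<int>\<^sub>\<le>\<^sub>0" for b :: complex
    using that by (metis plus_one_in_nonpos_Ints_imp)
  have e: "(\<mu> - \<nu> + 3) / 2 = (\<mu> - \<nu> + 1) / 2 + 1" "(\<mu> + \<nu> + 3) / 2 = (\<mu> + \<nu> + 1) / 2 + 1"
    by (simp_all add: field_simps)
  have b: "(\<mu> - \<nu> + 3) / 2 \<notin> \<int>\<^sub>\<le>\<^sub>0" "(\<mu> + \<nu> + 3) / 2 \<notin> \<int>\<^sub>\<le>\<^sub>0"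
    unfolding e using shift[OF r(1)] shift[OF r(2)] by blast+
  have "(\<mu> + 1)\<^sup>2 - \<nu>\<^sup>2 = 4 * ((\<mu> - \<nu> + 1) / 2 * ((\<mu> + \<nu> + 1) / 2))"
    by (simp add: power2_eq_square field_simps)
  moreover have "(\<mu> - \<nu> + 1) / 2 \<noteq> 0" "(\<mu> + \<nu> + 1) / 2 \<noteq> 0" using r by (metis zero_in_nonpos_Ints)+
  ultimately have nz: "(\<mu> + 1)\<^sup>2 - \<nu>\<^sup>2 \<noteq> 0" by (metis mult_eq_0_iff zero_neq_numeral)
  show ?thesis
    unfolding lommel_s_def
    by (intro tendsto_mult tendsto_divide tendsto_diff tendsto_power tendsto_add tendsto_const
        tendsto_powr_exponent hyp1F2_tendsto X Y z nz b) simp_all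
qed

text \<open>Convergence of \<open>besselY\<close> is a hypothesis because at integer order it is
  proved only in \<open>besselY_tendsto\<close>, which itself builds on this lemma for a fixed
  non-integer order.\<close>

lemma lommel_S_formula_tendsto:
  assumes reg: "regular_params \<mu> \<nu>" and z: "z \<noteq> 0" and X: "(X \<longlongrightarrow> \<mu>) F" and Y: "(Y \<longlongrightarrow> \<nu>) F"
    and bY: "((\<lambda>n. besselY (Y n) z) \<longlongrightarrow> besselY \<nu> z) F"
  shows "((\<lambda>n. lommel_S_formula (X n) (Y n) z) \<longlongrightarrow> lommel_S_formula \<mu> \<nu> z) F"
proof -
  have r: "(\<mu> - \<nu> + 1) / 2 \<notin> \<int>\<^sub>\<le>\<^sub>0" "(\<mu> + \<nu> + 1) / 2 \<notin> \<int>\<^sub>\<le>\<^sub>0" using reg by (auto simp: regular_params_def)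
  have t: "((\<lambda>n. sin ((X n - Y n) * of_real pi / 2)) \<longlongrightarrow> sin ((\<mu> - \<nu>) * of_real pi / 2)) F"
    "((\<lambda>n. cos ((X n - Y n) * of_real pi / 2)) \<longlongrightarrow> cos ((\<mu> - \<nu>) * of_real pi / 2)) F"
  proof -
    have "((\<lambda>n. (X n - Y n) * of_real pi / 2) \<longlongrightarrow> (\<mu> - \<nu>) * of_real pi / 2) F"
      by (intro tendsto_divide tendsto_mult tendsto_diff tendsto_const X Y) simp
    thus "((\<lambda>n. sin ((X n - Y n) * of_real pi / 2)) \<longlongrightarrow> sin ((\<mu> - \<nu>) * of_real pi / 2)) F"
      "((\<lambda>n. cos ((X n - Y n) * of_real pi / 2)) \<longlongrightarrow> cos ((\<mu> - \<nu>) * of_real pi / 2)) F"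
      by (rule isCont_tendsto_compose[rotated], simp)+
  qed
  show ?thesis
    unfolding lommel_S_formula_def
    by (intro t lommel_s_tendsto[OF reg z X Y] tendsto_mult tendsto_divide tendsto_diff tendsto_add tendsto_const
        tendsto_powr_exponent tendsto_Gamma besselJ_tendsto bY X Y z r) simp_all
qed

lemma Ints_isolated:
  fixes w :: complex
  obtains d where "d > 0" "\<And>k. k \<in> \<int> \<Longrightarrow> k \<noteq> w \<Longrightarrow> d \<le> norm (w - k)"
proof (cases "w \<in> \<int>")
  case False
  obtain d where "d > 0" "\<And>m. m \<in> \<int> \<Longrightarrow> d \<le> norm (w - m)" using nonint_dist[OF False] by metis
  thus ?thesis using that by blast
next
  case True
  have "1 \<le> norm (w - k)" if "k \<in> \<int>" "k \<noteq> w" for k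
  proof -
    obtain a b where ab: "w = of_int a" "k = of_int b" using True \<open>k \<in> \<int>\<close> by (auto elim!: Ints_cases)
    hence "a \<noteq> b" using that by auto
    hence "\<bar>a - b\<bar> \<ge> 1" by linarith
    have "norm (w - k) = \<bar>of_int (a - b)\<bar>" unfolding ab of_int_diff[symmetric] by (rule norm_of_int)
    also have "\<dots> \<ge> 1" using \<open>\<bar>a - b\<bar> \<ge> 1\<close> by linarith
    finally show ?thesis .
  qed
  thus ?thesis using that[of 1] by simp
qed

lemma eventually_at_not_Ints:
  fixes w c :: complex
  assumes c: "c \<noteq> 0"
  shows "eventually (\<lambda>m. c * m + b \<notin> \<int>) (at w)"
proof -
  obtain d where d: "d > 0" "\<And>k. k \<in> \<int> \<Longrightarrow> k \<noteq> c * w + b \<Longrightarrow> d \<le> norm (c * w + b - k)"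
    using Ints_isolated[of "c * w + b"] by metis
  have "eventually (\<lambda>m. m \<in> ball w (d / norm c) - {w}) (at w)"
    using d c by (intro eventually_at_in_open) auto
  thus ?thesis
  proof eventually_elim
    case (elim m)
    have "norm (c * w + b - (c * m + b)) = norm c * norm (w - m)"
      by (simp add: norm_mult[symmetric] algebra_simps)
    also have "\<dots> < d" using elim c by (simp add: dist_norm field_simps)
    finally have "norm (c * w + b - (c * m + b)) < d" .
    moreover have "c * m + b \<noteq> c * w + b" using elim c by auto
    ultimately show ?case using d(2)[of "c * m + b"] by fastforce
  qed
qed

lemma eventually_regular:
  "eventually (\<lambda>m. regular_params m \<nu>) (at \<mu>)" "eventually (\<lambda>v. regular_params \<mu> v) (at \<nu>)"
proof -
  have *: "w \<notin> \<int>\<^sub>\<le>\<^sub>0" if "w \<notin> \<int>" for w :: complex using that nonpos_Ints_Int by blast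
  have "eventually (\<lambda>m. 1/2 * m + (1 - \<nu>) / 2 \<notin> \<int>) (at \<mu>)" "eventually (\<lambda>m. 1/2 * m + (1 + \<nu>) / 2 \<notin> \<int>) (at \<mu>)"
    by (rule eventually_at_not_Ints, simp)+
  thus "eventually (\<lambda>m. regular_params m \<nu>) (at \<mu>)"
  proof eventually_elim
    case (elim m)
    have e: "1/2 * m + (1 - \<nu>) / 2 = (m - \<nu> + 1) / 2" "1/2 * m + (1 + \<nu>) / 2 = (m + \<nu> + 1) / 2"
      by (simp_all add: add_divide_distrib diff_divide_distrib)
    show ?case using elim[unfolded e] * by (simp add: regular_params_def)
  qed
  have "eventually (\<lambda>v. - (1/2) * v + (1 + \<mu>) / 2 \<notin> \<int>) (at \<nu>)" "eventually (\<lambda>v. 1/2 * v + (1 + \<mu>) / 2 \<notin> \<int>) (at \<nu>)"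
    by (rule eventually_at_not_Ints, simp)+
  thus "eventually (\<lambda>v. regular_params \<mu> v) (at \<nu>)"
  proof eventually_elim
    case (elim v)
    have e: "- (1/2) * v + (1 + \<mu>) / 2 = (\<mu> - v + 1) / 2" "1/2 * v + (1 + \<mu>) / 2 = (\<mu> + v + 1) / 2"
      by (simp_all add: add_divide_distrib diff_divide_distrib)
    show ?case using elim[unfolded e] * by (simp add: regular_params_def)
  qed
qed

lemma eventually_real_shift_not_Ints:
  "eventually (\<lambda>n. r - 1 / (2 * real (Suc n)) \<notin> \<int>) sequentially"
proof -
  \<comment> \<open>The largest integer strictly below r: the shifted values end up in the open
    interval (m, m + 1) even when r is itself an integer.\<close>
  define m where "m = real_of_int (\<lceil>r\<rceil> - 1)"
  have m: "m < r" "r \<le> m + 1" unfolding m_def by linarith+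
  have "(\<lambda>n. r - 1 / (2 * real (Suc n))) \<longlonglongrightarrow> r - 0"
    by (intro tendsto_intros) real_asymp
  hence "eventually (\<lambda>n. m < r - 1 / (2 * real (Suc n))) sequentially"
    using m by (auto intro: order_tendstoD)
  thus ?thesis
  proof eventually_elim
    case (elim n)
    have "1 / (2 * real (Suc n)) > 0" by simp
    hence u: "r - 1 / (2 * real (Suc n)) < m + 1" using m by linarith
    show ?case
    proof
      assume "r - 1 / (2 * real (Suc n)) \<in> \<int>"
      then obtain k where "r - 1 / (2 * real (Suc n)) = of_int k" by (auto elim: Ints_cases)
      with elim u have "real_of_int (\<lceil>r\<rceil> - 1) < of_int k" "real_of_int k < of_int (\<lceil>r\<rceil> - 1 + 1)"
        unfolding m_def by simp_all
      thus False unfolding of_int_less_iff by linarith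
    qed
  qed
qed

text \<open>\<open>lommel_expansion_generic\<close> restricts real parts and so excludes whole
  lines, which meet every punctured neighbourhood of their points. Shifting \<mu> by 1 / (n + 1)
  along the real direction leaves these lines; the real parts in question move by half of
  that.\<close>

lemma lommel_expansion_nonint:
  assumes \<nu>: "\<nu> \<notin> \<int>" and z: "Re z > 0" and \<mu>: "Re \<mu> + \<bar>Re \<nu>\<bar> < 2 * real N + 1"
    and reg: "regular_params \<mu> \<nu>"
  shows "lommel_S_formula \<mu> \<nu> z = lommel_expansion N z \<mu> \<nu>"
proof -
  have z0: "z \<noteq> 0" using z by auto
  define X where "X n = \<mu> + of_real (1 / real (Suc n))" for n
  have "(\<lambda>n. 1 / real (Suc n)) \<longlonglongrightarrow> 0" by real_asymp
  hence lim0: "(\<lambda>n. complex_of_real (1 / real (Suc n))) \<longlonglongrightarrow> of_real 0" by (rule tendsto_of_real)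
  have X: "X \<longlonglongrightarrow> \<mu>" unfolding X_def using tendsto_add[OF tendsto_const[of \<mu>] lim0] by simp
  have "(\<lambda>n. Re (X n) + \<bar>Re \<nu>\<bar>) \<longlonglongrightarrow> Re \<mu> + \<bar>Re \<nu>\<bar>" by (intro tendsto_intros X)
  hence "eventually (\<lambda>n. Re (X n) + \<bar>Re \<nu>\<bar> < 2 * real N + 1) sequentially"
    using \<mu> by (rule order_tendstoD)
  hence ev: "eventually (\<lambda>n. lommel_S_formula (X n) \<nu> z = lommel_expansion N z (X n) \<nu>) sequentially"
    using eventually_real_shift_not_Ints[of "Re ((\<nu> - \<mu> + 1) / 2)"] eventually_real_shift_not_Ints[of "Re ((1 - \<mu> - \<nu>) / 2)"]
  proof eventually_elim
    case (elim n)
    have d: "Re ((\<nu> - (\<mu> + of_real e) + 1) / 2) = Re ((\<nu> - \<mu> + 1) / 2) - e / 2"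
      "Re ((1 - (\<mu> + of_real e) - \<nu>) / 2) = Re ((1 - \<mu> - \<nu>) / 2) - e / 2" for e
      by (simp_all add: diff_divide_distrib add_divide_distrib)
    have h: "1 / real (Suc n) / 2 = 1 / (2 * real (Suc n))" by simp
    have "Re ((\<nu> - X n + 1) / 2) \<notin> \<int>" "Re ((1 - X n - \<nu>) / 2) \<notin> \<int>"
      unfolding X_def d h by (rule elim(2), rule elim(3))
    with elim(1) show ?case by (intro lommel_expansion_generic[OF \<nu> z])
  qed
  have "(\<lambda>n. lommel_expansion N z (X n) \<nu>) \<longlonglongrightarrow> lommel_expansion N z \<mu> \<nu>"
    by (intro lommel_expansion_tendsto_seq z \<mu> X tendsto_const)
  moreover have "(\<lambda>n. lommel_S_formula (X n) \<nu> z) \<longlonglongrightarrow> lommel_S_formula \<mu> \<nu> z"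
    by (intro lommel_S_formula_tendsto reg z0 X tendsto_const)
  hence "(\<lambda>n. lommel_expansion N z (X n) \<nu>) \<longlonglongrightarrow> lommel_S_formula \<mu> \<nu> z"
    using ev by (rule Lim_transform_eventually)
  ultimately show ?thesis by (intro LIMSEQ_unique)
qed

text \<open>The limit defining \<open>Y\<^sub>\<nu>\<close> for integer \<open>\<nu>\<close> exists because for \<open>\<mu> = \<i>\<close> every other
  ingredient of the formula for \<open>S\<close> is continuous in \<open>\<nu>\<close>, and so is the integral representation.\<close>

lemma besselY_tendsto:
  assumes \<nu>: "\<nu> \<in> \<int>" and z: "Re z > 0"
  shows "((\<lambda>v. besselY v z) \<longlongrightarrow> besselY \<nu> z) (at \<nu>)"
proof -
  have z0: "z \<noteq> 0" using z by auto
  have im: "Im \<nu> = 0" using \<nu> by (auto elim!: Ints_cases)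
  obtain N :: nat where "\<bar>Re \<nu>\<bar> < real N" using reals_Archimedean2 by blast
  hence N: "Re \<i> + \<bar>Re \<nu>\<bar> < 2 * real N + 1" by simp
  \<comment> \<open>As \<nu> is real, the arguments (\<i> \<plusminus> \<nu> + 1) / 2 are not real,
    so no Gamma pole is met. For the same reason the cosine in front of Y does not vanish.\<close>
  have reg: "regular_params \<i> \<nu>"
  proof -
    have "w \<notin> \<int>\<^sub>\<le>\<^sub>0" if "Im w \<noteq> 0" for w :: complex using that by (auto elim!: nonpos_Ints_cases)
    thus ?thesis using im by (simp add: regular_params_def)
  qed
  define c where "c v = cos ((\<i> - v) * of_real pi / 2)" for v :: complex
  have c0: "c \<nu> \<noteq> 0"
  proof
    assume "c \<nu> = 0"
    then obtain n :: int where "(\<i> - \<nu>) * of_real pi / 2 = of_real (n * pi) + of_real pi / 2"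
      by (auto simp: c_def cos_eq_0)
    hence "Im ((\<i> - \<nu>) * of_real pi / 2) = Im (of_real (n * pi) + of_real pi / 2)" by (rule arg_cong)
    thus False using im by simp
  qed
  have clim: "(c \<longlongrightarrow> c \<nu>) (at \<nu>)" unfolding c_def by (intro tendsto_intros) simp
  define G where "G v = 2 powr (\<i> - 1) * Gamma ((\<i> - v + 1) / 2) * Gamma ((\<i> + v + 1) / 2)" for v
  have r: "(\<i> - \<nu> + 1) / 2 \<notin> \<int>\<^sub>\<le>\<^sub>0" "(\<i> + \<nu> + 1) / 2 \<notin> \<int>\<^sub>\<le>\<^sub>0" using reg by (auto simp: regular_params_def)
  have Glim: "(G \<longlongrightarrow> G \<nu>) (at \<nu>)"
    unfolding G_def using r by (intro tendsto_mult tendsto_const tendsto_Gamma tendsto_divide tendsto_add tendsto_diff tendsto_ident_at) auto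
  have G0: "G \<nu> \<noteq> 0" unfolding G_def using r by (simp add: Gamma_eq_zero_iff)
  \<comment> \<open>The formula for S solved for Y, with the expansion in place of S; every
    ingredient is continuous at \<nu>.\<close>
  define H where "H v = (sin ((\<i> - v) * of_real pi / 2) * besselJ v z - (lommel_expansion N z \<i> v - lommel_s \<i> v z) / G v) / c v" for v
  have slim: "((\<lambda>v. lommel_s \<i> v z) \<longlongrightarrow> lommel_s \<i> \<nu> z) (at \<nu>)"
    by (rule lommel_s_tendsto[OF reg z0 tendsto_const tendsto_ident_at])
  have sinlim: "((\<lambda>v. sin ((\<i> - v) * of_real pi / 2)) \<longlongrightarrow> sin ((\<i> - \<nu>) * of_real pi / 2)) (at \<nu>)"
    by (intro tendsto_intros) simp
  have Hlim: "(H \<longlongrightarrow> H \<nu>) (at \<nu>)"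
    unfolding H_def
    by (intro sinlim tendsto_divide tendsto_diff tendsto_mult tendsto_const besselJ_tendsto tendsto_ident_at
        slim Glim clim G0 c0 z0 lommel_expansion_tendsto(2)[OF z N])
  have "(\<lambda>v. Re \<i> + \<bar>Re v\<bar>) \<midarrow>\<nu>\<rightarrow> Re \<i> + \<bar>Re \<nu>\<bar>" by (intro tendsto_intros)
  hence e1: "eventually (\<lambda>v. Re \<i> + \<bar>Re v\<bar> < 2 * real N + 1) (at \<nu>)" using N by (rule order_tendstoD)
  have e2: "eventually (\<lambda>v. v \<notin> \<int>) (at \<nu>)" using eventually_at_not_Ints[of 1 0 \<nu>] by simp
  have e3: "eventually (\<lambda>v. c v \<noteq> 0) (at \<nu>)" "eventually (\<lambda>v. G v \<noteq> 0) (at \<nu>)"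
    using clim c0 Glim G0 by (auto intro: tendsto_imp_eventually_ne)
  have ev: "eventually (\<lambda>v. besselY_aux v z = H v \<and> besselY v z = H v) (at \<nu>)"
    using e1 e2 e3 eventually_regular(2)[of \<i> \<nu>]
  proof eventually_elim
    case (elim v)
    have "lommel_S_formula \<i> v z = lommel_expansion N z \<i> v"
      using elim by (intro lommel_expansion_nonint z) auto
    hence "lommel_expansion N z \<i> v = lommel_s \<i> v z + G v * (sin ((\<i> - v) * of_real pi / 2) * besselJ v z - c v * besselY v z)"
      by (simp add: lommel_S_formula_def G_def c_def)
    hence "besselY v z = H v" using elim by (simp add: H_def field_simps)
    thus ?case using elim by (simp add: besselY_def)
  qed
  have "((\<lambda>v. besselY_aux v z) \<longlongrightarrow> H \<nu>) (at \<nu>)"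
    using Hlim by (rule Lim_transform_eventually) (use ev in \<open>auto elim: eventually_mono\<close>)
  hence "besselY \<nu> z = H \<nu>" using \<nu> by (simp add: besselY_def tendsto_Lim)
  moreover have "((\<lambda>v. besselY v z) \<longlongrightarrow> H \<nu>) (at \<nu>)"
    using Hlim by (rule Lim_transform_eventually) (use ev in \<open>auto elim: eventually_mono\<close>)
  ultimately show ?thesis by simp
qed

text \<open>An integer \<nu> is approached through non-integer orders with \<mu> fixed; both sides
  are continuous there, the left one thanks to \<open>besselY_tendsto\<close>.\<close>

lemma lommel_expansion_regular:
  assumes z: "Re z > 0" and \<mu>: "Re \<mu> + \<bar>Re \<nu>\<bar> < 2 * real N + 1" and reg: "regular_params \<mu> \<nu>"
  shows "lommel_S_formula \<mu> \<nu> z = lommel_expansion N z \<mu> \<nu>"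
proof (cases "\<nu> \<in> \<int>")
  case False
  thus ?thesis using lommel_expansion_nonint assms by blast
next
  case True
  have z0: "z \<noteq> 0" using z by auto
  have "(\<lambda>v. Re \<mu> + \<bar>Re v\<bar>) \<midarrow>\<nu>\<rightarrow> Re \<mu> + \<bar>Re \<nu>\<bar>" by (intro tendsto_intros)
  hence e1: "eventually (\<lambda>v. Re \<mu> + \<bar>Re v\<bar> < 2 * real N + 1) (at \<nu>)" using \<mu> by (rule order_tendstoD)
  have e2: "eventually (\<lambda>v. v \<notin> \<int>) (at \<nu>)" using eventually_at_not_Ints[of 1 0 \<nu>] by simp
  have ev: "eventually (\<lambda>v. lommel_expansion N z \<mu> v = lommel_S_formula \<mu> v z) (at \<nu>)"
    using e1 e2 eventually_regular(2)[of \<mu> \<nu>]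
    by eventually_elim (metis lommel_expansion_nonint z)
  have "((\<lambda>v. lommel_S_formula \<mu> v z) \<longlongrightarrow> lommel_S_formula \<mu> \<nu> z) (at \<nu>)"
    by (intro lommel_S_formula_tendsto reg z0 tendsto_const tendsto_ident_at besselY_tendsto True z)
  moreover have "((\<lambda>v. lommel_S_formula \<mu> v z) \<longlongrightarrow> lommel_expansion N z \<mu> \<nu>) (at \<nu>)"
    using lommel_expansion_tendsto(2)[OF z \<mu>] ev by (rule Lim_transform_eventually)
  ultimately show ?thesis by (rule tendsto_unique[rotated]) simp
qed

text \<open>At exceptional parameters a Gamma factor in the formula for S has a pole, but for nearby
  \<mu> the formula equals the expansion, which is continuous. Hence the limit in
  \<open>lommelS\<close> exists and has the right value.\<close>

lemma lommelS_expansion: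
  assumes z: "Re z > 0" and \<mu>: "Re \<mu> + \<bar>Re \<nu>\<bar> < 2 * real N + 1"
  shows "lommelS \<mu> \<nu> z = lommel_expansion N z \<mu> \<nu>"
proof (cases "regular_params \<mu> \<nu>")
  case True
  thus ?thesis using lommel_expansion_regular[OF z \<mu>] by (simp add: lommelS_def lommel_exceptional_iff)
next
  case False
  have "(\<lambda>m. Re m + \<bar>Re \<nu>\<bar>) \<midarrow>\<mu>\<rightarrow> Re \<mu> + \<bar>Re \<nu>\<bar>" by (intro tendsto_intros)
  hence e1: "eventually (\<lambda>m. Re m + \<bar>Re \<nu>\<bar> < 2 * real N + 1) (at \<mu>)" using \<mu> by (rule order_tendstoD)
  have ev: "eventually (\<lambda>m. lommel_expansion N z m \<nu> = lommel_S_formula m \<nu> z) (at \<mu>)"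
    using e1 eventually_regular(1)[of \<nu> \<mu>]
    by eventually_elim (metis lommel_expansion_regular z)
  have "((\<lambda>m. lommel_S_formula m \<nu> z) \<longlongrightarrow> lommel_expansion N z \<mu> \<nu>) (at \<mu>)"
    using lommel_expansion_tendsto(1)[OF z \<mu>] ev by (rule Lim_transform_eventually)
  thus ?thesis using False by (simp add: lommelS_def lommel_exceptional_iff tendsto_Lim)
qed

theorem theorem1:
  fixes \<mu> \<nu> z :: complex and N :: nat
  assumes "z \<noteq> 0" and "\<bar>Arg z\<bar> < pi / 2"
    and "Re \<mu> + \<bar>Re \<nu>\<bar> < 2 * real N + 1"
  shows "(\<lambda>t::real. of_real t powr (2 * of_nat N - \<mu>) * besselK \<nu> (of_real t)
            / (1 + (of_real t / z)\<^sup>2)) integrable_on {0<..}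
    \<and> lommel_R N z \<mu> \<nu> =
      (-1) ^ N * 2 powr (\<mu> + 1) * z powr (\<mu> - 2 * of_nat N - 1)
        / (Gamma ((\<nu> - \<mu> + 1) / 2) * Gamma ((1 - \<mu> - \<nu>) / 2))
      * integral {0<..} (\<lambda>t::real. of_real t powr (2 * of_nat N - \<mu>) * besselK \<nu> (of_real t)
            / (1 + (of_real t / z)\<^sup>2))"
proof -
  have z: "Re z > 0" using assms(1,2) Arg_Re_pos by blast
  let ?f = "\<lambda>t::real. of_real t powr (2 * of_nat N - \<mu>) * besselK \<nu> (of_real t) / (1 + (of_real t / z)\<^sup>2)"
  let ?g = "\<lambda>t::real. of_real t powr (2 * of_nat N - \<mu>) * kk \<nu> (t\<^sup>2 / 4) / (1 + (of_real t / z)\<^sup>2)"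
  have eq: "?f t = ?g t" if "t \<in> {0<..}" for t
    using that by (simp add: besselK_kk)
  have "?g integrable_on {0<..}"
    using kint_integrable[OF z, of \<nu> "2 * of_nat N - \<mu>"] assms(3) by (simp add: absolutely_integrable_on_def)
  hence "?f integrable_on {0<..}"
    by (rule integrable_eq) (rule eq[symmetric])
  moreover have "integral {0<..} ?f = kint z (2 * of_nat N - \<mu>) \<nu>"
    unfolding kint_def by (rule integral_cong[OF eq])
  \<comment> \<open>At a pole Gamma takes the value 0 in HOL, so the quotient in the theorem is 0
    there, in agreement with \<open>rGamma\<close>.\<close>
  moreover have "lommel_R N z \<mu> \<nu> = (-1) ^ N * 2 powr (\<mu> + 1) * z powr (\<mu> - 2 * of_nat N - 1)
        / (Gamma ((\<nu> - \<mu> + 1) / 2) * Gamma ((1 - \<mu> - \<nu>) / 2)) * kint z (2 * of_nat N - \<mu>) \<nu>"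
    unfolding lommel_R_def lommelS_expansion[OF z assms(3)] lommel_expansion_def
    by (simp only: rGamma_inverse_Gamma divide_inverse inverse_mult_distrib add_diff_cancel_left')
  ultimately show ?thesis by (simp only:)
qed

end
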